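(* Let $X=(a_1,\dots,a_N)$ be a finite list of nonzero vectors spanning the $s$-dimensional vector space $V$, and let $A=S[V]$. (1) The annihilator in $A$ of $u_X$ is the ideal $I_X$ generated by the elements $M_Y=\prod_{x\in Y}x$, as $Y$ runs over the cocircuits of $X$. Thus $Q_X\simeq A_X$ as graded $A$-modules. (2) Given a basis $\underline b=(a_{i_1},\dots,a_{i_s})$ extracted from $X$, set $$u_{\underline b}:=\Big(\prod_{a\in X-B(\underline b)}a\Big)u_X .$$ The elements $u_{\underline b}$, as $\underline b$ runs over all bases extracted from $X$, form a basis of $Q_X$.
   Context: $V$ is an $s$-dimensional complex vector space, $U=V^*$, and $A:=S[V]$ is the symmetric algebra, identified with polynomial functions on $U$. $X=(a_1,\dots,a_N)$ is an ordered list of nonzero vectors (repetitions allowed) spanning $V$; sublists are identified with sets of indices. A sublist $Y\subset X$ is a cocircuit if the elements of $X-Y$ do not span $V$. $A_X:=A/I_X$, graded by degree. $d_X:=\prod_{a\in X}a$ and $R_X:=S[V][d_X^{-1}]$. For $k\ge 0$, $R_{X,k}\subset R_X$ is the span of all fractions $f\prod_{a\in X}a^{-h_a}$ with $f\in S[V]$, $h_a\ge 0$, such that the vectors $a$ with $h_a>0$ span a space of dimension $\le k$; $R_{X,s}=R_X$. $P_X:=R_X/R_{X,s-1}$, $u_X\in P_X$ is the class of $d_X^{-1}$, and $Q_X:=S[V]u_X\subset P_X$. The grading on $R_X$ and $P_X$ is the natural one (degree as functions) shifted by $N$ so that $u_X$ has degree $0$. A basis extracted from $X$ is a sublist $\underline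 b=(a_{i_1},\dots,a_{i_s})$, $i_1<\dots<i_s$, which is a basis of $V$ (distinct index sets count as distinct). An element $a_i$ of $X$ breaks $\underline b$ if there is $1\le e\le s$ with $i\le i_e$ and $a_i$ in the span of $a_{i_e},\dots,a_{i_s}$. $B(\underline b)$ is the sublist (by index) of elements of $X$ breaking $\underline b$. *)

theory Defs
  imports Complex_Main "HOL-Algebra.QuotRing" "HOL-Algebra.Module"
begin

text \<open>
  Modules are \<^emph>\<open>HOL-Algebra\<close> module records. The fields \<open>mult\<close> and \<open>one\<close> play no role for
  a module; they carry dummy values in \<open>quot_module\<close>.
\<close>

definition quot_module :: "('a, 'm) module \<Rightarrow> 'm set \<Rightarrow> ('a, 'm set) module" where
  "quot_module M N =
     \<lparr>carrier = a_rcosets\<^bsub>M\<^esub> N, mult = (\<lambda>_ _. N), one = N, zero = N, add = set_add M,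
      smult = (\<lambda>r C. \<Union>c\<in>C. N +>\<^bsub>M\<^esub> (r \<odot>\<^bsub>M\<^esub> c))\<rparr>"

definition quot_ring_module :: "('a, 'x) ring_scheme \<Rightarrow> 'a set \<Rightarrow> ('a, 'a set) module" where
  "quot_ring_module R I =
     ring.extend (R Quot I) (module.fields (\<lambda>r C. (I +>\<^bsub>R\<^esub> r) \<otimes>\<^bsub>R Quot I\<^esub> C))"

definition cyclic_submodule :: "('a, 'x) ring_scheme \<Rightarrow> ('a, 'm) module \<Rightarrow> 'm \<Rightarrow> ('a, 'm) module" where
  "cyclic_submodule R M m = M\<lparr>carrier := {r \<odot>\<^bsub>M\<^esub> m | r. r \<in> carrier R}\<rparr>"

definition annihilator_of :: "('a, 'x) ring_scheme \<Rightarrow> ('a, 'm) module \<Rightarrow> 'm \<Rightarrow> 'a set" where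
  "annihilator_of R M m = {r \<in> carrier R. r \<odot>\<^bsub>M\<^esub> m = \<zero>\<^bsub>M\<^esub>}"

definition module_isos :: "('a, 'x) ring_scheme \<Rightarrow> ('a, 'm) module \<Rightarrow> ('a, 'n) module \<Rightarrow> ('m \<Rightarrow> 'n) set" where
  "module_isos R M N =
     {h. bij_betw h (carrier M) (carrier N) \<and>
         (\<forall>x\<in>carrier M. \<forall>y\<in>carrier M. h (x \<oplus>\<^bsub>M\<^esub> y) = h x \<oplus>\<^bsub>N\<^esub> h y) \<and>
         (\<forall>r\<in>carrier R. \<forall>x\<in>carrier M. h (r \<odot>\<^bsub>M\<^esub> x) = r \<odot>\<^bsub>N\<^esub> h x)}"

definition graded_isomorphic ::
  "('a, 'x) ring_scheme \<Rightarrow> ('a, 'm) module \<Rightarrow> (int \<Rightarrow> 'm set) \<Rightarrow>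
     ('a, 'n) module \<Rightarrow> (int \<Rightarrow> 'n set) \<Rightarrow> bool" where
  "graded_isomorphic R M gM N gN \<longleftrightarrow> (\<exists>h \<in> module_isos R M N. \<forall>d. h ` gM d = gN d)"

text \<open>
  The vector space \<open>V\<close> is the type \<open>'v\<close> with scalar multiplication \<open>scale\<close>; vectors of the list
  \<open>X\<close> are addressed by their indices \<open>0, \<dots>, length X - 1\<close>, and a sublist of \<open>X\<close> is a set of such
  indices.
\<close>

abbreviation vspan :: "(complex \<Rightarrow> 'v::ab_group_add \<Rightarrow> 'v) \<Rightarrow> 'v set \<Rightarrow> 'v set" where
  "vspan \<equiv> Modules.module.span"

abbreviation vdim :: "(complex \<Rightarrow> 'v::ab_group_add \<Rightarrow> 'v) \<Rightarrow> 'v set \<Rightarrow> nat" where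
  "vdim \<equiv> Vector_Spaces.vector_space.dim"

abbreviation vindependent :: "(complex \<Rightarrow> 'v::ab_group_add \<Rightarrow> 'v) \<Rightarrow> 'v set \<Rightarrow> bool" where
  "vindependent scale S \<equiv> \<not> Modules.module.dependent scale S"

text \<open>
  Functions on a domain \<open>D\<close>, with pointwise operations, extended by \<open>undefined\<close> outside \<open>D\<close>.
  The scalar multiplication is also pointwise; this makes every such structure a module over any
  ring of functions whose domain contains \<open>D\<close>.
\<close>

definition pointwise :: "'u set \<Rightarrow> ('u \<Rightarrow> complex) set \<Rightarrow> ('u \<Rightarrow> complex, 'u \<Rightarrow> complex) module" where
  "pointwise D F =
     \<lparr>carrier = F, mult = (\<lambda>f g. \<lambda>\<phi>\<in>D. f \<phi> * g \<phi>), one = (\<lambda>\<phi>\<in>D. 1),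
      zero = (\<lambda>\<phi>\<in>D. 0), add = (\<lambda>f g. \<lambda>\<phi>\<in>D. f \<phi> + g \<phi>),
      smult = (\<lambda>f g. \<lambda>\<phi>\<in>D. f \<phi> * g \<phi>)\<rparr>"

definition homogeneous_on :: "('v \<Rightarrow> complex) set \<Rightarrow> int \<Rightarrow> (('v \<Rightarrow> complex) \<Rightarrow> complex) \<Rightarrow> bool" where
  "homogeneous_on D d f \<longleftrightarrow> (\<forall>\<phi>\<in>D. \<forall>t. t \<noteq> 0 \<longrightarrow> f (\<lambda>v. t * \<phi> v) = t powi d * f \<phi>)"

context
  fixes scale :: "complex \<Rightarrow> 'v::ab_group_add \<Rightarrow> 'v"
begin

definition dual :: "('v \<Rightarrow> complex) set" where
  "dual = {\<phi>. Vector_Spaces.linear scale (*) \<phi>}"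

definition const_fun :: "complex \<Rightarrow> ('v \<Rightarrow> complex) \<Rightarrow> complex" where
  "const_fun c = (\<lambda>\<phi>\<in>dual. c)"

definition vec_fun :: "'v \<Rightarrow> ('v \<Rightarrow> complex) \<Rightarrow> complex" where
  "vec_fun v = (\<lambda>\<phi>\<in>dual. \<phi> v)"

inductive_set poly_funs :: "(('v \<Rightarrow> complex) \<Rightarrow> complex) set" where
  const: "const_fun c \<in> poly_funs"
| vec: "vec_fun v \<in> poly_funs"
| add: "f \<in> poly_funs \<Longrightarrow> g \<in> poly_funs \<Longrightarrow> (\<lambda>\<phi>\<in>dual. f \<phi> + g \<phi>) \<in> poly_funs"
| mult: "f \<in> poly_funs \<Longrightarrow> g \<in> poly_funs \<Longrightarrow> (\<lambda>\<phi>\<in>dual. f \<phi> * g \<phi>) \<in> poly_funs"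

text \<open>
  The symmetric algebra \<open>A = S[V]\<close>, identified with the polynomial functions on \<open>U = V\<^sup>*\<close>
  (and regarded also as a module over itself).
\<close>

definition SymAlg :: "(('v \<Rightarrow> complex) \<Rightarrow> complex, ('v \<Rightarrow> complex) \<Rightarrow> complex) module" where
  "SymAlg = pointwise dual poly_funs"

definition SymAlg_deg :: "int \<Rightarrow> (('v \<Rightarrow> complex) \<Rightarrow> complex) set" where
  "SymAlg_deg d = {f \<in> carrier SymAlg. homogeneous_on dual d f}"

text \<open>
  A module over \<open>A\<close> is a complex vector space through the constants of \<open>A\<close>.
\<close>

definition lin_comb ::
  "(('v \<Rightarrow> complex) \<Rightarrow> complex, 'm) module \<Rightarrow> 'i set \<Rightarrow> ('i \<Rightarrow> complex) \<Rightarrow> ('i \<Rightarrow> 'm) \<Rightarrow> 'm" where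
  "lin_comb M J c m = finsum M (\<lambda>i. const_fun (c i) \<odot>\<^bsub>M\<^esub> m i) J"

definition lin_span :: "(('v \<Rightarrow> complex) \<Rightarrow> complex, 'm) module \<Rightarrow> 'm set \<Rightarrow> 'm set" where
  "lin_span M S = {lin_comb M F c (\<lambda>x. x) | F c. finite F \<and> F \<subseteq> S}"

definition basis_family ::
  "(('v \<Rightarrow> complex) \<Rightarrow> complex, 'm) module \<Rightarrow> 'i set \<Rightarrow> ('i \<Rightarrow> 'm) \<Rightarrow> bool" where
  "basis_family M J m \<longleftrightarrow>
     finite J \<and> (\<forall>i\<in>J. m i \<in> carrier M) \<and>
     (\<forall>c. lin_comb M J c m = \<zero>\<^bsub>M\<^esub> \<longrightarrow> (\<forall>i\<in>J. c i = 0)) \<and>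
     (\<forall>x\<in>carrier M. \<exists>c. x = lin_comb M J c m)"

context
  fixes X :: "'v list"
begin

definition idx :: "nat set" where
  "idx = {..<length X}"

definition cocircuit :: "nat set \<Rightarrow> bool" where
  "cocircuit Y \<longleftrightarrow> Y \<subseteq> idx \<and> vspan scale ((!) X ` (idx - Y)) \<noteq> UNIV"

definition sublist_prod :: "nat set \<Rightarrow> ('v \<Rightarrow> complex) \<Rightarrow> complex" where
  "sublist_prod Y = (\<lambda>\<phi>\<in>dual. \<Prod>i\<in>Y. vec_fun (X ! i) \<phi>)"

definition I_X :: "(('v \<Rightarrow> complex) \<Rightarrow> complex) set" where
  "I_X = genideal SymAlg {sublist_prod Y | Y. cocircuit Y}"

definition A_X :: "(('v \<Rightarrow> complex) \<Rightarrow> complex, (('v \<Rightarrow> complex) \<Rightarrow> complex) set) module" where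
  "A_X = quot_ring_module SymAlg I_X"

definition A_X_deg :: "int \<Rightarrow> (('v \<Rightarrow> complex) \<Rightarrow> complex) set set" where
  "A_X_deg d = (\<lambda>f. I_X +>\<^bsub>SymAlg\<^esub> f) ` SymAlg_deg d"

definition d_X :: "('v \<Rightarrow> complex) \<Rightarrow> complex" where
  "d_X = sublist_prod idx"

text \<open>
  The localization \<open>R_X = S[V][d_X\<^sup>-\<^sup>1]\<close> is realized as the ring of regular functions on the
  complement of the zero locus of \<open>d_X\<close> in \<open>U\<close>. As the zero vector is not in \<open>X\<close>, this complement
  is Zariski dense, so distinct fractions give distinct functions.
\<close>

definition dual_reg :: "('v \<Rightarrow> complex) set" where
  "dual_reg = {\<phi> \<in> dual. d_X \<phi> \<noteq> 0}"

definition R_X :: "(('v \<Rightarrow> complex) \<Rightarrow> complex, ('v \<Rightarrow> complex) \<Rightarrow> complex) module" where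
  "R_X = pointwise dual_reg {(\<lambda>\<phi>\<in>dual_reg. f \<phi> / d_X \<phi> ^ n) | f n. f \<in> carrier SymAlg}"

text \<open>
  The index \<open>k\<close> is an integer so that \<open>R_filt (s - 1)\<close> is \<open>0\<close>, and not \<open>R_X\<close>, if \<open>s = 0\<close>.
\<close>

definition R_filt :: "int \<Rightarrow> (('v \<Rightarrow> complex) \<Rightarrow> complex) set" where
  "R_filt k = lin_span R_X
     {(\<lambda>\<phi>\<in>dual_reg. f \<phi> * (\<Prod>i\<in>idx. vec_fun (X ! i) \<phi> powi (- int (h i)))) | f h.
        f \<in> carrier SymAlg \<and>
        int (vdim scale (vspan scale ((!) X ` {i \<in> idx. 0 < h i}))) \<le> k}"

definition P_X :: "(('v \<Rightarrow> complex) \<Rightarrow> complex, (('v \<Rightarrow> complex) \<Rightarrow> complex) set) module" where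
  "P_X = quot_module R_X (R_filt (int (vdim scale UNIV) - 1))"

definition to_P :: "(('v \<Rightarrow> complex) \<Rightarrow> complex) \<Rightarrow> (('v \<Rightarrow> complex) \<Rightarrow> complex) set" where
  "to_P r = R_filt (int (vdim scale UNIV) - 1) +>\<^bsub>R_X\<^esub> r"

text \<open>The grading by the degree of functions, shifted by \<open>N = length X\<close>.\<close>

definition R_X_deg :: "int \<Rightarrow> (('v \<Rightarrow> complex) \<Rightarrow> complex) set" where
  "R_X_deg d = {r \<in> carrier R_X. homogeneous_on dual_reg (d - int (length X)) r}"

definition P_X_deg :: "int \<Rightarrow> (('v \<Rightarrow> complex) \<Rightarrow> complex) set set" where
  "P_X_deg d = to_P ` R_X_deg d"

definition u_X :: "(('v \<Rightarrow> complex) \<Rightarrow> complex) set" where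
  "u_X = to_P (\<lambda>\<phi>\<in>dual_reg. inverse (d_X \<phi>))"

definition Q_X :: "(('v \<Rightarrow> complex) \<Rightarrow> complex, (('v \<Rightarrow> complex) \<Rightarrow> complex) set) module" where
  "Q_X = cyclic_submodule SymAlg P_X u_X"

definition Q_X_deg :: "int \<Rightarrow> (('v \<Rightarrow> complex) \<Rightarrow> complex) set set" where
  "Q_X_deg d = carrier Q_X \<inter> P_X_deg d"

definition extracted_bases :: "nat set set" where
  "extracted_bases =
     {b. b \<subseteq> idx \<and> inj_on ((!) X) b \<and> vindependent scale ((!) X ` b) \<and>
         vspan scale ((!) X ` b) = UNIV}"

text \<open>
  For \<open>b = {i\<^sub>1 < \<dots> < i\<^sub>s}\<close> the tail \<open>i\<^sub>e, \<dots>, i\<^sub>s\<close> is the set of the members of \<open>b\<close> that are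
  \<open>\<ge> j\<close>, where \<open>j = i\<^sub>e\<close>.
\<close>

definition breaking :: "nat set \<Rightarrow> nat set" where
  "breaking b = {i \<in> idx. \<exists>j\<in>b. i \<le> j \<and> X ! i \<in> vspan scale ((!) X ` {k \<in> b. j \<le> k})}"

definition u_basis :: "nat set \<Rightarrow> (('v \<Rightarrow> complex) \<Rightarrow> complex) set" where
  "u_basis b = sublist_prod (idx - breaking b) \<odot>\<^bsub>P_X\<^esub> u_X"

end

end

end

(*
  Both parts follow by deletion and contraction of the last vector, once two things are known:
  modulo I_X every polynomial is a combination of the products M_b of the vectors outside B(b), and
  the fractions M_b / d_X = 1 / prod B(b) are linearly independent modulo R_{X,s-1}.  Then f u_X = 0
  forces all coefficients of f in its normal form to vanish, so f lies in I_X.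

  For the independence, let a be the last vector, occurring (up to scalars) m times in X.  A
  fraction 1 / prod B(b) has a pole of order m along a = 0 if a is in b, and of smaller order
  otherwise.  Taking the Laurent coefficient of order -m in a direction transverse to a = 0 maps
  R_{X,s-1} to the corresponding space for V/a, which kills the coefficients of the bases through a
  by induction; the remaining bases are bases of the list without a.  The poles allowed in R_{X,s-1}
  are kept along all of X in this last step, so no injectivity of P_{X-a} -> P_X is needed.

  Quotients V/W are avoided throughout: everything is relative to a set S spanning W, and functions
  on the dual of V/W are functions on the annihilator of S.
*)
theory Submission
  imports Defs "HOL-Complex_Analysis.Laurent_Convergence"
begin

text \<open>Contraction shapes the induction: modulo \<open>span S\<close> vectors may vanish or
  become proportional. A vector in \<open>span S\<close> breaks every basis, so it never enters M_b,
  and it is omitted from the denominators, where it would be zero. The exponent m is attained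
  because a basis through the last vector a is broken by every vector proportional to a, while a
  itself breaks no other basis. Only Laurent coefficients of negative order respect the filtration:
  a summand of R_{X,s-1} with a pole along a = 0 has a denominator proportional to a, so adjoining a
  to its denominators does not enlarge their span; a summand without such a pole does not reach
  these coefficients. The grading needs an argument of its own. A class of degree d in Q_X is a
  priori represented by a homogeneous fraction on the one hand and by f / d_X with f inhomogeneous
  on the other. Since R_{X,s-1} is graded, comparing components of one degree yields a homogeneous
  f. Components are again Laurent coefficients, now for the scaling of functionals.\<close>

unbundle no vec_syntax and fps_syntax

section \<open>Algebras of functions and homogeneous components\<close>

lemma pointwise_simps [simp]:
  "carrier (pointwise D F) = F" "\<zero>\<^bsub>pointwise D F\<^esub> = (\<lambda>\<phi>\<in>D. 0)"
  "\<one>\<^bsub>pointwise D F\<^esub> = (\<lambda>\<phi>\<in>D. 1)"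
  "f \<oplus>\<^bsub>pointwise D F\<^esub> g = (\<lambda>\<phi>\<in>D. f \<phi> + g \<phi>)" "f \<otimes>\<^bsub>pointwise D F\<^esub> g = (\<lambda>\<phi>\<in>D. f \<phi> * g \<phi>)"
  "f \<odot>\<^bsub>pointwise D F\<^esub> g = (\<lambda>\<phi>\<in>D. f \<phi> * g \<phi>)"
  by (simp_all add: pointwise_def)

text \<open>Extensionality makes the restricted zero neutral: adding it replaces a function by its
  restriction to \<open>D\<close>.\<close>

lemma pointwise_abelian_group:
  assumes "F \<subseteq> extensional D" "(\<lambda>\<phi>\<in>D. 0) \<in> F"
    and "\<And>f g. f \<in> F \<Longrightarrow> g \<in> F \<Longrightarrow> (\<lambda>\<phi>\<in>D. f \<phi> + g \<phi>) \<in> F"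
    and "\<And>f. f \<in> F \<Longrightarrow> (\<lambda>\<phi>\<in>D. - f \<phi>) \<in> F"
  shows "abelian_group (pointwise D F)"
proof (rule abelian_groupI)
  fix f assume f: "f \<in> carrier (pointwise D F)"
  have "(\<lambda>\<phi>\<in>D. f \<phi>) = f" using f assms(1) by (simp add: extensional_restrict subset_iff)
  then show "\<zero>\<^bsub>pointwise D F\<^esub> \<oplus>\<^bsub>pointwise D F\<^esub> f = f"
    by (simp cong: restrict_cong)
  show "\<exists>g\<in>carrier (pointwise D F). g \<oplus>\<^bsub>pointwise D F\<^esub> f = \<zero>\<^bsub>pointwise D F\<^esub>"
    using f assms(4) by (intro bexI[of _ "\<lambda>\<phi>\<in>D. - f \<phi>"]) (simp_all cong: restrict_cong)
qed (use assms in \<open>auto simp: add_ac cong: restrict_cong\<close>)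

lemma pointwise_cring:
  assumes "F \<subseteq> extensional D" "(\<lambda>\<phi>\<in>D. 0) \<in> F" "(\<lambda>\<phi>\<in>D. 1) \<in> F"
    and "\<And>f g. f \<in> F \<Longrightarrow> g \<in> F \<Longrightarrow> (\<lambda>\<phi>\<in>D. f \<phi> + g \<phi>) \<in> F"
    and "\<And>f g. f \<in> F \<Longrightarrow> g \<in> F \<Longrightarrow> (\<lambda>\<phi>\<in>D. f \<phi> * g \<phi>) \<in> F"
    and "\<And>f. f \<in> F \<Longrightarrow> (\<lambda>\<phi>\<in>D. - f \<phi>) \<in> F"
  shows "cring (pointwise D F)"
proof (rule cringI)
  show "abelian_group (pointwise D F)"
    using assms by (intro pointwise_abelian_group)
  show "Group.comm_monoid (pointwise D F)"
  proof (rule comm_monoidI)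
    fix f assume f: "f \<in> carrier (pointwise D F)"
    have "(\<lambda>\<phi>\<in>D. f \<phi>) = f" using f assms(1) by (simp add: extensional_restrict subset_iff)
    then show "\<one>\<^bsub>pointwise D F\<^esub> \<otimes>\<^bsub>pointwise D F\<^esub> f = f"
      by (simp cong: restrict_cong)
  qed (use assms in \<open>auto simp: mult_ac cong: restrict_cong\<close>)
qed (auto simp: distrib_right cong: restrict_cong)

lemma finsum_pointwise:
  assumes "abelian_group (pointwise D F)" "finite I" "\<And>i. i \<in> I \<Longrightarrow> m i \<in> F"
  shows "finsum (pointwise D F) m I = (\<lambda>\<phi>\<in>D. \<Sum>i\<in>I. m i \<phi>)"
  using assms(2,3)
proof (induction I rule: finite_induct)
  interpret abelian_group "pointwise D F" by fact
  case empty
  show ?case by simp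
next
  interpret abelian_group "pointwise D F" by fact
  case (insert i I)
  then show ?case by (subst finsum_insert) (auto cong: restrict_cong)
qed

lemma homogeneous_on_mult:
  "homogeneous_on D d f \<Longrightarrow> homogeneous_on D e g \<Longrightarrow> homogeneous_on D (d + e) (\<lambda>\<phi>. f \<phi> * g \<phi>)"
  by (simp add: homogeneous_on_def power_int_add mult_ac)

lemma homogeneous_on_add:
  "homogeneous_on D d f \<Longrightarrow> homogeneous_on D d g \<Longrightarrow> homogeneous_on D d (\<lambda>\<phi>. f \<phi> + g \<phi>)"
  by (simp add: homogeneous_on_def distrib_left)

lemma homogeneous_on_0 [simp]: "homogeneous_on D d (\<lambda>\<phi>. 0)"
  by (simp add: homogeneous_on_def)

lemma homogeneous_on_prod:
  "(\<And>i. i \<in> I \<Longrightarrow> homogeneous_on D (d i) (f i)) \<Longrightarrow> homogeneous_on D (\<Sum>i\<in>I. d i) (\<lambda>\<phi>. \<Prod>i\<in>I. f i \<phi>)"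
proof (induction I rule: infinite_finite_induct)
  case (insert i I)
  then have "homogeneous_on D (d i + (\<Sum>i\<in>I. d i)) (\<lambda>\<phi>. f i \<phi> * (\<Prod>i\<in>I. f i \<phi>))"
    by (intro homogeneous_on_mult) auto
  with insert.hyps show ?case by simp
qed (simp_all add: homogeneous_on_def)

lemma homogeneous_on_power_int:
  "homogeneous_on D d f \<Longrightarrow> homogeneous_on D (d * k) (\<lambda>\<phi>. f \<phi> powi k)"
  by (simp add: homogeneous_on_def power_int_mult_distrib power_int_mult)

lemma homogeneous_on_mono: "homogeneous_on D d f \<Longrightarrow> E \<subseteq> D \<Longrightarrow> homogeneous_on E d f"
  by (auto simp: homogeneous_on_def)

lemma homogeneous_on_cong:
  assumes "homogeneous_on D d f" "\<And>\<phi>. \<phi> \<in> D \<Longrightarrow> f \<phi> = g \<phi>"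
    and "\<And>\<phi> t. \<phi> \<in> D \<Longrightarrow> t \<noteq> 0 \<Longrightarrow> (\<lambda>v. t * \<phi> v) \<in> D"
  shows "homogeneous_on D d g"
  using assms(1) unfolding homogeneous_on_def by (metis assms(2,3))

section \<open>Decompositions into homogeneous components\<close>

text \<open>Components are indexed by all integers and vanish off the finite set \<open>I\<close>,
  so two decompositions can be moved to a common index set before they are compared.
  \<open>W\<close> records where the components live; this is how gradedness of a subspace is
  expressed.\<close>

definition graded_sum :: "('v \<Rightarrow> complex) set \<Rightarrow> (('v \<Rightarrow> complex) \<Rightarrow> complex) set \<Rightarrow>
    (('v \<Rightarrow> complex) \<Rightarrow> complex) \<Rightarrow> (int \<Rightarrow> ('v \<Rightarrow> complex) \<Rightarrow> complex) \<Rightarrow> int set \<Rightarrow> bool" where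
  "graded_sum D W f F I \<longleftrightarrow> finite I \<and> (\<forall>d. F d \<in> W \<and> homogeneous_on D d (F d)) \<and>
     (\<forall>d. d \<notin> I \<longrightarrow> F d = (\<lambda>\<phi>. 0)) \<and> (\<forall>\<phi>\<in>D. f \<phi> = (\<Sum>d\<in>I. F d \<phi>))"

lemma graded_sum_mono_index:
  assumes "graded_sum D W f F I" "I \<subseteq> J" "finite J"
  shows "graded_sum D W f F J"
proof -
  have "(\<Sum>d\<in>I. F d \<phi>) = (\<Sum>d\<in>J. F d \<phi>)" for \<phi>
    using assms by (intro sum.mono_neutral_left) (auto simp: graded_sum_def)
  with assms show ?thesis by (auto simp: graded_sum_def)
qed

lemma graded_sum_single:
  assumes "homogeneous_on D d f" "f \<in> W" "(\<lambda>\<phi>. 0) \<in> W"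
  shows "graded_sum D W f (\<lambda>e. if e = d then f else (\<lambda>\<phi>. 0)) {d}"
  using assms by (simp add: graded_sum_def)

lemma graded_sum_add:
  assumes "graded_sum D W f F I" "graded_sum D W g G J"
    and "\<And>f g. f \<in> W \<Longrightarrow> g \<in> W \<Longrightarrow> (\<lambda>\<phi>. f \<phi> + g \<phi>) \<in> W"
  shows "graded_sum D W (\<lambda>\<phi>. f \<phi> + g \<phi>) (\<lambda>d \<phi>. F d \<phi> + G d \<phi>) (I \<union> J)"
proof -
  have "finite (I \<union> J)" using assms(1,2) by (simp add: graded_sum_def)
  then have "graded_sum D W f F (I \<union> J)" "graded_sum D W g G (I \<union> J)"
    using graded_sum_mono_index[OF assms(1)] graded_sum_mono_index[OF assms(2)] by simp_all
  then show ?thesis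
    using assms(3) by (simp add: graded_sum_def homogeneous_on_add sum.distrib)
qed

lemma graded_sum_mult:
  assumes "graded_sum D W f F I" "homogeneous_on D e p"
    and "\<And>f. f \<in> W \<Longrightarrow> (\<lambda>\<phi>. p \<phi> * f \<phi>) \<in> W'"
  shows "graded_sum D W' (\<lambda>\<phi>. p \<phi> * f \<phi>) (\<lambda>d \<phi>. p \<phi> * F (d - e) \<phi>) ((+) e ` I)"
proof -
  have "homogeneous_on D d (\<lambda>\<phi>. p \<phi> * F (d - e) \<phi>)" for d
    using homogeneous_on_mult[OF assms(2), of "d - e" "F (d - e)"] assms(1) by (simp add: graded_sum_def)
  moreover have "F (d - e) = (\<lambda>\<phi>. 0)" if "d \<notin> (+) e ` I" for d
  proof -
    have "d - e \<notin> I" using that by (auto simp: image_iff dest: bspec[of I _ "d - e"])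
    then show ?thesis using assms(1) by (simp add: graded_sum_def)
  qed
  moreover have "(\<Sum>d\<in>(+) e ` I. p \<phi> * F (d - e) \<phi>) = p \<phi> * (\<Sum>d\<in>I. F d \<phi>)" for \<phi>
    by (subst sum.reindex) (auto simp: sum_distrib_left)
  ultimately show ?thesis
    using assms(1,3) by (simp add: graded_sum_def)
qed

text \<open>Along the points t * \<phi> a decomposition becomes a Laurent polynomial in t with
  coefficients \<open>F d \<phi>\<close>. Both decompositions give the same function for t \<noteq>
  0, so the coefficients agree. As \<open>W\<close> and \<open>W'\<close> may differ, arbitrary
  components can be identified with components known to lie in a subspace.\<close>

lemma graded_sum_unique:
  assumes "graded_sum D W f F I" "graded_sum D W' g G I"
    and "\<And>\<phi>. \<phi> \<in> D \<Longrightarrow> f \<phi> = g \<phi>" and "\<phi> \<in> D"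
    and D: "\<And>\<phi> t. \<phi> \<in> D \<Longrightarrow> t \<noteq> 0 \<Longrightarrow> (\<lambda>v. t * \<phi> v) \<in> D"
  shows "F d \<phi> = G d \<phi>"
proof (cases "d \<in> I")
  case True
  have expand: "(\<lambda>t. \<Sum>d\<in>I. H d \<phi> * t powi d) has_laurent_expansion (\<Sum>d\<in>I. fls_shift (- d) (fls_const (H d \<phi>)))"
    for H by (intro has_laurent_expansion_sum has_laurent_expansion_shift has_laurent_expansion_const)
  have nth: "(\<Sum>d\<in>I. fls_shift (- d) (fls_const (H d \<phi>))) $$ d = H d \<phi>" for H
    using True assms(1) by (simp add: fls_nth_sum fls_shift_const_nth graded_sum_def)
  have eq: "(\<Sum>d\<in>I. F d \<phi> * t powi d) = (\<Sum>d\<in>I. G d \<phi> * t powi d)" if "t \<noteq> 0" for t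
  proof -
    have sc: "(\<lambda>v. t * \<phi> v) \<in> D" using D assms(4) that .
    have "(\<Sum>d\<in>I. F d \<phi> * t powi d) = (\<Sum>d\<in>I. F d (\<lambda>v. t * \<phi> v))"
      using assms(1,4) that by (intro sum.cong) (auto simp: graded_sum_def homogeneous_on_def mult.commute)
    also have "\<dots> = (\<Sum>d\<in>I. G d (\<lambda>v. t * \<phi> v))"
      using assms(1-3) sc by (simp add: graded_sum_def)
    also have "\<dots> = (\<Sum>d\<in>I. G d \<phi> * t powi d)"
      using assms(2,4) that by (intro sum.cong) (auto simp: graded_sum_def homogeneous_on_def mult.commute)
    finally show ?thesis .
  qed
  have "eventually (\<lambda>t::complex. t \<noteq> 0) (at 0)"
    by (simp add: eventually_at_filter)
  then have "eventually (\<lambda>t. (\<Sum>d\<in>I. F d \<phi> * t powi d) = (\<Sum>d\<in>I. G d \<phi> * t powi d)) (at 0)"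
    by eventually_elim (rule eq)
  from has_laurent_expansion_cong[THEN iffD1, OF this refl expand[of F]]
  have "(\<Sum>d\<in>I. fls_shift (- d) (fls_const (F d \<phi>))) = (\<Sum>d\<in>I. fls_shift (- d) (fls_const (G d \<phi>)))"
    using expand[of G] by (rule has_laurent_expansion_unique)
  then show ?thesis using nth[of F] nth[of G] by simp
next
  case False
  with assms(1,2) show ?thesis by (simp add: graded_sum_def)
qed

section \<open>Bases and breaking elements\<close>

locale complex_vector_space = vector_space scale
  for scale :: "complex \<Rightarrow> 'v::ab_group_add \<Rightarrow> 'v"
begin

lemma dualD:
  assumes "\<phi> \<in> dual scale"
  shows "\<phi> (u + v) = \<phi> u + \<phi> v" "\<phi> (scale c v) = c * \<phi> v" "\<phi> 0 = 0"
  using assms unfolding dual_def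
  by (auto simp: Vector_Spaces.linear_def module_hom.add module_hom.scale module_hom.zero)

lemma dualI:
  assumes "\<And>u v. \<phi> (u + v) = \<phi> u + \<phi> v" "\<And>c v. \<phi> (scale c v) = c * \<phi> v"
  shows "\<phi> \<in> dual scale"
  unfolding dual_def using assms
  by (auto intro!: Vector_Spaces.linear.intro module_hom.intro module_hom_axioms.intro
      module_axioms vector_space_axioms vector_space_over_itself.vector_space_axioms
      vector_space_over_itself.module_axioms)

lemma dual_add_scale:
  assumes "\<phi> \<in> dual scale" "e \<in> dual scale"
  shows "(\<lambda>v. \<phi> v + t * e v) \<in> dual scale"
  using assms by (intro dualI) (simp_all add: dualD algebra_simps)

lemma dual_mult: "\<phi> \<in> dual scale \<Longrightarrow> (\<lambda>v. t * \<phi> v) \<in> dual scale"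
  by (intro dualI) (simp_all add: dualD algebra_simps)

lemma dual_vanish_span:
  assumes "\<phi> \<in> dual scale" "\<forall>s\<in>S. \<phi> s = 0" "v \<in> span S"
  shows "\<phi> v = 0"
  using assms(3)
  by (induction rule: span_induct_alt) (simp_all add: dualD assms)

text \<open>The values 0 on a basis of \<open>span S\<close> and 1 on \<open>a\<close> extend
  linearly to V. The result is the direction transverse to a = 0 in the dual of V / span S,
  normalised so that t is the value at \<open>a\<close> after moving by t.\<close>

lemma dual_separates:
  assumes "a \<notin> span S"
  obtains e where "e \<in> dual scale" "\<forall>s\<in>span S. e s = 0" "e a = 1"
proof -
  interpret P: vector_space_pair scale "(*) :: complex \<Rightarrow> complex \<Rightarrow> complex"
    by (intro vector_space_pair.intro vector_space_axioms vector_space_over_itself.vector_space_axioms)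
  obtain B where B: "B \<subseteq> span S" "independent B" "span S \<subseteq> span B"
    by (rule maximal_independent_subset)
  have sp: "span B = span S"
    using B span_mono[OF B(1)] by (auto simp: span_span)
  have "independent (insert a B)"
    using assms B sp by (intro independent_insertI) auto
  then obtain e where e: "Vector_Spaces.linear scale (*) e" "\<And>v. v \<in> insert a B \<Longrightarrow> e v = of_bool (v = a)"
    using P.linear_independent_extend[of "insert a B" "\<lambda>v. of_bool (v = a)"] by blast
  have ed: "e \<in> dual scale" using e by (simp add: dual_def)
  have "e s = 0" if "s \<in> B" for s
    using that e(2)[of s] B assms by auto
  then have "e s = 0" if "s \<in> span S" for s
    using dual_vanish_span[OF ed] that sp by blast
  with that[OF ed] e(2)[of a] show thesis by auto
qed

text \<open>
  The bases of \<open>V / span S\<close> extracted from the images of \<open>x 0, \<dots>, x (n - 1)\<close>. Independence is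
  expressed through the tails of \<open>b\<close>, so that adding the index \<open>n\<close> amounts to enlarging \<open>S\<close> by \<open>x n\<close>.
\<close>

definition bases :: "(nat \<Rightarrow> 'v) \<Rightarrow> nat \<Rightarrow> 'v set \<Rightarrow> nat set set" where
  "bases x n S = {b. b \<subseteq> {..<n} \<and> (\<forall>j\<in>b. x j \<notin> span (S \<union> x ` {k \<in> b. j < k})) \<and>
     span (S \<union> x ` b) = UNIV}"

text \<open>The tail starts at \<open>i\<close> itself instead of at a member of \<open>b\<close>.
  If it is empty, \<open>i\<close> breaks \<open>b\<close> exactly when \<open>x i\<close> vanishes
  modulo \<open>span S\<close>, a case that contraction creates.\<close>

definition brk :: "(nat \<Rightarrow> 'v) \<Rightarrow> nat \<Rightarrow> 'v set \<Rightarrow> nat set \<Rightarrow> nat set" where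
  "brk x n S b = {i \<in> {..<n}. x i \<in> span (S \<union> x ` {k \<in> b. i \<le> k})}"

lemma bases_0: "bases x 0 S = (if span S = UNIV then {{}} else {})"
  by (auto simp: bases_def)

lemma bases_subset: "b \<in> bases x n S \<Longrightarrow> b \<subseteq> {..<n}"
  by (simp add: bases_def)

lemma finite_bases [simp]: "finite (bases x n S)"
  by (rule finite_subset[of _ "Pow {..<n}"]) (auto simp: bases_def)

lemma finite_brk [simp]: "finite (brk x n S b)"
  by (simp add: brk_def)

text \<open>Deletion and contraction at the last index. Nothing follows \<open>n\<close>, so its
  only condition is that \<open>x n\<close> be nonzero modulo \<open>span S\<close>; and
  \<open>n\<close> follows every other member, so for these \<open>x n\<close> acts as an element of
  \<open>S\<close>.\<close>

lemma bases_Suc: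
  "bases x (Suc n) S = bases x n S \<union>
     (if x n \<in> span S then {} else insert n ` bases x n (insert (x n) S))"
  (is "?L = _ \<union> ?R")
proof -
  have e: "b \<in> ?L \<longleftrightarrow> b \<in> bases x n S" if "n \<notin> b" for b
    using that by (auto simp: bases_def lessThan_Suc)
  have 2: "insert n b \<in> ?L \<longleftrightarrow> x n \<notin> span S \<and> b \<in> bases x n (insert (x n) S)" if "b \<subseteq> {..<n}" for b
  proof -
    have [simp]: "{k. (k = n \<or> k \<in> b) \<and> n < k} = {}" "n \<notin> b" using that by auto
    have "{k. (k = n \<or> k \<in> b) \<and> j < k} = insert n {k \<in> b. j < k}" if "j \<in> b" for j
      using that \<open>b \<subseteq> {..<n}\<close> by auto
    then show ?thesis
      using that by (auto simp: bases_def lessThan_Suc)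
  qed
  show ?thesis
  proof (intro equalityI subsetI)
    fix b assume b: "b \<in> ?L"
    show "b \<in> bases x n S \<union> ?R"
    proof (cases "n \<in> b")
      case True
      have "b - {n} \<subseteq> {..<n}" using bases_subset[OF b] by auto
      moreover have "insert n (b - {n}) = b" using True by auto
      ultimately show ?thesis using 2[of "b - {n}"] b by (auto intro!: image_eqI[of _ _ "b - {n}"])
    qed (use e b in auto)
  next
    fix b assume b: "b \<in> bases x n S \<union> ?R"
    then consider "b \<in> bases x n S" | c where "x n \<notin> span S" "b = insert n c" "c \<in> bases x n (insert (x n) S)"
      by (auto split: if_splits)
    then show "b \<in> ?L"
    proof cases
      case 1
      then show ?thesis using e bases_subset[OF 1] by blast
    next
      case c: 2
      then show ?thesis using 2[OF bases_subset[OF c(3)]] by simp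
    qed
  qed
qed

text \<open>The tail at \<open>n\<close> is empty, so \<open>n\<close> breaks such a
  \<open>b\<close> only if \<open>x n\<close> vanishes modulo \<open>span S\<close>; the tails at
  earlier indices do not change.\<close>

lemma brk_Suc:
  assumes "b \<subseteq> {..<n}"
  shows "brk x (Suc n) S b = brk x n S b \<union> (if x n \<in> span S then {n} else {})"
proof -
  have "{k \<in> b. n \<le> k} = {}" using assms by auto
  then have "x n \<in> span (S \<union> x ` {k \<in> b. n \<le> k}) \<longleftrightarrow> x n \<in> span S"
    by (simp only: image_empty Un_empty_right)
  then show ?thesis by (auto simp: brk_def less_Suc_eq)
qed

text \<open>Now \<open>n\<close> belongs to every tail, so breaking is always tested modulo
  \<open>x n\<close>, and \<open>n\<close> breaks because it lies in its own tail.\<close>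

lemma brk_Suc_insert:
  assumes "b \<subseteq> {..<n}"
  shows "brk x (Suc n) S (insert n b) = insert n (brk x n (insert (x n) S) b)"
proof -
  have "x n \<in> span (S \<union> x ` {k \<in> insert n b. n \<le> k})"
    by (intro span_base) auto
  moreover have "S \<union> x ` {k \<in> insert n b. i \<le> k} = insert (x n) S \<union> x ` {k \<in> b. i \<le> k}" if "i < n" for i
    using that by auto
  ultimately show ?thesis
    by (auto simp: brk_def less_Suc_eq)
qed

section \<open>Fractions and their Laurent expansions\<close>

text \<open>Fractions with denominators from \<open>H\<close>, generated inductively so that
  expansions can be computed one generator at a time; \<open>rat {}\<close> is the ring of
  polynomial functions. The rule \<open>rat_cong\<close> discards the values off the dual.\<close>

inductive_set rat :: "'v set \<Rightarrow> (('v \<Rightarrow> complex) \<Rightarrow> complex) set" for H where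
  rat_const: "(\<lambda>\<phi>. c) \<in> rat H"
| rat_vec: "(\<lambda>\<phi>. \<phi> v) \<in> rat H"
| rat_inverse: "z \<in> H \<Longrightarrow> (\<lambda>\<phi>. inverse (\<phi> z)) \<in> rat H"
| rat_add: "f \<in> rat H \<Longrightarrow> g \<in> rat H \<Longrightarrow> (\<lambda>\<phi>. f \<phi> + g \<phi>) \<in> rat H"
| rat_mult: "f \<in> rat H \<Longrightarrow> g \<in> rat H \<Longrightarrow> (\<lambda>\<phi>. f \<phi> * g \<phi>) \<in> rat H"
| rat_cong: "f \<in> rat H \<Longrightarrow> (\<And>\<phi>. \<phi> \<in> dual scale \<Longrightarrow> f \<phi> = g \<phi>) \<Longrightarrow> g \<in> rat H"

lemma rat_sum: "(\<And>i. i \<in> I \<Longrightarrow> f i \<in> rat H) \<Longrightarrow> (\<lambda>\<phi>. \<Sum>i\<in>I. f i \<phi>) \<in> rat H"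
  by (induction I rule: infinite_finite_induct) (auto intro: rat_const rat_add rat_mult)

lemma rat_prod: "(\<And>i. i \<in> I \<Longrightarrow> f i \<in> rat H) \<Longrightarrow> (\<lambda>\<phi>. \<Prod>i\<in>I. f i \<phi>) \<in> rat H"
  by (induction I rule: infinite_finite_induct) (auto intro: rat_const rat_add rat_mult)

lemma rat_power: "f \<in> rat H \<Longrightarrow> (\<lambda>\<phi>. f \<phi> ^ k) \<in> rat H"
  by (induction k) (auto intro: rat_const rat_add rat_mult)

text \<open>
  \<open>reg S Z\<close> is the complement of the hyperplanes \<open>z = 0\<close>, \<open>z \<in> Z\<close>, in the dual of \<open>V / span S\<close>, and
  \<open>low S Z\<close> plays there the role of \<open>R_filt (s - 1)\<close>. The elements of \<open>rat\<close> and \<open>low\<close> are total functions with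
  \<open>inverse 0 = 0\<close>; their values matter only on the dual, respectively on \<open>reg S Z\<close>.
\<close>

definition reg :: "'v set \<Rightarrow> 'v set \<Rightarrow> ('v \<Rightarrow> complex) set" where
  "reg S Z = {\<phi> \<in> dual scale. (\<forall>s\<in>S. \<phi> s = 0) \<and> (\<forall>z\<in>Z. \<phi> z \<noteq> 0)}"

inductive_set low :: "'v set \<Rightarrow> 'v set \<Rightarrow> (('v \<Rightarrow> complex) \<Rightarrow> complex) set" for S Z where
  low_0: "(\<lambda>\<phi>. 0) \<in> low S Z"
| low_step: "g \<in> rat H \<Longrightarrow> H \<subseteq> Z \<Longrightarrow> span (S \<union> H) \<noteq> UNIV \<Longrightarrow> G \<in> low S Z \<Longrightarrow>
    (\<lambda>\<phi>. g \<phi> + G \<phi>) \<in> low S Z"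
| low_cong: "G \<in> low S Z \<Longrightarrow> (\<And>\<phi>. \<phi> \<in> reg S Z \<Longrightarrow> G \<phi> = G' \<phi>) \<Longrightarrow> G' \<in> low S Z"

lemma low_rat: "g \<in> rat H \<Longrightarrow> H \<subseteq> Z \<Longrightarrow> span (S \<union> H) \<noteq> UNIV \<Longrightarrow> g \<in> low S Z"
  using low_step[OF _ _ _ low_0, of g H Z S] by simp

lemma low_add:
  assumes "F \<in> low S Z" "G \<in> low S Z"
  shows "(\<lambda>\<phi>. F \<phi> + G \<phi>) \<in> low S Z"
  using assms
proof (induction rule: low.induct)
  case (low_step g H F)
  then show ?case using low.low_step[of g H Z S "\<lambda>\<phi>. F \<phi> + G \<phi>"] by (simp add: add.assoc)
next
  case (low_cong F F')
  from low_cong.IH[OF assms(2)] show ?case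
    by (rule low.low_cong) (simp add: low_cong.hyps)
qed simp

section \<open>Laurent expansion transverse to a hyperplane\<close>

lemma linear_has_fps_expansion:
  "(\<lambda>t. c + t * d) has_fps_expansion (fps_const c + fps_X * fps_const d :: complex fps)"
  by (intro fps_expansion_intros)

text \<open>Geometric series. Every coefficient is a power of d times a power of
  \<open>inverse c\<close>, so with d fixed and c varying it is a fraction with the single
  denominator c.\<close>

lemma inverse_linear_fps_nth:
  fixes c d :: complex
  assumes "c \<noteq> 0"
  shows "inverse (fps_const c + fps_X * fps_const d) $ k = (- d) ^ k * inverse c ^ Suc k"
proof -
  let ?f = "fps_const c + fps_X * fps_const d"
  let ?g = "Abs_fps (\<lambda>k. (- d) ^ k * inverse c ^ Suc k)"
  have "?f * ?g = 1"
  proof (rule fps_ext)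
    fix k
    have "(?f * ?g) $ k = c * (?g $ k) + (if k = 0 then 0 else d * (?g $ (k - 1)))"
      by (simp add: distrib_right mult.assoc)
    also have "\<dots> = 1 $ k"
      using assms by (cases k) (simp_all add: field_simps)
    finally show "(?f * ?g) $ k = 1 $ k" .
  qed
  moreover have "inverse ?f * ?f = 1"
    using assms by (intro inverse_mult_eq_1) simp
  ultimately have "inverse ?f = ?g"
    using mult.assoc[of "inverse ?f" ?f ?g] by simp
  then show ?thesis by simp
qed

text \<open>
  Moving off the hyperplane \<open>a = 0\<close> in the direction \<open>e\<close>, the vectors of \<open>span (insert a S)\<close>
  are exactly those that contribute to the pole at \<open>t = 0\<close>.
\<close>

lemma eval_off_hyperplane:
  assumes "e \<in> dual scale" "\<forall>s\<in>S. e s = 0" "e a = 1"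
    and "\<phi> \<in> reg (insert a S) Z" "z \<in> span (insert a S)"
  shows "\<phi> z + t * e z = t * e z" "z \<notin> span S \<Longrightarrow> e z \<noteq> 0"
proof -
  have "\<phi> z = 0"
    using assms(4) by (intro dual_vanish_span[OF _ _ assms(5)]) (auto simp: reg_def)
  then show "\<phi> z + t * e z = t * e z" by simp
  \<comment> \<open>Modulo \<open>span S\<close> the vector z is k times \<open>a\<close>, and e a =
    1 gives e z = k; the value k = 0 would put z into \<open>span S\<close>.\<close>
  from assms(5) obtain k where k: "z - scale k a \<in> span S"
    by (auto simp: span_breakdown_eq)
  then have "e (z - scale k a) = 0"
    by (rule dual_vanish_span[OF assms(1,2)])
  moreover have "e z = e (z - scale k a) + k * e a"
    using dualD(1)[OF assms(1), of "z - scale k a" "scale k a"] by (simp add: dualD(2)[OF assms(1)])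
  ultimately have "e z = k" using assms(3) by simp
  then show "z \<notin> span S \<Longrightarrow> e z \<noteq> 0" using k by auto
qed

text \<open>On the line \<phi> + t e a denominator z in \<open>span T\<close> becomes t * e z, whose
  coefficient does not depend on \<phi>, and is cleared by one factor t; any other denominator is
  inverted as a power series. Hence one exponent m serves all \<phi>, and the coefficients only have
  denominators outside \<open>span T\<close>. The clause on m = 0 says that a pole can only come
  from a denominator proportional to \<open>a\<close> modulo \<open>span S\<close>.\<close>

lemma rat_expansion:
  assumes "e \<in> dual scale" "\<forall>s\<in>S. e s = 0" "e a = 1"
    and "H \<inter> span S = {}" and "g \<in> rat H"
  defines "T \<equiv> insert a S"
  shows "\<exists>m Q. (H \<inter> span T = {} \<longrightarrow> m = 0) \<and>
    (\<forall>\<phi>\<in>reg T (H - span T). (\<lambda>t. g (\<lambda>v. \<phi> v + t * e v) * t ^ m) has_laurent_expansion fps_to_fls (Q \<phi>)) \<and>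
    (\<forall>k. (\<lambda>\<phi>. Q \<phi> $ k) \<in> rat (H - span T))"
    (is "\<exists>m Q. ?P g m Q")
  using assms(5)
proof (induction rule: rat.induct)
  case (rat_const c)
  have "?P (\<lambda>\<phi>. c) 0 (\<lambda>\<phi>. fps_const c)"
    by (simp add: rat.rat_const)
  show ?case by (rule exI, rule exI, fact)
next
  case (rat_vec v)
  have "(\<lambda>\<phi>. (fps_const (\<phi> v) + fps_X * fps_const (e v)) $ k) \<in> rat (H - span T)" for k
  proof (cases "k = 0")
    case False
    then have "(\<lambda>\<phi>::'v \<Rightarrow> complex. (fps_const (\<phi> v) + fps_X * fps_const (e v)) $ k) =
        (\<lambda>\<phi>. if k = 1 then e v else 0)" by auto
    then show ?thesis by (simp add: rat.rat_const)
  qed (simp add: rat.rat_vec)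
  then have "?P (\<lambda>\<phi>. \<phi> v) 0 (\<lambda>\<phi>. fps_const (\<phi> v) + fps_X * fps_const (e v))"
    using has_laurent_expansion_fps[OF linear_has_fps_expansion, of _ "e v"] by auto
  show ?case by (rule exI, rule exI, fact)
next
  case (rat_inverse z)
  show ?case
  proof (cases "z \<in> span T")
    case True
    \<comment> \<open>As \<phi> z = 0, the function to expand is t * inverse (t * e z), which is
      constant for t \<noteq> 0. At t = 0 its value is 0 by convention, so the comparison is made on
      a punctured neighbourhood.\<close>
    let ?Q = "\<lambda>\<phi>::'v \<Rightarrow> complex. fps_const (inverse (e z))"
    have nz: "z \<notin> span S" using rat_inverse assms(4) by auto
    have "(\<lambda>t. inverse (\<phi> z + t * e z) * t ^ 1) has_laurent_expansion fps_to_fls (?Q \<phi>)"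
      if "\<phi> \<in> reg T (H - span T)" for \<phi>
    proof -
      note off = eval_off_hyperplane[OF assms(1-3) that[unfolded T_def] True[unfolded T_def]]
      have "eventually (\<lambda>t::complex. t \<noteq> 0) (at 0)"
        by (simp add: eventually_at_filter)
      then have "eventually (\<lambda>t. inverse (e z) = inverse (\<phi> z + t * e z) * t ^ 1) (at 0)"
        by eventually_elim (use off nz in auto)
      from has_laurent_expansion_cong[THEN iffD1, OF this refl has_laurent_expansion_const]
      show ?thesis by (simp only: fps_const_to_fls)
    qed
    moreover have "(\<lambda>\<phi>. ?Q \<phi> $ k) \<in> rat (H - span T)" for k
      using rat.rat_const by simp
    ultimately have "?P (\<lambda>\<phi>. inverse (\<phi> z)) 1 ?Q"
      using True rat_inverse by blast
    show ?thesis by (rule exI, rule exI, fact)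
  next
    case False
    \<comment> \<open>The default 0 at \<phi> z = 0 matches \<open>inverse 0 = 0\<close>, so that
      the formula for the coefficients holds for every \<phi> and not only on the regular
      set.\<close>
    let ?Q = "\<lambda>\<phi>::'v \<Rightarrow> complex. if \<phi> z = 0 then 0 else inverse (fps_const (\<phi> z) + fps_X * fps_const (e z))"
    have z: "z \<in> H - span T" using False rat_inverse by auto
    have "(\<lambda>t. inverse (\<phi> z + t * e z)) has_laurent_expansion fps_to_fls (?Q \<phi>)"
      if "\<phi> \<in> reg T (H - span T)" for \<phi>
    proof -
      have nz: "\<phi> z \<noteq> 0" using that z by (auto simp: reg_def)
      then show ?thesis
        by (auto intro!: has_laurent_expansion_fps has_fps_expansion_inverse linear_has_fps_expansion)
    qed
    moreover have "(\<lambda>\<phi>. ?Q \<phi> $ k) \<in> rat (H - span T)" for k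
    proof -
      have "(\<lambda>\<phi>. ?Q \<phi> $ k) = (\<lambda>\<phi>. (- e z) ^ k * inverse (\<phi> z) ^ Suc k)"
        by (auto simp: inverse_linear_fps_nth)
      also have "\<dots> \<in> rat (H - span T)"
        by (intro rat.rat_mult rat.rat_const rat_power rat.rat_inverse z)
      finally show ?thesis .
    qed
    ultimately have "?P (\<lambda>\<phi>. inverse (\<phi> z)) 0 ?Q" by auto
    show ?thesis by (rule exI, rule exI, fact)
  qed
next
  case (rat_add f g)
  from rat_add.IH obtain m Q n R where "?P f m Q" "?P g n R" by (elim exE)
  note P = this
  \<comment> \<open>Both series are brought to the exponent m + n, which is 0 when m and n are, as
    the clause on functions without poles demands.\<close>
  let ?Q = "\<lambda>\<phi>. fps_X ^ n * Q \<phi> + fps_X ^ m * R \<phi>"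
  have E: "(\<lambda>t. (f (\<lambda>v. \<phi> v + t * e v) + g (\<lambda>v. \<phi> v + t * e v)) * t ^ (m + n))
      has_laurent_expansion fps_to_fls (?Q \<phi>)" if "\<phi> \<in> reg T (H - span T)" for \<phi>
  proof -
    have "(\<lambda>t. t ^ n * (f (\<lambda>v. \<phi> v + t * e v) * t ^ m) + t ^ m * (g (\<lambda>v. \<phi> v + t * e v) * t ^ n))
      has_laurent_expansion
        fps_to_fls (fps_X ^ n) * fps_to_fls (Q \<phi>) + fps_to_fls (fps_X ^ m) * fps_to_fls (R \<phi>)"
      using P[THEN conjunct2, THEN conjunct1, rule_format, OF that]
      by (intro has_laurent_expansion_add has_laurent_expansion_mult
          has_laurent_expansion_fps[OF has_fps_expansion_fps_X_power])
    moreover have "t ^ n * (f (\<lambda>v. \<phi> v + t * e v) * t ^ m) + t ^ m * (g (\<lambda>v. \<phi> v + t * e v) * t ^ n) =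
        (f (\<lambda>v. \<phi> v + t * e v) + g (\<lambda>v. \<phi> v + t * e v)) * t ^ (m + n)" for t
      by (simp add: algebra_simps power_add)
    ultimately show ?thesis by (simp add: fls_times_fps_to_fls)
  qed
  have C: "(\<lambda>\<phi>. ?Q \<phi> $ k) \<in> rat (H - span T)" for k
  proof -
    have "(\<lambda>\<phi>. ?Q \<phi> $ k) =
        (\<lambda>\<phi>. (if k < n then 0 else Q \<phi> $ (k - n)) + (if k < m then 0 else R \<phi> $ (k - m)))"
      by (simp add: fps_X_power_mult_nth)
    also have "\<dots> \<in> rat (H - span T)"
      using P[THEN conjunct2, THEN conjunct2, rule_format]
      by (cases "k < n"; cases "k < m"; intro rat.rat_add) (simp_all add: rat.rat_const)
    finally show ?thesis .
  qed
  have "?P (\<lambda>\<phi>. f \<phi> + g \<phi>) (m + n) ?Q"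
    by (intro conjI impI ballI allI E C) (use P(1)[THEN conjunct1] P(2)[THEN conjunct1] in simp_all)
  show ?case by (rule exI, rule exI, fact)
next
  case (rat_mult f g)
  from rat_mult.IH obtain m Q n R where "?P f m Q" "?P g n R" by (elim exE)
  note P = this
  let ?Q = "\<lambda>\<phi>. Q \<phi> * R \<phi>"
  have E: "(\<lambda>t. (f (\<lambda>v. \<phi> v + t * e v) * g (\<lambda>v. \<phi> v + t * e v)) * t ^ (m + n))
      has_laurent_expansion fps_to_fls (?Q \<phi>)" if "\<phi> \<in> reg T (H - span T)" for \<phi>
  proof -
    have E: "(\<lambda>t. (f (\<lambda>v. \<phi> v + t * e v) * t ^ m) * (g (\<lambda>v. \<phi> v + t * e v) * t ^ n))
      has_laurent_expansion fps_to_fls (Q \<phi>) * fps_to_fls (R \<phi>)"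
      using P[THEN conjunct2, THEN conjunct1, rule_format, OF that]
      by (intro has_laurent_expansion_mult)
    moreover have "(f (\<lambda>v. \<phi> v + t * e v) * t ^ m) * (g (\<lambda>v. \<phi> v + t * e v) * t ^ n) =
        (f (\<lambda>v. \<phi> v + t * e v) * g (\<lambda>v. \<phi> v + t * e v)) * t ^ (m + n)" for t
      by (simp add: algebra_simps power_add)
    ultimately show ?thesis by (simp add: fls_times_fps_to_fls)
  qed
  have C: "(\<lambda>\<phi>. ?Q \<phi> $ k) \<in> rat (H - span T)" for k
    unfolding fps_mult_nth using P[THEN conjunct2, THEN conjunct2, rule_format]
    by (intro rat_sum rat.rat_mult)
  have "?P (\<lambda>\<phi>. f \<phi> * g \<phi>) (m + n) ?Q"
    by (intro conjI impI ballI allI E C) (use P(1)[THEN conjunct1] P(2)[THEN conjunct1] in simp_all)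
  show ?case by (rule exI, rule exI, fact)
next
  case (rat_cong f g)
  from rat_cong.IH obtain m Q where P: "?P f m Q" by (elim exE)
  have "(\<lambda>t. g (\<lambda>v. \<phi> v + t * e v) * t ^ m) has_laurent_expansion fps_to_fls (Q \<phi>)"
    if \<phi>: "\<phi> \<in> reg T (H - span T)" for \<phi>
  proof -
    have "\<phi> \<in> dual scale" using \<phi> by (simp add: reg_def)
    then have "f (\<lambda>v. \<phi> v + t * e v) = g (\<lambda>v. \<phi> v + t * e v)" for t
      by (rule rat_cong.hyps(2)[OF dual_add_scale[OF _ assms(1)]])
    then show ?thesis using P[THEN conjunct2, THEN conjunct1, rule_format, OF \<phi>] by (simp only:)
  qed
  with P[THEN conjunct1] P[THEN conjunct2, THEN conjunct2]
  have "?P g m Q" by (intro conjI ballI)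
  show ?case by (rule exI, rule exI, fact)
qed

text \<open>A vector of \<open>Z\<close> in \<open>span (insert a S)\<close> takes the value t * e
  z, nonzero for t \<noteq> 0; any other stays near \<phi> z \<noteq> 0. As \<open>Z\<close> is
  finite, all conditions hold together. Thus functions that agree on \<open>reg S Z\<close> have the
  same expansion at a point of the hyperplane.\<close>

lemma eventually_reg:
  assumes "e \<in> dual scale" "\<forall>s\<in>S. e s = 0" "e a = 1"
    and "finite Z" "Z \<inter> span S = {}" and "\<phi> \<in> reg (insert a S) (Z - span (insert a S))"
  shows "eventually (\<lambda>t. (\<lambda>v. \<phi> v + t * e v) \<in> reg S Z) (at 0)"
proof -
  have ev: "eventually (\<lambda>t::complex. t \<noteq> 0) (at 0)"
    by (simp add: eventually_at_filter)
  have "eventually (\<lambda>t. \<phi> z + t * e z \<noteq> 0) (at 0)" if z: "z \<in> Z" for z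
  proof (cases "z \<in> span (insert a S)")
    case True
    from eval_off_hyperplane[OF assms(1-3,6) this] assms(5) z
    have "\<phi> z + t * e z = t * e z" "e z \<noteq> 0" for t by auto
    then show ?thesis using ev by (auto elim: eventually_mono)
  next
    case False
    then have "\<phi> z \<noteq> 0" using z assms(6) by (auto simp: reg_def)
    moreover have "((\<lambda>t. \<phi> z + t * e z) \<longlongrightarrow> \<phi> z + 0 * e z) (at 0)"
      by (intro tendsto_intros)
    ultimately show ?thesis by (intro tendsto_imp_eventually_ne) auto
  qed
  then have "eventually (\<lambda>t. \<forall>z\<in>Z. \<phi> z + t * e z \<noteq> 0) (at 0)"
    using assms(4) by (simp add: eventually_ball_finite)
  then show ?thesis
    by eventually_elim
      (use assms(1,2,6) in \<open>simp add: reg_def dual_add_scale\<close>)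
qed

text \<open>A summand with a pole at t = 0 has a denominator proportional to \<open>a\<close> modulo
  \<open>span S\<close>, so \<open>a\<close> already lies in the span of \<open>S\<close> and the
  denominators, and passing from \<open>S\<close> to \<open>T\<close> does not make them spanning.
  The restriction to k > 0 is essential: a summand without a pole may become spanning over
  \<open>T\<close>, but it only affects the orders from 0 on.\<close>

lemma low_expansion:
  assumes "e \<in> dual scale" "\<forall>s\<in>S. e s = 0" "e a = 1"
    and "finite Z" "Z \<inter> span S = {}" and "g \<in> low S Z"
  defines "T \<equiv> insert a S"
  shows "\<exists>Q. (\<forall>\<phi>\<in>reg T (Z - span T). (\<lambda>t. g (\<lambda>v. \<phi> v + t * e v)) has_laurent_expansion Q \<phi>) \<and>
    (\<forall>k>0. (\<lambda>\<phi>. Q \<phi> $$ (- k)) \<in> low T (Z - span T))"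
    (is "\<exists>Q. ?P g Q")
  using assms(6)
proof (induction rule: low.induct)
  case low_0
  have "?P (\<lambda>\<phi>. 0) (\<lambda>\<phi>. 0)" using low.low_0[of T "Z - span T"] by simp
  show ?case by (rule exI, fact)
next
  case (low_step g H G)
  from low_step.IH obtain R where R: "?P G R" by (elim exE)
  have "H \<inter> span S = {}" using low_step.hyps(2) assms(5) by auto
  from rat_expansion[OF assms(1-3) this low_step.hyps(1), folded T_def]
  obtain m Q where m: "H \<inter> span T = {} \<longrightarrow> m = 0"
    and Q: "\<And>\<phi>. \<phi>\<in>reg T (H - span T) \<Longrightarrow>
        (\<lambda>t. g (\<lambda>v. \<phi> v + t * e v) * t ^ m) has_laurent_expansion fps_to_fls (Q \<phi>)"
    and Qr: "\<And>k. (\<lambda>\<phi>. Q \<phi> $ k) \<in> rat (H - span T)"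
    by (elim exE conjE) blast
  let ?Q = "\<lambda>\<phi>. fls_shift (int m) (fps_to_fls (Q \<phi>)) + R \<phi>"
  have "(\<lambda>t. g (\<lambda>v. \<phi> v + t * e v) + G (\<lambda>v. \<phi> v + t * e v)) has_laurent_expansion ?Q \<phi>"
    if \<phi>: "\<phi> \<in> reg T (Z - span T)" for \<phi>
  proof (intro has_laurent_expansion_add)
    have "\<phi> \<in> reg T (H - span T)" using \<phi> low_step.hyps(2) by (auto simp: reg_def)
    from has_laurent_expansion_shift'[OF Q[OF this], of "int m"]
    have sh: "(\<lambda>t. g (\<lambda>v. \<phi> v + t * e v) * t ^ m * t powi - int m)
        has_laurent_expansion fls_shift (int m) (fps_to_fls (Q \<phi>))" .
    have "eventually (\<lambda>t::complex. t \<noteq> 0) (at 0)"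
      by (simp add: eventually_at_filter)
    then have "eventually (\<lambda>t. g (\<lambda>v. \<phi> v + t * e v) * t ^ m * t powi - int m =
        g (\<lambda>v. \<phi> v + t * e v)) (at 0)"
      by eventually_elim (simp add: power_int_minus)
    from has_laurent_expansion_cong[THEN iffD1, OF this refl sh]
    show "(\<lambda>t. g (\<lambda>v. \<phi> v + t * e v)) has_laurent_expansion fls_shift (int m) (fps_to_fls (Q \<phi>))" .
  qed (use R \<phi> in auto)
  moreover have "(\<lambda>\<phi>. ?Q \<phi> $$ (- k)) \<in> low T (Z - span T)" if k: "k > 0" for k
  proof -
    have "(\<lambda>\<phi>. fls_shift (int m) (fps_to_fls (Q \<phi>)) $$ (- k)) \<in> low T (Z - span T)"
    \<comment> \<open>The coefficient of order -k is number m - k of the power series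
      \<open>Q \<phi>\<close>. If that index is not negative then m > 0, so some denominator z lies
      in \<open>span T\<close>.\<close>
    proof (cases "int m - k < 0")
      case True
      then show ?thesis by (simp add: low.low_0)
    next
      case False
      with m k obtain z where z: "z \<in> H" "z \<in> span T" by force
      then have "z \<notin> span S" using low_step.hyps(2) assms(5) by auto
      \<comment> \<open>Exchange: z lies in the span of \<open>a\<close> and \<open>S\<close> but
        not of \<open>S\<close> alone, so \<open>a\<close> can be recovered from z.\<close>
      then have "a \<in> span (insert z S)"
        using z(2) in_span_insert[of z a S] unfolding T_def by blast
      then have "a \<in> span (S \<union> H)"
        using z(1) span_mono[of "insert z S" "S \<union> H"] by auto
      then have "T \<union> (H - span T) \<subseteq> span (S \<union> H)"
        unfolding T_def by (auto intro: span_base)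
      then have "span (T \<union> (H - span T)) \<subseteq> span (S \<union> H)"
        by (intro span_minimal) auto
      then have "span (T \<union> (H - span T)) \<noteq> UNIV"
        using low_step.hyps(3) by auto
      moreover have "H - span T \<subseteq> Z - span T" using low_step.hyps(2) by auto
      moreover have "(\<lambda>\<phi>. fls_shift (int m) (fps_to_fls (Q \<phi>)) $$ (- k)) \<in> rat (H - span T)"
        using False Qr by simp
      ultimately show ?thesis by (intro low_rat)
    qed
    from low_add[OF this] R k show ?thesis by auto
  qed
  ultimately have "?P (\<lambda>\<phi>. g \<phi> + G \<phi>) ?Q" by (intro conjI allI ballI impI)
  show ?case by (rule exI, fact)
next
  case (low_cong G G')
  from low_cong.IH obtain R where R: "?P G R" by (elim exE)
  have "(\<lambda>t. G' (\<lambda>v. \<phi> v + t * e v)) has_laurent_expansion R \<phi>"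
    if \<phi>: "\<phi> \<in> reg T (Z - span T)" for \<phi>
  proof -
    have "eventually (\<lambda>t. G (\<lambda>v. \<phi> v + t * e v) = G' (\<lambda>v. \<phi> v + t * e v)) (at 0)"
      using eventually_reg[OF assms(1-5) \<phi>[unfolded T_def]]
      by eventually_elim (rule low_cong.hyps)
    from has_laurent_expansion_cong[THEN iffD1, OF this refl] R \<phi> show ?thesis by blast
  qed
  with R have "?P G' R" by simp
  show ?case by (rule exI, fact)
qed

section \<open>Linear independence\<close>

text \<open>If \<open>S\<close> already spans, no set of denominators is admissible, so only zero
  remains. This is R_{X,-1} = 0, the base of the induction.\<close>

lemma low_trivial:
  assumes "span S = UNIV" "G \<in> low S Z" "\<phi> \<in> reg S Z"
  shows "G \<phi> = 0"
  using assms(2,3)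
proof (induction rule: low.induct)
  case (low_step g H G)
  then show ?case using assms(1) span_mono[of S "S \<union> H"] by auto
qed auto

text \<open>The factors with index in \<open>J\<close> equal t * e (x i) and produce the pole of
  order \<open>card J\<close>; the other factors are nonzero at t = 0, so the leading coefficient is
  obtained by putting t = 0 in them.\<close>

lemma inverse_prod_expansion:
  assumes "e \<in> dual scale" "\<forall>s\<in>S. e s = 0" "e a = 1"
    and \<phi>: "\<phi> \<in> reg (insert a S) Z" and "finite I"
    and S: "\<And>i. i \<in> I \<Longrightarrow> x i \<notin> span S"
    and nz: "\<And>i. i \<in> I \<Longrightarrow> x i \<notin> span (insert a S) \<Longrightarrow> \<phi> (x i) \<noteq> 0"
  defines "J \<equiv> {i \<in> I. x i \<in> span (insert a S)}"
  shows "\<exists>Q. (\<lambda>t. inverse (\<Prod>i\<in>I. \<phi> (x i) + t * e (x i))) has_laurent_expansion Q \<and>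
    (\<forall>k>int (card J). Q $$ (- k) = 0) \<and>
    Q $$ (- int (card J)) = inverse (\<Prod>i\<in>J. e (x i)) * inverse (\<Prod>i\<in>I - J. \<phi> (x i))"
proof -
  let ?L = "\<lambda>i. fps_const (\<phi> (x i)) + fps_X * fps_const (e (x i))"
  let ?E = "inverse (\<Prod>i\<in>J. e (x i))"
  let ?R = "fps_const ?E * inverse (\<Prod>i\<in>I - J. ?L i)"
  have JI: "J \<subseteq> I" by (auto simp: J_def)
  have nth0: "(\<Prod>i\<in>K. ?L i) $ 0 = (\<Prod>i\<in>K. \<phi> (x i))" for K
    by (induction K rule: infinite_finite_induct) simp_all
  have "(\<Prod>i\<in>I - J. ?L i) $ 0 \<noteq> 0"
    unfolding nth0 using \<open>finite I\<close> nz by (auto simp: J_def)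
  then have "(\<lambda>t. ?E * inverse (\<Prod>i\<in>I - J. \<phi> (x i) + t * e (x i))) has_fps_expansion ?R"
    by (intro has_fps_expansion_mult has_fps_expansion_const has_fps_expansion_inverse
        has_fps_expansion_prod linear_has_fps_expansion)
  from has_laurent_expansion_shift'[OF has_laurent_expansion_fps[OF this], of "int (card J)"]
  have sh: "(\<lambda>t. ?E * inverse (\<Prod>i\<in>I - J. \<phi> (x i) + t * e (x i)) * t powi - int (card J))
      has_laurent_expansion fls_shift (int (card J)) (fps_to_fls ?R)" .
  have "(\<Prod>i\<in>I. \<phi> (x i) + t * e (x i)) =
      t ^ card J * (\<Prod>i\<in>J. e (x i)) * (\<Prod>i\<in>I - J. \<phi> (x i) + t * e (x i))" for t
  proof -
    have "\<phi> (x i) + t * e (x i) = t * e (x i)" if "i \<in> J" for i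
      using eval_off_hyperplane(1)[OF assms(1-3) \<phi>] that by (simp add: J_def)
    then have "(\<Prod>i\<in>J. \<phi> (x i) + t * e (x i)) = t ^ card J * (\<Prod>i\<in>J. e (x i))"
      by (simp add: prod.distrib)
    then show ?thesis
      using prod.subset_diff[OF JI \<open>finite I\<close>, of "\<lambda>i. \<phi> (x i) + t * e (x i)"]
      by (simp add: mult_ac)
  qed
  then have "?E * inverse (\<Prod>i\<in>I - J. \<phi> (x i) + t * e (x i)) * t powi - int (card J) =
      inverse (\<Prod>i\<in>I. \<phi> (x i) + t * e (x i))" for t
    by (simp add: power_int_minus mult_ac)
  with sh have "(\<lambda>t. inverse (\<Prod>i\<in>I. \<phi> (x i) + t * e (x i)))
      has_laurent_expansion fls_shift (int (card J)) (fps_to_fls ?R)"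
    by (simp only:)
  moreover have "fls_shift (int (card J)) (fps_to_fls ?R) $$ (- int (card J)) =
      ?E * inverse (\<Prod>i\<in>I - J. \<phi> (x i))"
    by (simp only: fls_shift_nth fps_to_fls_nth) (simp add: nth0 fps_inverse_nth_0)
  moreover have "\<forall>k>int (card J). fls_shift (int (card J)) (fps_to_fls ?R) $$ (- k) = 0"
    by (simp only: fls_shift_nth fps_to_fls_nth) simp
  ultimately show ?thesis by blast
qed

text \<open>Indices with \<open>x i\<close> in \<open>span S\<close> break every basis and are left
  out of the products. The set \<open>Z\<close> of admissible poles is separate from the list:
  deletion of the last vector leaves \<open>Z\<close> as it is, contraction replaces it by
  \<open>Z - span T\<close>.\<close>

lemma bases_independent:
  assumes "finite Z" "Z \<inter> span S = {}" "\<And>i. i < n \<Longrightarrow> x i \<notin> span S \<Longrightarrow> x i \<in> Z"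
    and "(\<lambda>\<phi>. \<Sum>b\<in>bases x n S. c b * inverse (\<Prod>i\<in>{i \<in> brk x n S b. x i \<notin> span S}. \<phi> (x i))) \<in> low S Z"
    and "b \<in> bases x n S"
  shows "c b = 0"
  using assms
proof (induction n arbitrary: S Z c b)
  case 0
  then have sp: "span S = UNIV" and b: "b = {}" by (simp_all add: bases_0 split: if_splits)
  have "(\<lambda>v. 0) \<in> dual scale" by (intro dualI) simp_all
  \<comment> \<open>As \<open>Z\<close> avoids \<open>span S = UNIV\<close>, it is empty and the
    zero functional is regular. Evaluation there leaves the coefficient of the only basis, the empty
    one, times the empty product.\<close>
  then have "(\<lambda>v. 0) \<in> reg S Z" using sp 0(2) by (simp add: reg_def)
  from low_trivial[OF sp 0(4) this] show ?case
    by (simp add: sp b bases_0 brk_def)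
next
  case (Suc n)
  let ?a = "x n"
  let ?T = "insert ?a S"
  let ?I = "\<lambda>b. {i \<in> brk x (Suc n) S b. x i \<notin> span S}"
  have I_old: "?I b = {i \<in> brk x n S b. x i \<notin> span S}" if "b \<in> bases x n S" for b
    using brk_Suc[OF bases_subset[OF that]] by auto
  have old: "c b = 0" if b: "b \<in> bases x n S"
    and G: "(\<lambda>\<phi>. \<Sum>b\<in>bases x n S. c b * inverse (\<Prod>i\<in>?I b. \<phi> (x i))) \<in> low S Z" for b
  proof (rule Suc.IH[OF Suc.prems(1,2) _ _ b])
    show "x i \<in> Z" if "i < n" "x i \<notin> span S" for i using that Suc.prems(3) by simp
    show "(\<lambda>\<phi>. \<Sum>b\<in>bases x n S. c b * inverse (\<Prod>i\<in>{i \<in> brk x n S b. x i \<notin> span S}. \<phi> (x i))) \<in> low S Z"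
      using G by (simp add: I_old cong: sum.cong)
  qed
  show ?case
  proof (cases "?a \<in> span S")
    case True
    then have "bases x (Suc n) S = bases x n S" by (simp add: bases_Suc)
    then show ?thesis using old Suc.prems(4,5) by simp
  next
    case False
    obtain e where e: "e \<in> dual scale" "\<forall>s\<in>span S. e s = 0" "e ?a = 1"
      by (rule dual_separates[OF False])
    have e2: "\<forall>s\<in>S. e s = 0" using e(2) span_base by blast
    let ?Z = "Z - span ?T"
    \<comment> \<open>The vectors that are nonzero multiples of \<open>x n\<close> modulo
      \<open>span S\<close>, with \<open>n\<close> itself included; their number is the largest pole
      order that can occur.\<close>
    define pole where "pole = {i \<in> {..n}. x i \<in> span ?T \<and> x i \<notin> span S}"
    define m where "m = card pole"
    have pole: "finite pole" "n \<in> pole" using False by (auto simp: pole_def span_base)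
    then have m: "m > 0" by (auto simp: m_def card_gt_0_iff)
    let ?J = "\<lambda>b. {i \<in> ?I b. x i \<in> span ?T}"
    \<comment> \<open>A basis without \<open>n\<close> is not broken by \<open>n\<close>, so at
      least this factor is missing from its pole.\<close>
    have J_old: "card (?J b) < m" if "b \<in> bases x n S" for b
      unfolding m_def
    proof (rule psubset_card_mono[OF pole(1)])
      have "n \<notin> ?J b" using I_old[OF that] by (auto simp: brk_def)
      moreover have "?J b \<subseteq> pole" by (auto simp: pole_def brk_def less_Suc_eq_le)
      ultimately show "?J b \<subset> pole" using pole(2) by blast
    qed
    \<comment> \<open>Once \<open>n\<close> is a member, every tail spans \<open>x n\<close>, so all
      vectors proportional to it break the basis.\<close>
    have J_new: "?J (insert n b) = pole" if "b \<in> bases x n ?T" for b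
    proof -
      have "x i \<in> span (insert ?a S \<union> x ` {k \<in> b. i \<le> k})" if "x i \<in> span ?T" for i
        using that span_mono[of ?T "insert ?a S \<union> x ` {k \<in> b. i \<le> k}"] by auto
      then show ?thesis
        unfolding brk_Suc_insert[OF bases_subset[OF that]]
        using False by (auto simp: pole_def brk_def span_base)
    qed
    have I_new: "?I (insert n b) - pole = {i \<in> brk x n ?T b. x i \<notin> span ?T}" if "b \<in> bases x n ?T" for b
    proof -
      have "x i \<notin> span S" if "x i \<notin> span ?T" for i
        using that span_mono[of S ?T] by auto
      then show ?thesis
        unfolding brk_Suc_insert[OF bases_subset[OF that]] using False
        by (auto simp: pole_def brk_def span_base)
    qed
    let ?g = "\<lambda>\<phi>. \<Sum>b\<in>bases x (Suc n) S. c b * inverse (\<Prod>i\<in>?I b. \<phi> (x i))"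
    from low_expansion[OF e(1) e2 e(3) Suc.prems(1,2,4)]
    obtain Q where Q: "\<And>\<phi>. \<phi> \<in> reg ?T ?Z \<Longrightarrow> (\<lambda>t. ?g (\<lambda>v. \<phi> v + t * e v)) has_laurent_expansion Q \<phi>"
      and Ql: "\<And>k. k > 0 \<Longrightarrow> (\<lambda>\<phi>. Q \<phi> $$ (- k)) \<in> low ?T ?Z"
      by (elim exE conjE) blast
    \<comment> \<open>The leading coefficients of all bases through \<open>n\<close> share this
      factor, because they have the same pole indices.\<close>
    define C where "C = inverse (\<Prod>i\<in>pole. e (x i))"
    have C: "C \<noteq> 0"
    proof -
      have "e (x i) \<noteq> 0" if "i \<in> pole" for i
      proof -
        \<comment> \<open>The fact that e is nonzero on the pole vectors is stated at a regular
          point; without poles to avoid, the zero functional is one.\<close>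
        have "(\<lambda>v. 0) \<in> reg (insert ?a S) {}" by (auto simp: reg_def intro: dualI)
        from eval_off_hyperplane(2)[OF e(1) e2 e(3) this] that show ?thesis by (auto simp: pole_def)
      qed
      then show ?thesis using pole(1) by (simp add: C_def)
    qed
    let ?h = "\<lambda>\<phi>. \<Sum>b\<in>bases x n ?T. (c (insert n b) * C) *
        inverse (\<Prod>i\<in>{i \<in> brk x n ?T b. x i \<notin> span ?T}. \<phi> (x i))"
    have coeff: "Q \<phi> $$ (- int m) = ?h \<phi>" if \<phi>: "\<phi> \<in> reg ?T ?Z" for \<phi>
    proof -
      let ?P = "\<lambda>b Q. (\<lambda>t. inverse (\<Prod>i\<in>?I b. \<phi> (x i) + t * e (x i))) has_laurent_expansion Q \<and>
        (\<forall>k>int (card (?J b)). Q $$ (- k) = 0) \<and>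
        Q $$ (- int (card (?J b))) = inverse (\<Prod>i\<in>?J b. e (x i)) * inverse (\<Prod>i\<in>?I b - ?J b. \<phi> (x i))"
      have "\<forall>b. \<exists>Q. ?P b Q"
      proof (rule allI, rule inverse_prod_expansion[OF e(1) e2 e(3) \<phi>])
        fix b i assume i: "i \<in> ?I b" "x i \<notin> span ?T"
        then have "x i \<in> ?Z" using Suc.prems(3)[of i] by (auto simp: brk_def)
        then show "\<phi> (x i) \<noteq> 0" using \<phi> by (auto simp: reg_def)
      qed simp_all
      from choice[OF this] obtain R where P: "\<forall>b. ?P b (R b)" by (elim exE)
      note R = P[rule_format, THEN conjunct1] P[rule_format, THEN conjunct2, THEN conjunct1, rule_format]
        P[rule_format, THEN conjunct2, THEN conjunct2]
      have "(\<lambda>t. ?g (\<lambda>v. \<phi> v + t * e v)) has_laurent_expansion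
          (\<Sum>b\<in>bases x (Suc n) S. fls_const (c b) * R b)"
        by (intro has_laurent_expansion_sum has_laurent_expansion_mult has_laurent_expansion_const R)
      then have "Q \<phi> = (\<Sum>b\<in>bases x (Suc n) S. fls_const (c b) * R b)"
        using Q[OF \<phi>] by (rule has_laurent_expansion_unique[rotated])
      then have "Q \<phi> $$ (- int m) = (\<Sum>b\<in>bases x (Suc n) S. c b * R b $$ (- int m))"
        by (simp add: fls_nth_sum)
      \<comment> \<open>Bases without \<open>n\<close> have pole order below m and contribute
        nothing to the coefficient of order -m.\<close>
      also have "\<dots> = (\<Sum>b\<in>insert n ` bases x n ?T. c b * R b $$ (- int m))"
        using R(2)[of _ "int m"] J_old False by (intro sum.mono_neutral_right) (auto simp: bases_Suc)
      also have "\<dots> = (\<Sum>b\<in>bases x n ?T. c (insert n b) * R (insert n b) $$ (- int m))"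
      proof (rule sum.reindex_cong[OF _ refl refl])
        show "inj_on (insert n) (bases x n ?T)"
          using bases_subset by (intro inj_onI) (metis insert_ident lessThan_iff less_irrefl subsetD)
      qed
      also have "\<dots> = ?h \<phi>"
      proof (rule sum.cong[OF refl])
        fix b assume b: "b \<in> bases x n ?T"
        have "R (insert n b) $$ (- int m) = C * inverse (\<Prod>i\<in>{i \<in> brk x n ?T b. x i \<notin> span ?T}. \<phi> (x i))"
          using R(3)[of "insert n b"] unfolding J_new[OF b] I_new[OF b] C_def m_def .
        then show "c (insert n b) * R (insert n b) $$ (- int m) = c (insert n b) * C *
            inverse (\<Prod>i\<in>{i \<in> brk x n ?T b. x i \<notin> span ?T}. \<phi> (x i))" by simp
      qed
      finally show ?thesis .
    qed
    have "(\<lambda>\<phi>. Q \<phi> $$ (- int m)) \<in> low ?T ?Z"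
      by (rule Ql) (simp add: m)
    then have "?h \<in> low ?T ?Z"
      by (rule low_cong) (rule coeff)
    then have "c (insert n b) * C = 0" if "b \<in> bases x n ?T" for b
    proof (intro Suc.IH[of ?Z ?T "\<lambda>b. c (insert n b) * C", OF _ _ _ _ that])
      show "x i \<in> ?Z" if "i < n" "x i \<notin> span ?T" for i
        using that Suc.prems(3)[of i] span_mono[of S ?T] by auto
    qed (use Suc.prems(1) in auto)
    then have new: "c (insert n b) = 0" if "b \<in> bases x n ?T" for b using that C by auto
    \<comment> \<open>With the coefficients through \<open>n\<close> gone, the original relation
      only involves bases of the shorter list, over the same \<open>S\<close> and the same
      \<open>Z\<close>.\<close>
    have "?g = (\<lambda>\<phi>. \<Sum>b\<in>bases x n S. c b * inverse (\<Prod>i\<in>?I b. \<phi> (x i)))"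
      using new False by (intro ext sum.mono_neutral_right) (auto simp: bases_Suc)
    then have "c b = 0" if "b \<in> bases x n S" for b
      using old[OF that] Suc.prems(4) by simp
    then show ?thesis using new Suc.prems(5) False by (auto simp: bases_Suc)
  qed
qed

section \<open>Generation\<close>

text \<open>Ideals of \<open>rat {}\<close> on total functions, built up one multiple of a generator
  at a time, so that no restriction to the dual intervenes in the inductions. Restriction to the
  dual later turns them into ideals of \<open>SymAlg\<close>.\<close>

inductive_set idl :: "(('v \<Rightarrow> complex) \<Rightarrow> complex) set \<Rightarrow> (('v \<Rightarrow> complex) \<Rightarrow> complex) set" for G where
  idl_0: "(\<lambda>\<phi>. 0) \<in> idl G"
| idl_step: "p \<in> rat {} \<Longrightarrow> s \<in> G \<Longrightarrow> h \<in> idl G \<Longrightarrow> (\<lambda>\<phi>. p \<phi> * s \<phi> + h \<phi>) \<in> idl G"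

lemma idl_mult_gen: "p \<in> rat {} \<Longrightarrow> s \<in> G \<Longrightarrow> (\<lambda>\<phi>. p \<phi> * s \<phi>) \<in> idl G"
  using idl_step[OF _ _ idl_0, of p s G] by simp

lemma idl_gen: "s \<in> G \<Longrightarrow> s \<in> idl G"
  using idl_mult_gen[OF rat_const, of s G 1] by simp

lemma idl_add:
  assumes "f \<in> idl G" "g \<in> idl G"
  shows "(\<lambda>\<phi>. f \<phi> + g \<phi>) \<in> idl G"
  using assms
proof (induction rule: idl.induct)
  case (idl_step p s h)
  then show ?case
    using idl.idl_step[of p s G "\<lambda>\<phi>. h \<phi> + g \<phi>"] by (simp add: add.assoc)
qed simp

lemma idl_mult:
  assumes "f \<in> idl G" "q \<in> rat {}"
  shows "(\<lambda>\<phi>. q \<phi> * f \<phi>) \<in> idl G"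
  using assms
proof (induction rule: idl.induct)
  case (idl_step p s h)
  then show ?case
    using idl.idl_step[of "\<lambda>\<phi>. q \<phi> * p \<phi>" s G "\<lambda>\<phi>. q \<phi> * h \<phi>"] rat_mult[of q "{}" p]
    by (simp add: distrib_left mult.assoc)
qed (simp add: idl_0)

lemma idl_mono:
  assumes "f \<in> idl G" "G \<subseteq> idl G'"
  shows "f \<in> idl G'"
  using assms
proof (induction rule: idl.induct)
  case (idl_step p s h)
  then show ?case
    using idl_add[OF idl_mult[of s G' p], of h] by auto
qed (simp add: idl_0)

definition monom_at :: "(nat \<Rightarrow> 'v) \<Rightarrow> nat set \<Rightarrow> ('v \<Rightarrow> complex) \<Rightarrow> complex" where
  "monom_at x Y = (\<lambda>\<phi>. \<Prod>i\<in>Y. \<phi> (x i))"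

text \<open>The linear forms from \<open>S\<close> present S[V / span S] as a quotient of S[V]; the
  monomials belong to the cocircuits of the images of the vectors in V / span S.\<close>

definition gens :: "(nat \<Rightarrow> 'v) \<Rightarrow> nat \<Rightarrow> 'v set \<Rightarrow> (('v \<Rightarrow> complex) \<Rightarrow> complex) set" where
  "gens x n S = (\<lambda>v \<phi>. \<phi> v) ` S \<union>
     monom_at x ` {Y. Y \<subseteq> {..<n} \<and> span (S \<union> x ` ({..<n} - Y)) \<noteq> UNIV}"

lemma monom_at_rat: "monom_at x Y \<in> rat H"
  unfolding monom_at_def by (intro rat_prod rat_vec)

lemma monom_at_insert:
  "finite Y \<Longrightarrow> i \<notin> Y \<Longrightarrow> monom_at x (insert i Y) = (\<lambda>\<phi>. \<phi> (x i) * monom_at x Y \<phi>)"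
  by (simp add: monom_at_def)

text \<open>The new vector stays in the complement of every \<open>Y\<close> but adds nothing to its
  span, so cocircuits of the shorter list remain cocircuits.\<close>

lemma gens_Suc_in_span:
  assumes "x n \<in> span S"
  shows "gens x n S \<subseteq> gens x (Suc n) S"
proof -
  have "span (S \<union> x ` ({..<Suc n} - Y)) = span (S \<union> x ` ({..<n} - Y))" if "Y \<subseteq> {..<n}" for Y
  proof -
    have "S \<union> x ` ({..<Suc n} - Y) = insert (x n) (S \<union> x ` ({..<n} - Y))"
      using that by (auto simp: lessThan_Suc)
    moreover have "x n \<in> span (S \<union> x ` ({..<n} - Y))"
      using assms span_mono[of S "S \<union> x ` ({..<n} - Y)"] by auto
    ultimately show ?thesis by (simp add: span_redundant)
  qed
  then have "{Y. Y \<subseteq> {..<n} \<and> span (S \<union> x ` ({..<n} - Y)) \<noteq> UNIV} \<subseteq>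
      {Y. Y \<subseteq> {..<Suc n} \<and> span (S \<union> x ` ({..<Suc n} - Y)) \<noteq> UNIV}"
    by (auto simp: lessThan_Suc)
  then show ?thesis unfolding gens_def by (intro Un_mono image_mono order_refl)
qed

text \<open>For Y below \<open>n\<close> the complement in the longer list contains
  \<open>n\<close>, so cocircuits of the contraction are cocircuits of the longer list. The one
  generator that may be new is the linear form \<open>x n\<close>, whose multiples are collected in
  p. This describes the kernel of A_X -> A_{X/a}.\<close>

lemma idl_contract:
  assumes "h \<in> idl (gens x n (insert (x n) S))"
  shows "\<exists>h'\<in>idl (gens x (Suc n) S). \<exists>p\<in>rat {}. h = (\<lambda>\<phi>. h' \<phi> + p \<phi> * \<phi> (x n))"
  using assms
proof (induction rule: idl.induct)
  case idl_0
  then show ?case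
    by (intro bexI[of _ "\<lambda>\<phi>. 0"] idl.idl_0 rat_const) simp
next
  case (idl_step q s h)
  then obtain h' p where h: "h' \<in> idl (gens x (Suc n) S)" "p \<in> rat {}" "h = (\<lambda>\<phi>. h' \<phi> + p \<phi> * \<phi> (x n))"
    by blast
  show ?case
  proof (cases "s = (\<lambda>\<phi>. \<phi> (x n))")
    case True
    then have "(\<lambda>\<phi>. q \<phi> * s \<phi> + h \<phi>) = (\<lambda>\<phi>. h' \<phi> + (q \<phi> + p \<phi>) * \<phi> (x n))"
      using h(3) by (simp add: algebra_simps)
    then show ?thesis
      by (intro bexI[OF _ h(1)] bexI[OF _ rat_add[OF idl_step.hyps(1) h(2)]])
  next
    case False
    have "s \<in> gens x (Suc n) S"
    proof (cases "s \<in> (\<lambda>v \<phi>. \<phi> v) ` S")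
      case s: False
      then obtain Y where Y: "s = monom_at x Y" "Y \<subseteq> {..<n}" "span (insert (x n) S \<union> x ` ({..<n} - Y)) \<noteq> UNIV"
        using False idl_step.hyps(2) unfolding gens_def by blast
      have "insert (x n) S \<union> x ` ({..<n} - Y) = S \<union> x ` ({..<Suc n} - Y)"
        using Y(2) by (auto simp: lessThan_Suc)
      with Y(3) have "span (S \<union> x ` ({..<Suc n} - Y)) \<noteq> UNIV" by (simp only: not_False_eq_True)
      then show ?thesis unfolding gens_def Y(1) using Y(2) by (intro UnI2 imageI) auto
    qed (simp add: gens_def)
    note idl.idl_step[OF idl_step.hyps(1) this h(1)]
    moreover have "(\<lambda>\<phi>. q \<phi> * s \<phi> + h \<phi>) = (\<lambda>\<phi>. (q \<phi> * s \<phi> + h' \<phi>) + p \<phi> * \<phi> (x n))"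
      using h(3) by (simp add: algebra_simps)
    ultimately show ?thesis
      by (intro bexI[of _ "\<lambda>\<phi>. q \<phi> * s \<phi> + h' \<phi>"] bexI[OF _ h(2)])
  qed
qed

text \<open>Adding \<open>n\<close> to a cocircuit Y of the shorter list leaves the complement
  unchanged, so multiplication by \<open>x n\<close> carries M_Y to the monomial of a cocircuit of
  the longer list. This is the map A_{X-a} -> A_X.\<close>

lemma idl_delete:
  assumes "h \<in> idl (gens x n S)"
  shows "(\<lambda>\<phi>. h \<phi> * \<phi> (x n)) \<in> idl (gens x (Suc n) S)"
  using assms
proof (induction rule: idl.induct)
  case (idl_step p s h)
  have "\<exists>q\<in>rat {}. \<exists>r\<in>gens x (Suc n) S. \<forall>\<phi>. s \<phi> * \<phi> (x n) = q \<phi> * r \<phi>"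
  proof (cases "s \<in> (\<lambda>v \<phi>. \<phi> v) ` S")
    case True
    then have "s \<in> gens x (Suc n) S" by (simp add: gens_def)
    then show ?thesis
      by (intro bexI[OF _ rat_vec[of "x n"]] bexI[of _ s]) (simp_all add: mult.commute)
  next
    case False
    then obtain Y where Y: "s = monom_at x Y" "Y \<subseteq> {..<n}" "span (S \<union> x ` ({..<n} - Y)) \<noteq> UNIV"
      using idl_step.hyps(2) unfolding gens_def by blast
    have "{..<Suc n} - insert n Y = {..<n} - Y" by auto
    with Y(2,3) have "monom_at x (insert n Y) \<in> gens x (Suc n) S"
      unfolding gens_def by (intro UnI2 imageI) (auto simp: lessThan_Suc)
    moreover have "finite Y" "n \<notin> Y" using Y(2) finite_subset by auto
    ultimately show ?thesis
      by (intro bexI[OF _ rat_const[of 1]] bexI[of _ "monom_at x (insert n Y)"])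
        (simp_all add: monom_at_insert Y(1))
  qed
  then obtain q r where "q \<in> rat {}" "r \<in> gens x (Suc n) S" "\<And>\<phi>. s \<phi> * \<phi> (x n) = q \<phi> * r \<phi>"
    by blast
  moreover from this have "(\<lambda>\<phi>. (p \<phi> * s \<phi> + h \<phi>) * \<phi> (x n)) = (\<lambda>\<phi>. (p \<phi> * q \<phi>) * r \<phi> + h \<phi> * \<phi> (x n))"
    by (simp add: distrib_right mult.assoc)
  ultimately show ?case
    using idl.idl_step[OF rat_mult[OF idl_step.hyps(1)] _ idl_step.IH] by simp
qed (simp add: idl_0)

text \<open>The linear forms from a spanning set generate the maximal ideal at the origin, and
  modulo it a polynomial is its constant term.\<close>

lemma poly_mod_span:
  assumes "span S = UNIV" "f \<in> rat {}"
  shows "\<exists>h\<in>idl ((\<lambda>v \<phi>. \<phi> v) ` S). \<exists>c. \<forall>\<phi>\<in>dual scale. f \<phi> = h \<phi> + c"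
  using assms(2)
proof (induction rule: rat.induct)
  case (rat_const c)
  then show ?case by (intro bexI[OF _ idl_0] exI[of _ c]) simp
next
  case (rat_vec v)
  let ?I = "idl ((\<lambda>v \<phi>. \<phi> v) ` S)"
  have "v \<in> span S" using assms(1) by simp
  then have "\<exists>h\<in>?I. \<forall>\<phi>\<in>dual scale. \<phi> v = h \<phi>"
  proof (induction rule: span_induct_alt)
    case base
    show ?case by (intro bexI[OF _ idl_0]) (simp add: dualD)
  next
    case (step c s v)
    then obtain h where h: "h \<in> ?I" "\<forall>\<phi>\<in>dual scale. \<phi> v = h \<phi>" by blast
    have "(\<lambda>\<phi>. c * \<phi> s + h \<phi>) \<in> ?I"
      using idl_step[OF rat_const _ h(1), of "\<lambda>\<phi>. \<phi> s" c] step.hyps by blast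
    then show ?case
      by (rule rev_bexI) (simp add: dualD h)
  qed
  then obtain h where "h \<in> ?I" "\<forall>\<phi>\<in>dual scale. \<phi> v = h \<phi>" by blast
  then show ?case by (intro bexI[of _ h] exI[of _ 0]) simp_all
next
  case (rat_add f g)
  then obtain h h' c c' where
    "h \<in> idl ((\<lambda>v \<phi>. \<phi> v) ` S)" "\<forall>\<phi>\<in>dual scale. f \<phi> = h \<phi> + c"
    "h' \<in> idl ((\<lambda>v \<phi>. \<phi> v) ` S)" "\<forall>\<phi>\<in>dual scale. g \<phi> = h' \<phi> + c'" by blast
  then show ?case
    by (intro bexI[OF _ idl_add[of h _ h']] exI[of _ "c + c'"]) simp_all
next
  case (rat_mult f g)
  then obtain h h' c c' where h:
    "h \<in> idl ((\<lambda>v \<phi>. \<phi> v) ` S)" "\<forall>\<phi>\<in>dual scale. f \<phi> = h \<phi> + c"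
    "h' \<in> idl ((\<lambda>v \<phi>. \<phi> v) ` S)" "\<forall>\<phi>\<in>dual scale. g \<phi> = h' \<phi> + c'" by blast
  have "(\<lambda>\<phi>. g \<phi> * h \<phi> + c * h' \<phi>) \<in> idl ((\<lambda>v \<phi>. \<phi> v) ` S)"
    by (intro idl_add idl_mult h rat_mult.hyps rat_const)
  then show ?case
    by (rule rev_bexI) (use h in \<open>auto simp: algebra_simps intro!: exI[of _ "c * c'"]\<close>)
next
  case (rat_cong f g)
  then show ?case by simp
qed simp

text \<open>Normal forms are assembled along A_{X-a} -> A_X -> A_{X/a}. Reducing f in the
  contraction leaves an error p * a modulo the ideal, and p is reduced in the deletion. Bases
  through \<open>n\<close> keep their monomial, since \<open>n\<close> breaks them; the others gain
  the factor a.\<close>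

lemma bases_spanning:
  assumes "f \<in> rat {}"
  shows "\<exists>h\<in>idl (gens x n S). \<exists>c. \<forall>\<phi>\<in>dual scale.
    f \<phi> = h \<phi> + (\<Sum>b\<in>bases x n S. c b * monom_at x ({..<n} - brk x n S b) \<phi>)"
  using assms
proof (induction n arbitrary: S f)
  case 0
  show ?case
  proof (cases "span S = UNIV")
    case True
    then have "gens x 0 S = (\<lambda>v \<phi>. \<phi> v) ` S" by (simp add: gens_def)
    moreover obtain h c where "h \<in> idl ((\<lambda>v \<phi>. \<phi> v) ` S)" "\<forall>\<phi>\<in>dual scale. f \<phi> = h \<phi> + c"
      using poly_mod_span[OF True 0] by blast
    ultimately show ?thesis
      by (intro bexI[of _ h] exI[of _ "\<lambda>b. c"]) (simp_all add: bases_0 True monom_at_def)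
  next
    case False
    \<comment> \<open>Over a set that does not span, the empty set is a cocircuit, so the ideal
      contains 1 and there is no basis to account for.\<close>
    then have "monom_at x {} \<in> gens x 0 S" by (simp add: gens_def)
    from idl_mult_gen[OF 0 this] False show ?thesis
      by (intro bexI[of _ f]) (simp_all add: bases_0 monom_at_def)
  qed
next
  case (Suc n)
  let ?a = "x n" and ?M = "\<lambda>b. monom_at x ({..<Suc n} - brk x (Suc n) S b)"
  show ?case
  proof (cases "?a \<in> span S")
    case True
    from Suc.IH[OF Suc.prems, of S] obtain h c where h: "h \<in> idl (gens x n S)"
      "\<forall>\<phi>\<in>dual scale. f \<phi> = h \<phi> + (\<Sum>b\<in>bases x n S. c b * monom_at x ({..<n} - brk x n S b) \<phi>)"
      by blast
    have "{..<Suc n} - brk x (Suc n) S b = {..<n} - brk x n S b" if "b \<in> bases x n S" for b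
      using brk_Suc[OF bases_subset[OF that]] True by auto
    then have "(\<Sum>b\<in>bases x n S. c b * monom_at x ({..<n} - brk x n S b) \<phi>) =
        (\<Sum>b\<in>bases x (Suc n) S. c b * ?M b \<phi>)" for \<phi>
      by (intro sum.cong) (simp_all add: bases_Suc True)
    moreover have "h \<in> idl (gens x (Suc n) S)"
      using gens_Suc_in_span[of x n S] True idl_gen by (intro idl_mono[OF h(1)]) auto
    ultimately show ?thesis using h(2) by (intro bexI[of _ h] exI[of _ c]) simp_all
  next
    case False
    let ?T = "insert ?a S"
    from Suc.IH[OF Suc.prems, of ?T] obtain h c where h: "h \<in> idl (gens x n ?T)"
      "\<forall>\<phi>\<in>dual scale. f \<phi> = h \<phi> + (\<Sum>b\<in>bases x n ?T. c b * monom_at x ({..<n} - brk x n ?T b) \<phi>)"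
      by blast
    from idl_contract[OF h(1)] obtain h' p where h': "h' \<in> idl (gens x (Suc n) S)" "p \<in> rat {}"
      "h = (\<lambda>\<phi>. h' \<phi> + p \<phi> * \<phi> ?a)" by blast
    from Suc.IH[OF h'(2), of S] obtain k d where k: "k \<in> idl (gens x n S)"
      "\<forall>\<phi>\<in>dual scale. p \<phi> = k \<phi> + (\<Sum>b\<in>bases x n S. d b * monom_at x ({..<n} - brk x n S b) \<phi>)"
      by blast
    \<comment> \<open>The two families of coefficients cannot collide: membership of
      \<open>n\<close> tells which reduction a basis came from.\<close>
    let ?c = "\<lambda>b. if n \<in> b then c (b - {n}) else d b"
    have nn: "n \<notin> b" if "b \<in> bases x n S'" for b S' using bases_subset[OF that] by auto
    have old: "?M b \<phi> = monom_at x ({..<n} - brk x n S b) \<phi> * \<phi> ?a" if "b \<in> bases x n S" for b \<phi>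
    proof -
      have "{..<Suc n} - brk x (Suc n) S b = insert n ({..<n} - brk x n S b)"
        using brk_Suc[OF bases_subset[OF that]] False by (auto simp: brk_def)
      then show ?thesis by (simp add: monom_at_insert)
    qed
    have new: "?M (insert n b) = monom_at x ({..<n} - brk x n ?T b)" if "b \<in> bases x n ?T" for b
    proof -
      have "{..<Suc n} - brk x (Suc n) S (insert n b) = {..<n} - brk x n ?T b"
        using brk_Suc_insert[OF bases_subset[OF that]] by auto
      then show ?thesis by simp
    qed
    have "f \<phi> = (h' \<phi> + k \<phi> * \<phi> ?a) + (\<Sum>b\<in>bases x (Suc n) S. ?c b * ?M b \<phi>)" if "\<phi> \<in> dual scale" for \<phi>
    proof -
      have "(\<Sum>b\<in>bases x (Suc n) S. ?c b * ?M b \<phi>) =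
          (\<Sum>b\<in>bases x n S. ?c b * ?M b \<phi>) + (\<Sum>b\<in>insert n ` bases x n ?T. ?c b * ?M b \<phi>)"
        using False nn by (subst sum.union_disjoint[symmetric]) (auto simp: bases_Suc)
      also have "(\<Sum>b\<in>bases x n S. ?c b * ?M b \<phi>) =
          (\<Sum>b\<in>bases x n S. d b * monom_at x ({..<n} - brk x n S b) \<phi>) * \<phi> ?a"
        unfolding sum_distrib_right using nn by (intro sum.cong) (simp_all add: old)
      also have "(\<Sum>b\<in>insert n ` bases x n ?T. ?c b * ?M b \<phi>) =
          (\<Sum>b\<in>bases x n ?T. c b * monom_at x ({..<n} - brk x n ?T b) \<phi>)"
      proof (rule sum.reindex_cong[OF _ refl])
        show "inj_on (insert n) (bases x n ?T)"
          using nn by (intro inj_onI) (metis insert_ident)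
        show "?c (insert n b) * ?M (insert n b) \<phi> = c b * monom_at x ({..<n} - brk x n ?T b) \<phi>"
          if "b \<in> bases x n ?T" for b using nn[OF that] new[OF that] by simp
      qed
      finally show ?thesis
        using h(2) h'(3) k(2) that by (simp add: distrib_right)
    qed
    moreover have "(\<lambda>\<phi>. h' \<phi> + k \<phi> * \<phi> ?a) \<in> idl (gens x (Suc n) S)"
      by (intro idl_add h'(1) idl_delete k(1))
    ultimately show ?thesis by (intro bexI[of _ "\<lambda>\<phi>. h' \<phi> + k \<phi> * \<phi> ?a"] exI[of _ ?c]) simp_all
  qed
qed

section \<open>Polynomial functions as a graded ring\<close>

lemma poly_funs_extensional: "f \<in> poly_funs scale \<Longrightarrow> f \<in> extensional (dual scale)"
  by (induction rule: poly_funs.induct) (simp_all only: const_fun_def vec_fun_def restrict_extensional)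

lemma poly_funs_rat:
  assumes "f \<in> poly_funs scale"
  shows "f \<in> rat {}"
  using assms
proof (induction rule: poly_funs.induct)
  case (const c)
  show ?case by (rule rat_cong[OF rat_const[of c]]) (simp add: const_fun_def)
next
  case (vec v)
  show ?case by (rule rat_cong[OF rat_vec[of v]]) (simp add: vec_fun_def)
next
  case (add f g)
  show ?case by (rule rat_cong[OF rat_add[OF add.IH]]) simp
next
  case (mult f g)
  show ?case by (rule rat_cong[OF rat_mult[OF mult.IH]]) simp
qed

lemma rat_poly_funs:
  assumes "f \<in> rat {}"
  shows "restrict f (dual scale) \<in> poly_funs scale"
  using assms
proof (induction rule: rat.induct)
  case (rat_const c)
  show ?case using poly_funs.const[of scale c] unfolding const_fun_def .
next
  case (rat_vec v)
  show ?case using poly_funs.vec[of scale v] unfolding vec_fun_def .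
next
  case (rat_add f g)
  have "(\<lambda>\<phi>\<in>dual scale. restrict f (dual scale) \<phi> + restrict g (dual scale) \<phi>) =
      (\<lambda>\<phi>\<in>dual scale. f \<phi> + g \<phi>)" by (rule restrict_ext) simp
  with poly_funs.add[OF rat_add.IH] show ?case by (simp only:)
next
  case (rat_mult f g)
  have "(\<lambda>\<phi>\<in>dual scale. restrict f (dual scale) \<phi> * restrict g (dual scale) \<phi>) =
      (\<lambda>\<phi>\<in>dual scale. f \<phi> * g \<phi>)" by (rule restrict_ext) simp
  with poly_funs.mult[OF rat_mult.IH] show ?case by (simp only:)
next
  case (rat_cong f g)
  then have "restrict f (dual scale) = restrict g (dual scale)" by (intro restrict_ext) auto
  with rat_cong.IH show ?case by simp
qed simp

lemma restrict_poly_funs: "f \<in> poly_funs scale \<Longrightarrow> restrict f (dual scale) = f"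
  by (simp add: extensional_restrict poly_funs_extensional)

lemma rat_uminus: "f \<in> rat H \<Longrightarrow> (\<lambda>\<phi>. - f \<phi>) \<in> rat H"
  using rat_mult[OF rat_const[of "-1"], of f] by simp

lemma rat_diff: "f \<in> rat H \<Longrightarrow> g \<in> rat H \<Longrightarrow> (\<lambda>\<phi>. f \<phi> - g \<phi>) \<in> rat H"
  using rat_add[OF _ rat_uminus, of f H g] by simp

lemma rat_mono: "f \<in> rat H \<Longrightarrow> H \<subseteq> H' \<Longrightarrow> f \<in> rat H'"
proof (induction rule: rat.induct)
  case (rat_cong f g)
  show ?case using rat_cong.IH[OF rat_cong.prems] rat_cong.hyps(2) by (rule rat.rat_cong)
qed (simp_all add: rat_const rat_vec rat_inverse rat_add rat_mult subset_iff)

lemma carrier_SymAlg [simp]: "carrier (SymAlg scale) = poly_funs scale"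
  by (simp add: SymAlg_def)

lemma cring_SymAlg: "cring (SymAlg scale)"
  unfolding SymAlg_def
proof (rule pointwise_cring)
  show "poly_funs scale \<subseteq> extensional (dual scale)" using poly_funs_extensional by blast
  show "(\<lambda>\<phi>\<in>dual scale. 0) \<in> poly_funs scale" "(\<lambda>\<phi>\<in>dual scale. 1) \<in> poly_funs scale"
    by (intro rat_poly_funs rat_const)+
  show "(\<lambda>\<phi>\<in>dual scale. - f \<phi>) \<in> poly_funs scale" if "f \<in> poly_funs scale" for f
    using that by (intro rat_poly_funs rat_uminus poly_funs_rat)
qed (auto intro: poly_funs.intros)

text \<open>What is gained over a mere decomposition of the function is that the components are
  again polynomial.\<close>

lemma poly_graded:
  assumes "f \<in> rat {}"
  shows "\<exists>F I. graded_sum (dual scale) (rat {}) f F I"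
  using assms
proof (induction rule: rat.induct)
  case (rat_const c)
  show ?case
    by (intro exI, rule graded_sum_single[of _ 0]) (simp_all add: homogeneous_on_def rat.rat_const)
next
  case (rat_vec v)
  show ?case
    by (intro exI, rule graded_sum_single[of _ 1]) (simp_all add: homogeneous_on_def rat.rat_const rat.rat_vec)
next
  case (rat_add f g)
  then obtain F I G J where FG: "graded_sum (dual scale) (rat {}) f F I" "graded_sum (dual scale) (rat {}) g G J"
    by blast
  show ?case by (intro exI, rule graded_sum_add[OF FG rat.rat_add])
next
  case (rat_mult f g)
  then obtain F I G J where F: "graded_sum (dual scale) (rat {}) f F I" and G: "graded_sum (dual scale) (rat {}) g G J"
    by blast
  \<comment> \<open>Multiplication of a decomposition is available for a homogeneous factor only, so
    the product is expanded over the components of f.\<close>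
  have sums: "\<exists>H K. graded_sum (dual scale) (rat {}) (\<lambda>\<phi>. \<Sum>d\<in>I'. F d \<phi> * g \<phi>) H K" if "finite I'" for I'
    using that
  proof (induction I' rule: finite_induct)
    case empty
    show ?case
      by (intro exI, rule graded_sum_single[of _ 0]) (simp_all add: rat.rat_const)
  next
    case (insert d I')
    then obtain H K where H: "graded_sum (dual scale) (rat {}) (\<lambda>\<phi>. \<Sum>d\<in>I'. F d \<phi> * g \<phi>) H K" by blast
    have "F d \<in> rat {}" "homogeneous_on (dual scale) d (F d)" using F by (simp_all add: graded_sum_def)
    note sum = graded_sum_add[OF graded_sum_mult[OF G this(2) rat.rat_mult[OF this(1)]] H rat.rat_add]
    have eq: "(\<lambda>\<phi>. \<Sum>d\<in>insert d I'. F d \<phi> * g \<phi>) = (\<lambda>\<phi>. F d \<phi> * g \<phi> + (\<Sum>d\<in>I'. F d \<phi> * g \<phi>))"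
      using insert.hyps by simp
    show ?case unfolding eq by (intro exI, rule sum)
  qed
  have "finite I" using F by (simp add: graded_sum_def)
  from sums[OF this] obtain H K where "graded_sum (dual scale) (rat {}) (\<lambda>\<phi>. \<Sum>d\<in>I. F d \<phi> * g \<phi>) H K"
    by (elim exE)
  then have "graded_sum (dual scale) (rat {}) (\<lambda>\<phi>. f \<phi> * g \<phi>) H K"
    using F by (simp add: graded_sum_def sum_distrib_right)
  then show ?case by (intro exI)
next
  case (rat_cong f g)
  then show ?case by (auto simp: graded_sum_def)
qed simp

end

section \<open>The module \<open>P\<^sub>X\<close>\<close>

locale vector_config = complex_vector_space scale
  for scale :: "complex \<Rightarrow> 'v::ab_group_add \<Rightarrow> 'v" +
  fixes X :: "'v list"
  assumes nonzero: "0 \<notin> set X" and spanning: "span (set X) = UNIV"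
begin

abbreviation "U \<equiv> dual scale"
abbreviation "Ureg \<equiv> dual_reg scale X"
abbreviation "Rlow \<equiv> R_filt scale X (int (dim UNIV) - 1)"

text \<open>The generators of R_{X,s-1} with the dimension bound replaced by failure to span, the
  form in which \<open>low\<close> and the cocircuits state it.\<close>

definition frac_gens :: "(('v \<Rightarrow> complex) \<Rightarrow> complex) set" where
  "frac_gens = {(\<lambda>\<phi>\<in>Ureg. f \<phi> * (\<Prod>i<length X. \<phi> (X ! i) powi (- int (h i)))) | f h.
     f \<in> rat {} \<and> span ((!) X ` {i. i < length X \<and> 0 < h i}) \<noteq> UNIV}"

definition over_d :: "(('v \<Rightarrow> complex) \<Rightarrow> complex) \<Rightarrow> ('v \<Rightarrow> complex) \<Rightarrow> complex" where
  "over_d f = (\<lambda>\<phi>\<in>Ureg. f \<phi> * inverse (\<Prod>i<length X. \<phi> (X ! i)))"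

lemma sublist_prod_eq: "sublist_prod scale X Y = restrict (monom_at ((!) X) Y) U"
  by (auto simp: sublist_prod_def monom_at_def vec_fun_def)

lemma d_X_eq: "\<phi> \<in> U \<Longrightarrow> d_X scale X \<phi> = (\<Prod>i<length X. \<phi> (X ! i))"
  by (simp add: d_X_def sublist_prod_eq monom_at_def idx_def)

lemma Ureg_eq: "Ureg = reg {} (set X)"
  by (auto simp: dual_reg_def reg_def d_X_eq all_set_conv_all_nth)

lemma Ureg_dual: "\<phi> \<in> Ureg \<Longrightarrow> \<phi> \<in> U"
  by (simp add: dual_reg_def)

lemma Ureg_nz: "\<phi> \<in> Ureg \<Longrightarrow> i < length X \<Longrightarrow> \<phi> (X ! i) \<noteq> 0"
  by (simp add: Ureg_eq reg_def)

lemma Ureg_mult: "\<phi> \<in> Ureg \<Longrightarrow> t \<noteq> 0 \<Longrightarrow> (\<lambda>v. t * \<phi> v) \<in> Ureg"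
  by (simp add: Ureg_eq reg_def dual_mult)

lemma d_poly: "(\<lambda>\<phi>. (\<Prod>i<length X. \<phi> (X ! i)) ^ n) \<in> rat H"
  by (intro rat_power rat_prod rat_vec)

lemma carrier_R_iff: "r \<in> carrier (R_X scale X) \<longleftrightarrow>
  (\<exists>f\<in>rat {}. \<exists>n. r = (\<lambda>\<phi>\<in>Ureg. f \<phi> / (\<Prod>i<length X. \<phi> (X ! i)) ^ n))"
proof
  assume "r \<in> carrier (R_X scale X)"
  then obtain f n where f: "f \<in> poly_funs scale" "r = (\<lambda>\<phi>\<in>Ureg. f \<phi> / d_X scale X \<phi> ^ n)"
    by (auto simp: R_X_def)
  then show "\<exists>f\<in>rat {}. \<exists>n. r = (\<lambda>\<phi>\<in>Ureg. f \<phi> / (\<Prod>i<length X. \<phi> (X ! i)) ^ n)"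
    by (intro bexI[OF _ poly_funs_rat[OF f(1)]] exI[of _ n]) (auto simp: d_X_eq Ureg_dual cong: restrict_cong)
next
  assume "\<exists>f\<in>rat {}. \<exists>n. r = (\<lambda>\<phi>\<in>Ureg. f \<phi> / (\<Prod>i<length X. \<phi> (X ! i)) ^ n)"
  then obtain f n where f: "f \<in> rat {}" "r = (\<lambda>\<phi>\<in>Ureg. f \<phi> / (\<Prod>i<length X. \<phi> (X ! i)) ^ n)" by blast
  then have "r = (\<lambda>\<phi>\<in>Ureg. restrict f U \<phi> / d_X scale X \<phi> ^ n)"
    by (auto simp: d_X_eq Ureg_dual cong: restrict_cong)
  with rat_poly_funs[OF f(1)] show "r \<in> carrier (R_X scale X)"
    unfolding R_X_def pointwise_simps carrier_SymAlg by blast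
qed

text \<open>With the denominator cleared, membership becomes a polynomial identity on the regular
  set, and closure properties follow by ring arithmetic.\<close>

lemma carrier_RI:
  assumes "f \<in> rat {}" "\<And>\<phi>. \<phi> \<in> Ureg \<Longrightarrow> r \<phi> * (\<Prod>i<length X. \<phi> (X ! i)) ^ n = f \<phi>"
  shows "restrict r Ureg \<in> carrier (R_X scale X)"
proof -
  have "r \<phi> = f \<phi> / (\<Prod>i<length X. \<phi> (X ! i)) ^ n" if "\<phi> \<in> Ureg" for \<phi>
    using assms(2)[OF that] Ureg_nz[OF that] by (simp add: eq_divide_eq)
  then show ?thesis
    unfolding carrier_R_iff by (intro bexI[OF _ assms(1)] exI[of _ n]) (simp cong: restrict_cong)
qed

lemma carrier_RE:
  assumes "r \<in> carrier (R_X scale X)"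
  obtains f n where "f \<in> rat {}" "\<forall>\<phi>\<in>Ureg. r \<phi> * (\<Prod>i<length X. \<phi> (X ! i)) ^ n = f \<phi>"
proof -
  from assms obtain f n where f: "f \<in> rat {}" "r = (\<lambda>\<phi>\<in>Ureg. f \<phi> / (\<Prod>i<length X. \<phi> (X ! i)) ^ n)"
    unfolding carrier_R_iff by blast
  have "r \<phi> * (\<Prod>i<length X. \<phi> (X ! i)) ^ n = f \<phi>" if "\<phi> \<in> Ureg" for \<phi>
    using Ureg_nz[OF that] that by (simp add: f(2))
  with f(1) show thesis by (intro that ballI)
qed

lemma R_ops [simp]:
  "\<zero>\<^bsub>R_X scale X\<^esub> = (\<lambda>\<phi>\<in>Ureg. 0)" "f \<oplus>\<^bsub>R_X scale X\<^esub> g = (\<lambda>\<phi>\<in>Ureg. f \<phi> + g \<phi>)"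
  "f \<odot>\<^bsub>R_X scale X\<^esub> g = (\<lambda>\<phi>\<in>Ureg. f \<phi> * g \<phi>)"
  by (simp_all add: R_X_def)

lemma R_extensional: "r \<in> carrier (R_X scale X) \<Longrightarrow> restrict r Ureg = r"
  unfolding carrier_R_iff by auto

lemma R_add:
  assumes "r \<in> carrier (R_X scale X)" "s \<in> carrier (R_X scale X)"
  shows "(\<lambda>\<phi>\<in>Ureg. r \<phi> + s \<phi>) \<in> carrier (R_X scale X)"
proof -
  let ?d = "\<lambda>\<phi>. \<Prod>i<length X. \<phi> (X ! i)"
  obtain f m where f: "f \<in> rat {}" "\<forall>\<phi>\<in>Ureg. r \<phi> * ?d \<phi> ^ m = f \<phi>"
    by (rule carrier_RE[OF assms(1)])
  obtain g n where g: "g \<in> rat {}" "\<forall>\<phi>\<in>Ureg. s \<phi> * ?d \<phi> ^ n = g \<phi>"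
    by (rule carrier_RE[OF assms(2)])
  show ?thesis
  proof (rule carrier_RI)
    show "(\<lambda>\<phi>. f \<phi> * ?d \<phi> ^ n + g \<phi> * ?d \<phi> ^ m) \<in> rat {}"
      by (intro rat_add rat_mult f g d_poly)
    show "(r \<phi> + s \<phi>) * ?d \<phi> ^ (m + n) = f \<phi> * ?d \<phi> ^ n + g \<phi> * ?d \<phi> ^ m" if "\<phi> \<in> Ureg" for \<phi>
      using f(2)[rule_format, OF that, symmetric] g(2)[rule_format, OF that, symmetric] by (simp add: algebra_simps power_add)
  qed
qed

lemma R_mult:
  assumes "r \<in> carrier (R_X scale X)" "p \<in> rat {}"
  shows "(\<lambda>\<phi>\<in>Ureg. p \<phi> * r \<phi>) \<in> carrier (R_X scale X)"
proof -
  let ?d = "\<lambda>\<phi>. \<Prod>i<length X. \<phi> (X ! i)"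
  obtain f m where f: "f \<in> rat {}" "\<forall>\<phi>\<in>Ureg. r \<phi> * ?d \<phi> ^ m = f \<phi>"
    by (rule carrier_RE[OF assms(1)])
  show ?thesis
    by (rule carrier_RI[OF rat_mult[OF assms(2) f(1)], where n = m]) (use f(2) in \<open>simp add: mult.assoc\<close>)
qed

lemma R_abelian_group: "abelian_group (R_X scale X)"
proof -
  have "abelian_group (pointwise Ureg (carrier (R_X scale X)))"
  proof (rule pointwise_abelian_group)
    show "carrier (R_X scale X) \<subseteq> extensional Ureg"
      using R_extensional by (metis restrict_extensional subsetI)
    show "(\<lambda>\<phi>\<in>Ureg. 0) \<in> carrier (R_X scale X)"
      by (rule carrier_RI[OF rat_const, of _ 0 0]) simp
    show "(\<lambda>\<phi>\<in>Ureg. - r \<phi>) \<in> carrier (R_X scale X)" if "r \<in> carrier (R_X scale X)" for r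
      using R_mult[OF that rat_const[of "-1"]] by simp
  qed (rule R_add)
  then show ?thesis by (simp add: R_X_def)
qed

lemma finite_dimensional: "\<exists>B. finite_dimensional_vector_space scale B"
proof -
  obtain B where B: "B \<subseteq> set X" "independent B" "set X \<subseteq> span B"
    by (rule maximal_independent_subset)
  have "span B = UNIV"
    using span_mono[OF B(3)] spanning by (auto simp: span_span)
  then have "finite_dimensional_vector_space scale B"
    using B finite_subset[OF B(1)] by unfold_locales auto
  then show ?thesis by blast
qed

text \<open>V has finite dimension because the finite list X spans it. The integer subtraction
  matters for V = 0, where both sides are false.\<close>

lemma dim_span_less_iff: "int (dim (span S)) \<le> int (dim UNIV) - 1 \<longleftrightarrow> span S \<noteq> UNIV"
proof -
  obtain B where "finite_dimensional_vector_space scale B" using finite_dimensional by blast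
  then interpret fd: finite_dimensional_vector_space scale B .
  show ?thesis
    using fd.dim_eq_full[of S] fd.dim_subset_UNIV[of S] by (auto simp: fd.dim_UNIV fd.dimension_def)
qed

lemma frac_gensI:
  assumes "f \<in> rat {}" "span ((!) X ` {i. i < length X \<and> 0 < h i}) \<noteq> UNIV"
    and "\<And>\<phi>. \<phi> \<in> Ureg \<Longrightarrow> g \<phi> = f \<phi> * (\<Prod>i<length X. \<phi> (X ! i) powi (- int (h i)))"
  shows "restrict g Ureg \<in> frac_gens"
  unfolding frac_gens_def mem_Collect_eq
  by (rule exI[of _ f], rule exI[of _ h], intro conjI assms(1,2) restrict_ext assms(3))

lemma frac_gens_eq:
  "frac_gens = {(\<lambda>\<phi>\<in>Ureg. f \<phi> * (\<Prod>i\<in>idx X. vec_fun scale (X ! i) \<phi> powi (- int (h i)))) | f h.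
     f \<in> carrier (SymAlg scale) \<and>
     int (dim (span ((!) X ` {i \<in> idx X. 0 < h i}))) \<le> int (dim UNIV) - 1}"
  (is "_ = ?G")
proof (intro equalityI subsetI)
  fix g assume "g \<in> frac_gens"
  then obtain f h where f: "f \<in> rat {}" "span ((!) X ` {i. i < length X \<and> 0 < h i}) \<noteq> UNIV"
    "g = (\<lambda>\<phi>\<in>Ureg. f \<phi> * (\<Prod>i<length X. \<phi> (X ! i) powi (- int (h i))))"
    unfolding frac_gens_def by blast
  have "g = (\<lambda>\<phi>\<in>Ureg. restrict f U \<phi> * (\<Prod>i\<in>idx X. vec_fun scale (X ! i) \<phi> powi (- int (h i))))"
    unfolding f(3) by (rule restrict_ext) (simp add: Ureg_dual vec_fun_def idx_def)
  moreover have "int (dim (span ((!) X ` {i \<in> idx X. 0 < h i}))) \<le> int (dim UNIV) - 1"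
    using f(2) unfolding dim_span_less_iff by (simp add: idx_def)
  ultimately show "g \<in> ?G" using rat_poly_funs[OF f(1)] unfolding carrier_SymAlg by blast
next
  fix g assume "g \<in> ?G"
  then obtain f h where f: "f \<in> poly_funs scale" "span ((!) X ` {i \<in> idx X. 0 < h i}) \<noteq> UNIV"
    "g = (\<lambda>\<phi>\<in>Ureg. f \<phi> * (\<Prod>i\<in>idx X. vec_fun scale (X ! i) \<phi> powi (- int (h i))))"
    unfolding carrier_SymAlg dim_span_less_iff by blast
  have "g = (\<lambda>\<phi>\<in>Ureg. f \<phi> * (\<Prod>i<length X. \<phi> (X ! i) powi (- int (h i))))"
    unfolding f(3) by (rule restrict_ext) (simp add: Ureg_dual vec_fun_def idx_def)
  then show "g \<in> frac_gens"
    using f(2) poly_funs_rat[OF f(1)] unfolding frac_gens_def idx_def by auto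
qed

lemma frac_gens_carrier: "g \<in> frac_gens \<Longrightarrow> g \<in> carrier (R_X scale X)"
proof -
  assume "g \<in> frac_gens"
  then obtain f h where f: "f \<in> rat {}"
    "g = (\<lambda>\<phi>\<in>Ureg. f \<phi> * (\<Prod>i<length X. \<phi> (X ! i) powi (- int (h i))))"
    unfolding frac_gens_def by blast
  \<comment> \<open>The sum of the exponents bounds each of them, so this power of d_X clears all
    denominators.\<close>
  define n where "n = (\<Sum>i<length X. h i)"
  have hn: "h i \<le> n" if "i < length X" for i
    unfolding n_def using that by (intro member_le_sum) auto
  show ?thesis unfolding f(2)
  proof (rule carrier_RI)
    show "(\<lambda>\<phi>. f \<phi> * (\<Prod>i<length X. \<phi> (X ! i) ^ (n - h i))) \<in> rat {}"
      by (intro rat_mult rat_prod rat_power rat_vec f(1))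
    fix \<phi> assume \<phi>: "\<phi> \<in> Ureg"
    have "(\<Prod>i<length X. \<phi> (X ! i) powi (- int (h i))) * (\<Prod>i<length X. \<phi> (X ! i)) ^ n =
        (\<Prod>i<length X. \<phi> (X ! i) powi (- int (h i)) * \<phi> (X ! i) ^ n)"
      by (simp add: prod.distrib prod_power_distrib)
    also have "\<dots> = (\<Prod>i<length X. \<phi> (X ! i) ^ (n - h i))"
      using Ureg_nz[OF \<phi>] hn
      by (intro prod.cong) (auto simp: power_int_minus power_diff field_simps)
    finally show "f \<phi> * (\<Prod>i<length X. \<phi> (X ! i) powi (- int (h i))) * (\<Prod>i<length X. \<phi> (X ! i)) ^ n =
        f \<phi> * (\<Prod>i<length X. \<phi> (X ! i) ^ (n - h i))"
      by (simp add: mult.assoc)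
  qed
qed

lemma Rlow_iff: "r \<in> Rlow \<longleftrightarrow>
  (\<exists>F c. finite F \<and> F \<subseteq> frac_gens \<and> r = (\<lambda>\<phi>\<in>Ureg. \<Sum>g\<in>F. c g * g \<phi>))"
proof -
  have span: "Rlow = lin_span scale (R_X scale X) frac_gens"
    unfolding R_filt_def frac_gens_eq ..
  have comb: "lin_comb scale (R_X scale X) F c (\<lambda>x. x) = (\<lambda>\<phi>\<in>Ureg. \<Sum>g\<in>F. c g * g \<phi>)"
    if F: "finite F" "F \<subseteq> frac_gens" for F c
  proof -
    have m: "const_fun scale (c g) \<odot>\<^bsub>R_X scale X\<^esub> g = (\<lambda>\<phi>\<in>Ureg. c g * g \<phi>)" for g
      unfolding R_ops by (rule restrict_ext) (simp add: const_fun_def Ureg_dual)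
    have "lin_comb scale (R_X scale X) F c (\<lambda>x. x) =
        finsum (pointwise Ureg (carrier (R_X scale X))) (\<lambda>g. \<lambda>\<phi>\<in>Ureg. c g * g \<phi>) F"
      unfolding lin_comb_def m by (simp add: R_X_def)
    also have "\<dots> = (\<lambda>\<phi>\<in>Ureg. \<Sum>g\<in>F. (\<lambda>\<phi>\<in>Ureg. c g * g \<phi>) \<phi>)"
    proof (rule finsum_pointwise[OF _ F(1)])
      show "abelian_group (pointwise Ureg (carrier (R_X scale X)))"
        using R_abelian_group by (simp add: R_X_def)
      show "(\<lambda>\<phi>\<in>Ureg. c g * g \<phi>) \<in> carrier (R_X scale X)" if "g \<in> F" for g
        using R_mult[OF frac_gens_carrier rat_const] F(2) that by blast
    qed
    also have "\<dots> = (\<lambda>\<phi>\<in>Ureg. \<Sum>g\<in>F. c g * g \<phi>)"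
      by (rule restrict_ext) simp
    finally show ?thesis .
  qed
  show ?thesis
  proof
    assume "r \<in> Rlow"
    then obtain F c where F: "finite F" "F \<subseteq> frac_gens" "r = lin_comb scale (R_X scale X) F c (\<lambda>x. x)"
      unfolding span lin_span_def by blast
    show "\<exists>F c. finite F \<and> F \<subseteq> frac_gens \<and> r = (\<lambda>\<phi>\<in>Ureg. \<Sum>g\<in>F. c g * g \<phi>)"
      by (rule exI[of _ F], rule exI[of _ c]) (simp only: F comb[OF F(1,2)] simp_thms)
  next
    assume "\<exists>F c. finite F \<and> F \<subseteq> frac_gens \<and> r = (\<lambda>\<phi>\<in>Ureg. \<Sum>g\<in>F. c g * g \<phi>)"
    then obtain F c where F: "finite F" "F \<subseteq> frac_gens" "r = (\<lambda>\<phi>\<in>Ureg. \<Sum>g\<in>F. c g * g \<phi>)"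
      by (elim exE conjE)
    from F(3) have "r = lin_comb scale (R_X scale X) F c (\<lambda>x. x)"
      unfolding comb[OF F(1,2)] .
    with F(1,2) show "r \<in> Rlow" unfolding span lin_span_def by blast
  qed
qed

lemma frac_gens_mult:
  assumes "g \<in> frac_gens" "p \<in> rat {}"
  shows "(\<lambda>\<phi>\<in>Ureg. p \<phi> * g \<phi>) \<in> frac_gens"
proof -
  from assms(1) obtain f h where f: "f \<in> rat {}" "span ((!) X ` {i. i < length X \<and> 0 < h i}) \<noteq> UNIV"
    "g = (\<lambda>\<phi>\<in>Ureg. f \<phi> * (\<Prod>i<length X. \<phi> (X ! i) powi (- int (h i))))"
    unfolding frac_gens_def by blast
  show ?thesis
    by (rule frac_gensI[OF rat_mult[OF assms(2) f(1)] f(2)]) (simp add: f(3) mult.assoc)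
qed

lemma Rlow_gen: "g \<in> frac_gens \<Longrightarrow> g \<in> Rlow"
  unfolding Rlow_iff using R_extensional[OF frac_gens_carrier, of g]
  by (intro exI[of _ "{g}"] exI[of _ "\<lambda>_. 1"]) simp

lemma Rlow_0: "(\<lambda>\<phi>\<in>Ureg. 0) \<in> Rlow"
  unfolding Rlow_iff by (intro exI[of _ "{}"]) simp

lemma Rlow_add:
  assumes "r \<in> Rlow" "s \<in> Rlow"
  shows "(\<lambda>\<phi>\<in>Ureg. r \<phi> + s \<phi>) \<in> Rlow"
proof -
  obtain F c where F: "finite F" "F \<subseteq> frac_gens" "r = (\<lambda>\<phi>\<in>Ureg. \<Sum>g\<in>F. c g * g \<phi>)"
    using assms(1) unfolding Rlow_iff by blast
  obtain G d where G: "finite G" "G \<subseteq> frac_gens" "s = (\<lambda>\<phi>\<in>Ureg. \<Sum>g\<in>G. d g * g \<phi>)"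
    using assms(2) unfolding Rlow_iff by blast
  let ?c = "\<lambda>g. (if g \<in> F then c g else 0) + (if g \<in> G then d g else 0)"
  have "(\<Sum>g\<in>F \<union> G. ?c g * g \<phi>) = (\<Sum>g\<in>F. c g * g \<phi>) + (\<Sum>g\<in>G. d g * g \<phi>)" for \<phi>
  proof -
    have "(\<Sum>g\<in>F \<union> G. (if g \<in> F then c g else 0) * g \<phi>) = (\<Sum>g\<in>F. c g * g \<phi>)"
      using F(1) G(1) by (intro sum.mono_neutral_cong_right) auto
    moreover have "(\<Sum>g\<in>F \<union> G. (if g \<in> G then d g else 0) * g \<phi>) = (\<Sum>g\<in>G. d g * g \<phi>)"
      using F(1) G(1) by (intro sum.mono_neutral_cong_right) auto
    ultimately show ?thesis by (simp add: distrib_right sum.distrib)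
  qed
  then have "(\<lambda>\<phi>\<in>Ureg. r \<phi> + s \<phi>) = (\<lambda>\<phi>\<in>Ureg. \<Sum>g\<in>F \<union> G. ?c g * g \<phi>)"
    by (intro restrict_ext) (simp add: F(3) G(3))
  then show ?thesis
    unfolding Rlow_iff using F(1,2) G(1,2) by (intro exI[of _ "F \<union> G"] exI[of _ ?c]) simp
qed

text \<open>Scalars are absorbed into the generators, which are closed under multiplication by
  polynomials, so the inductive step only adds one generator.\<close>

lemma Rlow_induct [consumes 1, case_names zero step]:
  assumes "r \<in> Rlow" "P (\<lambda>\<phi>\<in>Ureg. 0)"
    and "\<And>g r. g \<in> frac_gens \<Longrightarrow> r \<in> Rlow \<Longrightarrow> P r \<Longrightarrow> P (\<lambda>\<phi>\<in>Ureg. g \<phi> + r \<phi>)"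
  shows "P r"
proof -
  obtain F c where F: "finite F" "F \<subseteq> frac_gens" "r = (\<lambda>\<phi>\<in>Ureg. \<Sum>g\<in>F. c g * g \<phi>)"
    using assms(1) unfolding Rlow_iff by blast
  from F(1,2) have "P (\<lambda>\<phi>\<in>Ureg. \<Sum>g\<in>F. c g * g \<phi>)"
  proof (induction F rule: finite_induct)
    case (insert g F)
    let ?g = "\<lambda>\<phi>\<in>Ureg. c g * g \<phi>" and ?r = "\<lambda>\<phi>\<in>Ureg. \<Sum>g\<in>F. c g * g \<phi>"
    have "P (\<lambda>\<phi>\<in>Ureg. ?g \<phi> + ?r \<phi>)"
    proof (rule assms(3))
      show "?g \<in> frac_gens" using frac_gens_mult[OF _ rat_const] insert.prems by blast
      show "?r \<in> Rlow" unfolding Rlow_iff using insert.hyps(1) insert.prems by (intro exI[of _ F] exI[of _ c]) simp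
      show "P ?r" using insert.prems by (intro insert.IH) simp
    qed
    moreover have "(\<lambda>\<phi>\<in>Ureg. ?g \<phi> + ?r \<phi>) = (\<lambda>\<phi>\<in>Ureg. \<Sum>g\<in>insert g F. c g * g \<phi>)"
      using insert.hyps by (intro restrict_ext) simp
    ultimately show ?case by (simp only:)
  qed (use assms(2) in \<open>simp only: sum.empty\<close>)
  then show ?thesis by (simp only: F(3))
qed

lemma Rlow_carrier: "r \<in> Rlow \<Longrightarrow> r \<in> carrier (R_X scale X)"
proof (induction rule: Rlow_induct)
  case zero
  show ?case by (rule carrier_RI[OF rat_const, of _ 0 0]) simp
next
  case (step g r)
  then show ?case by (intro R_add frac_gens_carrier[OF step.hyps(1)])
qed

lemma Rlow_mult:
  assumes "r \<in> Rlow" "p \<in> rat {}"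
  shows "(\<lambda>\<phi>\<in>Ureg. p \<phi> * r \<phi>) \<in> Rlow"
  using assms(1)
proof (induction rule: Rlow_induct)
  case zero
  have "(\<lambda>\<phi>\<in>Ureg. p \<phi> * (\<lambda>\<phi>\<in>Ureg. 0) \<phi>) = (\<lambda>\<phi>\<in>Ureg. 0)" by (rule restrict_ext) simp
  with Rlow_0 show ?case by (simp only:)
next
  case (step g r)
  have "(\<lambda>\<phi>\<in>Ureg. p \<phi> * (\<lambda>\<phi>\<in>Ureg. g \<phi> + r \<phi>) \<phi>) =
      (\<lambda>\<phi>\<in>Ureg. (\<lambda>\<phi>\<in>Ureg. p \<phi> * g \<phi>) \<phi> + (\<lambda>\<phi>\<in>Ureg. p \<phi> * r \<phi>) \<phi>)"
    by (rule restrict_ext) (simp add: distrib_left)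
  then show ?case
    using Rlow_add[OF Rlow_gen[OF frac_gens_mult[OF step.hyps(1) assms(2)]] step.IH] by (simp only:)
qed

text \<open>Here the exponents are forgotten and only the set of denominators is kept, which is how
  a relation in P_X enters the induction over contractions, starting from \<open>S = {}\<close> and
  \<open>Z = set X\<close>.\<close>

lemma Rlow_low:
  assumes "r \<in> Rlow"
  shows "r \<in> low {} (set X)"
  using assms
proof (induction rule: Rlow_induct)
  case zero
  show ?case by (rule low_cong[OF low_0]) (simp add: Ureg_eq)
next
  case (step g r)
  then obtain f h where f: "f \<in> rat {}" "span ((!) X ` {i. i < length X \<and> 0 < h i}) \<noteq> UNIV"
    "g = (\<lambda>\<phi>\<in>Ureg. f \<phi> * (\<Prod>i<length X. \<phi> (X ! i) powi (- int (h i))))"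
    unfolding frac_gens_def by blast
  let ?H = "(!) X ` {i. i < length X \<and> 0 < h i}"
  have "(\<lambda>\<phi>. f \<phi> * (\<Prod>i<length X. \<phi> (X ! i) powi (- int (h i)))) \<in> rat ?H"
  proof (intro rat_mult rat_prod rat_mono[OF f(1)])
    fix i assume i: "i \<in> {..<length X}"
    show "(\<lambda>\<phi>. \<phi> (X ! i) powi (- int (h i))) \<in> rat ?H"
    proof (cases "h i = 0")
      case False
      then have "(\<lambda>\<phi>. inverse (\<phi> (X ! i)) ^ h i) \<in> rat ?H"
        using i by (intro rat_power rat_inverse) auto
      then show ?thesis by (simp add: power_int_minus power_inverse)
    qed (simp add: rat_const)
  qed simp
  then have "(\<lambda>\<phi>. (f \<phi> * (\<Prod>i<length X. \<phi> (X ! i) powi (- int (h i)))) + r \<phi>) \<in> low {} (set X)"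
    using f(2) step.IH by (intro low_step[of _ ?H]) auto
  then show ?case
    by (rule low_cong) (simp add: f(3) Ureg_eq)
qed

section \<open>Cocircuits, bases and fractions with denominator d_X\<close>

abbreviation "cocircuit_gens \<equiv> gens ((!) X) (length X) {}"
abbreviation "X_bases \<equiv> bases ((!) X) (length X) {}"
abbreviation "X_brk \<equiv> brk ((!) X) (length X) {}"

lemma over_d_carrier:
  assumes "f \<in> rat {}"
  shows "over_d f \<in> carrier (R_X scale X)"
  unfolding over_d_def
proof (rule carrier_RI[OF assms, where n = 1])
  fix \<phi> assume "\<phi> \<in> Ureg"
  then have "(\<Prod>i<length X. \<phi> (X ! i)) \<noteq> 0" by (simp add: Ureg_nz)
  then show "f \<phi> * inverse (\<Prod>i<length X. \<phi> (X ! i)) * (\<Prod>i<length X. \<phi> (X ! i)) ^ 1 = f \<phi>" by simp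
qed

lemma over_d_add: "over_d (\<lambda>\<phi>. f \<phi> + g \<phi>) = (\<lambda>\<phi>\<in>Ureg. over_d f \<phi> + over_d g \<phi>)"
  unfolding over_d_def by (rule restrict_ext) (simp add: distrib_right)

lemma over_d_cong: "(\<And>\<phi>. \<phi> \<in> U \<Longrightarrow> f \<phi> = g \<phi>) \<Longrightarrow> over_d f = over_d g"
  unfolding over_d_def by (rule restrict_ext) (simp add: Ureg_dual)

text \<open>After cancellation M_Y / d_X has the vectors of X - Y as denominators, each with
  exponent 1, and these do not span because Y is a cocircuit. This is the easy inclusion of I_X in
  the annihilator.\<close>

lemma over_d_idl:
  assumes "h \<in> idl cocircuit_gens"
  shows "over_d h \<in> Rlow"
  using assms
proof (induction rule: idl.induct)
  case idl_0
  have "over_d (\<lambda>\<phi>. 0) = (\<lambda>\<phi>\<in>Ureg. 0)" unfolding over_d_def by (rule restrict_ext) simp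
  with Rlow_0 show ?case by (simp only:)
next
  case (idl_step p s h)
  from idl_step.hyps(2) obtain Y where Y: "s = monom_at ((!) X) Y" "Y \<subseteq> {..<length X}"
    "span ((!) X ` ({..<length X} - Y)) \<noteq> UNIV"
    by (auto simp: gens_def)
  have "over_d (\<lambda>\<phi>. p \<phi> * s \<phi>) \<in> frac_gens"
    unfolding over_d_def
  proof (rule frac_gensI[OF idl_step.hyps(1), where h = "\<lambda>i. of_bool (i \<notin> Y)"])
    have "{i. i < length X \<and> 0 < (of_bool (i \<notin> Y) :: nat)} = {..<length X} - Y" by auto
    with Y(3) show "span ((!) X ` {i. i < length X \<and> 0 < (of_bool (i \<notin> Y) :: nat)}) \<noteq> UNIV"
      by (simp only: not_False_eq_True)
    fix \<phi> assume \<phi>: "\<phi> \<in> Ureg"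
    have "(\<Prod>i<length X. \<phi> (X ! i) powi - int (of_bool (i \<notin> Y))) =
        (\<Prod>i<length X. (if i \<in> Y then \<phi> (X ! i) else 1) * inverse (\<phi> (X ! i)))"
      using Ureg_nz[OF \<phi>] by (intro prod.cong) (auto simp: power_int_minus)
    also have "\<dots> = (\<Prod>i<length X. if i \<in> Y then \<phi> (X ! i) else 1) * inverse (\<Prod>i<length X. \<phi> (X ! i))"
      by (simp only: prod.distrib prod_inversef[symmetric] comp_def)
    also have "(\<Prod>i<length X. if i \<in> Y then \<phi> (X ! i) else 1) = (\<Prod>i\<in>Y. \<phi> (X ! i))"
      using Y(2) by (intro prod.mono_neutral_cong_right) auto
    finally show "p \<phi> * s \<phi> * inverse (\<Prod>i<length X. \<phi> (X ! i)) =
        p \<phi> * (\<Prod>i<length X. \<phi> (X ! i) powi - int (of_bool (i \<notin> Y)))"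
      by (simp add: Y(1) monom_at_def mult.assoc)
  qed
  from Rlow_add[OF Rlow_gen[OF this] idl_step.IH] show ?case
    unfolding over_d_add .
qed

text \<open>Induction by removal of the smallest index: its tail is all the rest, and the other
  tails do not notice it. A repeated vector violates the tail condition too, so injectivity need not
  be stated separately on the right.\<close>

lemma independent_iff_no_tail:
  assumes "finite b"
  shows "inj_on x b \<and> independent (x ` b) \<longleftrightarrow> (\<forall>j\<in>b. x j \<notin> span (x ` {k \<in> b. (j::nat) < k}))"
  using assms
proof (induction "card b" arbitrary: b)
  case 0
  then show ?case by (simp add: independent_empty)
next
  case (Suc n)
  then have ne: "b \<noteq> {}" by auto
  define m where "m = Min b"
  have m: "m \<in> b" "\<And>k. k \<in> b \<Longrightarrow> m \<le> k" using Suc.prems ne by (auto simp: m_def)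
  let ?c = "b - {m}"
  have b: "b = insert m ?c" "m \<notin> ?c" using m by auto
  have "n = card ?c" using Suc.hyps(2) m(1) Suc.prems by simp
  from Suc.hyps(1)[OF this] Suc.prems
  have IH: "inj_on x ?c \<and> independent (x ` ?c) \<longleftrightarrow> (\<forall>j\<in>?c. x j \<notin> span (x ` {k \<in> ?c. j < k}))" by simp
  have tail: "{k \<in> b. m < k} = ?c" using m(2) by (auto simp: order.strict_iff_order)
  have tails: "{k \<in> ?c. j < k} = {k \<in> b. j < k}" if "j \<in> ?c" for j
    using m(2)[of j] that by auto
  have "inj_on x b \<and> independent (x ` b) \<longleftrightarrow> inj_on x ?c \<and> independent (x ` ?c) \<and> x m \<notin> span (x ` ?c)"
  proof -
    have "inj_on x b \<longleftrightarrow> inj_on x ?c \<and> x m \<notin> x ` ?c"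
      using b inj_on_insert[of x m ?c] by (metis Diff_idemp)
    moreover have "independent (x ` b) \<longleftrightarrow> independent (x ` ?c) \<and> x m \<notin> span (x ` ?c)" if "x m \<notin> x ` ?c"
    proof -
      have "x ` b = insert (x m) (x ` ?c)" using b(1) by (metis image_insert)
      then show ?thesis using that by (simp add: independent_insert)
    qed
    moreover have "x m \<in> span (x ` ?c)" if "x m \<in> x ` ?c" using that by (rule span_base)
    ultimately show ?thesis by blast
  qed
  also have "\<dots> \<longleftrightarrow> (\<forall>j\<in>?c. x j \<notin> span (x ` {k \<in> b. j < k})) \<and> x m \<notin> span (x ` {k \<in> b. m < k})"
    using IH tails tail by auto
  also have "\<dots> \<longleftrightarrow> (\<forall>j\<in>b. x j \<notin> span (x ` {k \<in> b. j < k}))"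
    using m(1) by auto
  finally show ?case .
qed

lemma extracted_bases_eq: "extracted_bases scale X = X_bases"
proof -
  have "(inj_on ((!) X) b \<and> independent ((!) X ` b)) =
      (\<forall>j\<in>b. X ! j \<notin> span ((!) X ` {k \<in> b. j < k}))" if "b \<subseteq> {..<length X}" for b
    using independent_iff_no_tail[of b "(!) X"] finite_subset[OF that] by simp
  then show ?thesis
    by (auto simp: extracted_bases_def bases_def idx_def)
qed

text \<open>The tail at \<open>i\<close> equals the tail at its smallest member, which is the j
  sought. It has members because an empty tail would force \<open>X ! i = 0\<close>.\<close>

lemma breaking_eq:
  assumes "b \<in> X_bases"
  shows "breaking scale X b = X_brk b"
proof -
  have fin: "finite b" using bases_subset[OF assms] finite_subset by blast
  have "(\<exists>j\<in>b. i \<le> j \<and> X ! i \<in> span ((!) X ` {k \<in> b. j \<le> k})) \<longleftrightarrow>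
      X ! i \<in> span ((!) X ` {k \<in> b. i \<le> k})" (is "?L \<longleftrightarrow> ?R") if i: "i < length X" for i
  proof
    assume ?L
    then obtain j where j: "i \<le> j" "X ! i \<in> span ((!) X ` {k \<in> b. j \<le> k})" by blast
    have "(!) X ` {k \<in> b. j \<le> k} \<subseteq> (!) X ` {k \<in> b. i \<le> k}" using j(1) by auto
    from span_mono[OF this] j(2) show ?R by blast
  next
    assume R: ?R
    let ?t = "{k \<in> b. i \<le> k}"
    have "?t \<noteq> {}"
    proof
      assume "?t = {}"
      with R have "X ! i = 0" by (simp only: image_empty span_empty singleton_iff)
      then show False using nonzero i nth_mem by metis
    qed
    then have min: "Min ?t \<in> ?t" using fin by (intro Min_in) auto
    moreover have "{k \<in> b. Min ?t \<le> k} = ?t"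
      using fin min by (auto intro: Min_le order.trans)
    ultimately show ?L using R by (intro bexI[of _ "Min ?t"]) auto
  qed
  then show ?thesis by (auto simp: breaking_def brk_def idx_def)
qed

lemma nth_nonzero: "i < length X \<Longrightarrow> X ! i \<noteq> 0"
  using nonzero nth_mem by metis

text \<open>Division by d_X turns M_b into the inverse of the product over B(b). With
  \<open>S = {}\<close> no index is omitted from that product, as the vectors of X are
  nonzero.\<close>

lemma over_d_independent:
  assumes "over_d (\<lambda>\<phi>. \<Sum>b\<in>X_bases. c b * monom_at ((!) X) ({..<length X} - X_brk b) \<phi>) \<in> Rlow"
    and "b \<in> X_bases"
  shows "c b = 0"
proof (rule bases_independent[of "set X" "{}" "length X" "(!) X" c b])
  show "set X \<inter> span {} = {}" using nonzero by simp
  show "(\<lambda>\<phi>. \<Sum>b\<in>X_bases. c b * inverse (\<Prod>i\<in>{i \<in> X_brk b. X ! i \<notin> span {}}. \<phi> (X ! i))) \<in> low {} (set X)"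
  proof (rule low_cong[OF Rlow_low[OF assms(1)]])
    fix \<phi> assume "\<phi> \<in> reg {} (set X)"
    then have \<phi>: "\<phi> \<in> Ureg" by (simp add: Ureg_eq)
    have terms: "c b * monom_at ((!) X) ({..<length X} - X_brk b) \<phi> * inverse (\<Prod>i<length X. \<phi> (X ! i)) =
        c b * inverse (\<Prod>i\<in>{i \<in> X_brk b. X ! i \<notin> span {}}. \<phi> (X ! i))" for b
    proof -
      have sub: "X_brk b \<subseteq> {..<length X}" by (auto simp: brk_def)
      have "{i \<in> X_brk b. X ! i \<notin> span {}} = X_brk b"
        using sub nth_nonzero by auto
      moreover have "(\<Prod>i<length X. \<phi> (X ! i)) =
          (\<Prod>i\<in>{..<length X} - X_brk b. \<phi> (X ! i)) * (\<Prod>i\<in>X_brk b. \<phi> (X ! i))"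
        using sub by (intro prod.subset_diff) auto
      moreover have "(\<Prod>i\<in>{..<length X} - X_brk b. \<phi> (X ! i)) \<noteq> 0"
        using Ureg_nz[OF \<phi>] by simp
      ultimately show ?thesis by (simp add: monom_at_def)
    qed
    show "over_d (\<lambda>\<phi>. \<Sum>b\<in>X_bases. c b * monom_at ((!) X) ({..<length X} - X_brk b) \<phi>) \<phi> =
        (\<Sum>b\<in>X_bases. c b * inverse (\<Prod>i\<in>{i \<in> X_brk b. X ! i \<notin> span {}}. \<phi> (X ! i)))"
      unfolding over_d_def restrict_apply'[OF \<phi>] sum_distrib_right terms ..
  qed
qed (use assms(2) in auto)

text \<open>The restrictions form an ideal of \<open>SymAlg\<close> that contains the M_Y;
  conversely each of them is built from the M_Y by operations of the ideal I_X.\<close>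

lemma I_X_eq: "I_X scale X = (\<lambda>h. restrict h U) ` idl cocircuit_gens"
proof -
  let ?G = "{sublist_prod scale X Y | Y. cocircuit scale X Y}"
  let ?J = "(\<lambda>h. restrict h U) ` idl cocircuit_gens"
  interpret A: cring "SymAlg scale" by (rule cring_SymAlg)
  have add: "f \<oplus>\<^bsub>SymAlg scale\<^esub> g = (\<lambda>\<phi>\<in>U. f \<phi> + g \<phi>)" and mult: "f \<otimes>\<^bsub>SymAlg scale\<^esub> g = (\<lambda>\<phi>\<in>U. f \<phi> * g \<phi>)"
    and zero: "\<zero>\<^bsub>SymAlg scale\<^esub> = (\<lambda>\<phi>\<in>U. 0)" for f g
    by (simp_all add: SymAlg_def)
  \<comment> \<open>With \<open>S = {}\<close> there are no linear forms among the generators, only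
    the monomials of cocircuits.\<close>
  have gens: "cocircuit_gens = monom_at ((!) X) ` {Y. cocircuit scale X Y}"
    by (auto simp: gens_def cocircuit_def idx_def)
  have G: "?G = (\<lambda>h. restrict h U) ` cocircuit_gens"
    unfolding gens sublist_prod_eq by auto
  have rat: "h \<in> rat {}" if "h \<in> idl cocircuit_gens" for h
    using that by (induction rule: idl.induct)
      (auto simp: gens intro!: rat_const rat_add rat_mult monom_at_rat)
  have "ideal ?J (SymAlg scale)"
  proof (rule idealI[OF A.ring_axioms])
    show "subgroup ?J (add_monoid (SymAlg scale))"
    proof (rule group.subgroupI[OF A.a_group])
      show "?J \<subseteq> carrier (add_monoid (SymAlg scale))" using rat rat_poly_funs by auto
      show "?J \<noteq> {}" using idl_0 by blast
      fix f assume "f \<in> ?J"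
      then obtain h where h: "h \<in> idl cocircuit_gens" "f = restrict h U" by blast
      let ?k = "\<lambda>\<phi>. (-1) * h \<phi>"
      have k: "?k \<in> idl cocircuit_gens" using idl_mult[OF h(1) rat_const] .
      have "(\<lambda>\<phi>\<in>U. restrict ?k U \<phi> + f \<phi>) = (\<lambda>\<phi>\<in>U. 0)" by (rule restrict_ext) (simp add: h(2))
      then have "\<ominus>\<^bsub>SymAlg scale\<^esub> f = restrict ?k U"
        using h rat[OF h(1)] rat[OF k] by (intro A.minus_equality) (simp_all add: add zero rat_poly_funs)
      then show "inv\<^bsub>add_monoid (SymAlg scale)\<^esub> f \<in> ?J"
        using k by (simp add: a_inv_def)
      fix g assume "g \<in> ?J"
      then obtain h' where h': "h' \<in> idl cocircuit_gens" "g = restrict h' U" by blast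
      have "(\<lambda>\<phi>\<in>U. f \<phi> + g \<phi>) = (\<lambda>\<phi>\<in>U. h \<phi> + h' \<phi>)" by (rule restrict_ext) (simp add: h(2) h'(2))
      then show "f \<otimes>\<^bsub>add_monoid (SymAlg scale)\<^esub> g \<in> ?J"
        using idl_add[OF h(1) h'(1)] by (simp only: add monoid.simps) blast
    qed
  next
    fix f p assume "f \<in> ?J" and p: "p \<in> carrier (SymAlg scale)"
    then obtain h where h: "h \<in> idl cocircuit_gens" "f = restrict h U" by blast
    have "(\<lambda>\<phi>\<in>U. p \<phi> * f \<phi>) = (\<lambda>\<phi>\<in>U. p \<phi> * h \<phi>)" "(\<lambda>\<phi>\<in>U. f \<phi> * p \<phi>) = (\<lambda>\<phi>\<in>U. p \<phi> * h \<phi>)"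
      by (rule restrict_ext, simp add: h(2))+
    then show "p \<otimes>\<^bsub>SymAlg scale\<^esub> f \<in> ?J" "f \<otimes>\<^bsub>SymAlg scale\<^esub> p \<in> ?J"
      using idl_mult[OF h(1) poly_funs_rat, of p] p unfolding mult by auto
  qed
  moreover have "?G \<subseteq> ?J" unfolding G using idl_gen by blast
  ultimately have "I_X scale X \<subseteq> ?J"
    unfolding I_X_def by (rule A.genideal_minimal)
  moreover have "restrict h U \<in> I_X scale X" if "h \<in> idl cocircuit_gens" for h
  proof -
    have sub: "?G \<subseteq> carrier (SymAlg scale)"
      unfolding G using rat idl_gen rat_poly_funs by auto
    interpret I: ideal "I_X scale X" "SymAlg scale"
      unfolding I_X_def by (rule A.genideal_ideal[OF sub])
    have GI: "?G \<subseteq> I_X scale X" unfolding I_X_def by (rule A.genideal_self[OF sub])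
    show ?thesis using that
    proof (induction rule: idl.induct)
      case idl_0
      show ?case using I.zero_closed unfolding zero .
    next
      case (idl_step p s h)
      have "restrict s U \<in> I_X scale X" using GI idl_step.hyps(2) unfolding G by blast
      moreover have "restrict p U \<in> carrier (SymAlg scale)" using rat_poly_funs[OF idl_step.hyps(1)] by simp
      ultimately have "restrict p U \<otimes>\<^bsub>SymAlg scale\<^esub> restrict s U \<in> I_X scale X"
        by (rule I.I_l_closed)
      from I.a_closed[OF this idl_step.IH]
      have "(\<lambda>\<phi>\<in>U. (\<lambda>\<phi>\<in>U. restrict p U \<phi> * restrict s U \<phi>) \<phi> + restrict h U \<phi>) \<in> I_X scale X"
        unfolding add mult .
      moreover have "(\<lambda>\<phi>\<in>U. (\<lambda>\<phi>\<in>U. restrict p U \<phi> * restrict s U \<phi>) \<phi> + restrict h U \<phi>) =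
          (\<lambda>\<phi>\<in>U. p \<phi> * s \<phi> + h \<phi>)" by (rule restrict_ext) simp
      ultimately show ?case by (simp only:)
    qed
  qed
  ultimately show ?thesis by blast
qed

lemma poly_normal_form:
  assumes "f \<in> rat {}"
  obtains h c where "h \<in> idl cocircuit_gens"
    "\<forall>\<phi>\<in>U. f \<phi> = h \<phi> + (\<Sum>b\<in>X_bases. c b * monom_at ((!) X) ({..<length X} - X_brk b) \<phi>)"
  using bases_spanning[OF assms, of "(!) X" "length X" "{}"] by blast

lemma over_d_in_Rlow_iff:
  assumes "f \<in> poly_funs scale"
  shows "over_d f \<in> Rlow \<longleftrightarrow> f \<in> I_X scale X"
proof
  assume f: "over_d f \<in> Rlow"
  let ?M = "\<lambda>c \<phi>. \<Sum>b\<in>X_bases. c b * monom_at ((!) X) ({..<length X} - X_brk b) \<phi>"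
  obtain h c where h: "h \<in> idl cocircuit_gens" "\<forall>\<phi>\<in>U. f \<phi> = h \<phi> + ?M c \<phi>"
    by (rule poly_normal_form[OF poly_funs_rat[OF assms]])
  have "over_d (?M c) = over_d (\<lambda>\<phi>. f \<phi> + (-1) * h \<phi>)"
    using h(2) by (intro over_d_cong) simp
  also have "\<dots> \<in> Rlow"
    unfolding over_d_add by (intro Rlow_add f over_d_idl idl_mult h(1) rat_const)
  finally have "c b = 0" if "b \<in> X_bases" for b
    using that by (rule over_d_independent)
  then have "f = restrict h U"
    using h(2) by (subst restrict_poly_funs[OF assms, symmetric]) (intro restrict_ext, simp)
  then show "f \<in> I_X scale X" unfolding I_X_eq using h(1) by blast
next
  assume "f \<in> I_X scale X"
  then obtain h where h: "h \<in> idl cocircuit_gens" "f = restrict h U" unfolding I_X_eq by blast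
  have "over_d f = over_d h" by (rule over_d_cong) (simp add: h(2))
  with over_d_idl[OF h(1)] show "over_d f \<in> Rlow" by simp
qed

section \<open>The quotient P_X and the cyclic module Q_X\<close>

text \<open>This is the map f -> f u_X on total functions. Its image is Q_X and its kernel, on
  polynomial functions, the annihilator of u_X, so computations in the quotient are reduced to
  polynomials.\<close>

definition cls :: "(('v \<Rightarrow> complex) \<Rightarrow> complex) \<Rightarrow> (('v \<Rightarrow> complex) \<Rightarrow> complex) set" where
  "cls f = to_P scale X (over_d f)"

lemma Rlow_abelian_subgroup: "abelian_subgroup Rlow (R_X scale X)"
proof (rule abelian_subgroupI3[OF additive_subgroupI R_abelian_group])
  interpret R: abelian_group "R_X scale X" by (rule R_abelian_group)
  show "subgroup Rlow (add_monoid (R_X scale X))"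
  proof (rule group.subgroupI[OF R.a_group])
    show "Rlow \<subseteq> carrier (add_monoid (R_X scale X))" using Rlow_carrier by auto
    show "Rlow \<noteq> {}" using Rlow_0 by blast
    fix r assume r: "r \<in> Rlow"
    let ?s = "\<lambda>\<phi>\<in>Ureg. (-1) * r \<phi>"
    have s: "?s \<in> Rlow" by (rule Rlow_mult[OF r rat_const])
    have "(\<lambda>\<phi>\<in>Ureg. ?s \<phi> + r \<phi>) = (\<lambda>\<phi>\<in>Ureg. 0)" by (rule restrict_ext) simp
    then have "\<ominus>\<^bsub>R_X scale X\<^esub> r = ?s"
      by (intro R.minus_equality Rlow_carrier r s) (simp only: R_ops)
    with s show "inv\<^bsub>add_monoid (R_X scale X)\<^esub> r \<in> Rlow" by (simp only: a_inv_def)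
    fix r' assume "r' \<in> Rlow"
    from Rlow_add[OF r this] show "r \<otimes>\<^bsub>add_monoid (R_X scale X)\<^esub> r' \<in> Rlow"
      by (simp only: monoid.simps R_ops)
  qed
qed

lemma to_P_eq: "to_P scale X r = {\<lambda>\<phi>\<in>Ureg. w \<phi> + r \<phi> | w. w \<in> Rlow}"
  unfolding to_P_def a_r_coset_def' R_ops by auto

lemma to_P_self:
  assumes "r \<in> carrier (R_X scale X)"
  shows "r \<in> to_P scale X r"
proof -
  have "r = (\<lambda>\<phi>\<in>Ureg. (\<lambda>\<phi>\<in>Ureg. 0) \<phi> + r \<phi>)"
    by (subst R_extensional[OF assms, symmetric]) (rule restrict_ext, simp)
  then show ?thesis unfolding to_P_eq using Rlow_0 by blast
qed

lemma to_P_eq_iff: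
  assumes "r \<in> carrier (R_X scale X)" "s \<in> carrier (R_X scale X)"
  shows "to_P scale X r = to_P scale X s \<longleftrightarrow> (\<lambda>\<phi>\<in>Ureg. r \<phi> - s \<phi>) \<in> Rlow"
proof
  assume "to_P scale X r = to_P scale X s"
  then have "r \<in> to_P scale X s" using to_P_self[OF assms(1)] by simp
  then obtain w where w: "w \<in> Rlow" "r = (\<lambda>\<phi>\<in>Ureg. w \<phi> + s \<phi>)" unfolding to_P_eq by blast
  have "(\<lambda>\<phi>\<in>Ureg. r \<phi> - s \<phi>) = restrict w Ureg"
    by (rule restrict_ext) (simp add: w(2))
  with w(1) show "(\<lambda>\<phi>\<in>Ureg. r \<phi> - s \<phi>) \<in> Rlow"
    by (simp only: R_extensional[OF Rlow_carrier[OF w(1)]])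
next
  have sub: "to_P scale X r \<subseteq> to_P scale X s" if d: "(\<lambda>\<phi>\<in>Ureg. r \<phi> - s \<phi>) \<in> Rlow" for r s
  proof
    fix t assume "t \<in> to_P scale X r"
    then obtain w where w: "w \<in> Rlow" "t = (\<lambda>\<phi>\<in>Ureg. w \<phi> + r \<phi>)" unfolding to_P_eq by blast
    have "t = (\<lambda>\<phi>\<in>Ureg. (\<lambda>\<phi>\<in>Ureg. w \<phi> + (\<lambda>\<phi>\<in>Ureg. r \<phi> - s \<phi>) \<phi>) \<phi> + s \<phi>)"
      unfolding w(2) by (rule restrict_ext) simp
    with Rlow_add[OF w(1) d] show "t \<in> to_P scale X s" unfolding to_P_eq by blast
  qed
  assume d: "(\<lambda>\<phi>\<in>Ureg. r \<phi> - s \<phi>) \<in> Rlow"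
  have "(\<lambda>\<phi>\<in>Ureg. (-1) * (\<lambda>\<phi>\<in>Ureg. r \<phi> - s \<phi>) \<phi>) = (\<lambda>\<phi>\<in>Ureg. s \<phi> - r \<phi>)"
    by (rule restrict_ext) simp
  with Rlow_mult[OF d rat_const[of "-1"]] have "(\<lambda>\<phi>\<in>Ureg. s \<phi> - r \<phi>) \<in> Rlow" by (simp only:)
  with sub d show "to_P scale X r = to_P scale X s" by blast
qed

lemma P_ops:
  "\<zero>\<^bsub>P_X scale X\<^esub> = Rlow" "C \<oplus>\<^bsub>P_X scale X\<^esub> C' = C <+>\<^bsub>R_X scale X\<^esub> C'"
  "f \<odot>\<^bsub>P_X scale X\<^esub> C = (\<Union>r\<in>C. to_P scale X (\<lambda>\<phi>\<in>Ureg. f \<phi> * r \<phi>))"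
  by (simp_all add: P_X_def quot_module_def to_P_def)

lemma to_P_zero: "to_P scale X (\<lambda>\<phi>\<in>Ureg. 0) = Rlow"
proof -
  have eq: "(\<lambda>\<phi>\<in>Ureg. w \<phi> + (\<lambda>\<phi>\<in>Ureg. 0) \<phi>) = w" if "w \<in> Rlow" for w
    by (subst (2) R_extensional[OF Rlow_carrier[OF that], symmetric]) (rule restrict_ext, simp)
  show ?thesis
    unfolding to_P_eq Setcompr_eq_image Collect_mem_eq
    by (rule trans[OF image_cong[OF refl eq] image_ident])
qed

lemma to_P_add:
  assumes "r \<in> carrier (R_X scale X)" "s \<in> carrier (R_X scale X)"
  shows "to_P scale X r \<oplus>\<^bsub>P_X scale X\<^esub> to_P scale X s = to_P scale X (\<lambda>\<phi>\<in>Ureg. r \<phi> + s \<phi>)"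
proof -
  interpret abelian_subgroup Rlow "R_X scale X" by (rule Rlow_abelian_subgroup)
  show ?thesis using a_rcos_sum[OF assms] by (simp only: P_ops to_P_def R_ops)
qed

text \<open>The action on cosets is a union over representatives. All cosets in that union coincide
  because R_{X,s-1} is stable under polynomial multiplication.\<close>

lemma to_P_smult:
  assumes "r \<in> carrier (R_X scale X)" "f \<in> rat {}"
  shows "f \<odot>\<^bsub>P_X scale X\<^esub> to_P scale X r = to_P scale X (\<lambda>\<phi>\<in>Ureg. f \<phi> * r \<phi>)"
proof -
  have "to_P scale X (\<lambda>\<phi>\<in>Ureg. f \<phi> * s \<phi>) = to_P scale X (\<lambda>\<phi>\<in>Ureg. f \<phi> * r \<phi>)"
    if s: "s \<in> to_P scale X r" for s
  proof -
    obtain w where w: "w \<in> Rlow" "s = (\<lambda>\<phi>\<in>Ureg. w \<phi> + r \<phi>)" using s unfolding to_P_eq by blast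
    have s_carrier: "s \<in> carrier (R_X scale X)"
      unfolding w(2) by (intro R_add Rlow_carrier w(1) assms(1))
    have "(\<lambda>\<phi>\<in>Ureg. (\<lambda>\<phi>\<in>Ureg. f \<phi> * s \<phi>) \<phi> - (\<lambda>\<phi>\<in>Ureg. f \<phi> * r \<phi>) \<phi>) =
        (\<lambda>\<phi>\<in>Ureg. f \<phi> * w \<phi>)"
      by (rule restrict_ext) (simp add: w(2) algebra_simps)
    with Rlow_mult[OF w(1) assms(2)] show ?thesis
      unfolding to_P_eq_iff[OF R_mult[OF s_carrier assms(2)] R_mult[OF assms]] by (simp only:)
  qed
  then show ?thesis unfolding P_ops using to_P_self[OF assms(1)] by blast
qed

lemma cls_add:
  assumes "f \<in> rat {}" "g \<in> rat {}"
  shows "cls f \<oplus>\<^bsub>P_X scale X\<^esub> cls g = cls (\<lambda>\<phi>. f \<phi> + g \<phi>)"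
  unfolding cls_def over_d_add by (intro to_P_add over_d_carrier assms)

lemma cls_smult:
  assumes "f \<in> rat {}" "g \<in> rat {}"
  shows "f \<odot>\<^bsub>P_X scale X\<^esub> cls g = cls (\<lambda>\<phi>. f \<phi> * g \<phi>)"
proof -
  have "(\<lambda>\<phi>\<in>Ureg. f \<phi> * over_d g \<phi>) = over_d (\<lambda>\<phi>. f \<phi> * g \<phi>)"
    unfolding over_d_def by (rule restrict_ext) simp
  then show ?thesis
    unfolding cls_def to_P_smult[OF over_d_carrier[OF assms(2)] assms(1)] by (simp only:)
qed

lemma cls_cong: "(\<And>\<phi>. \<phi> \<in> U \<Longrightarrow> f \<phi> = g \<phi>) \<Longrightarrow> cls f = cls g"
  unfolding cls_def by (subst over_d_cong) auto

lemma cls_eq_iff: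
  assumes "f \<in> rat {}" "g \<in> rat {}"
  shows "cls f = cls g \<longleftrightarrow> over_d (\<lambda>\<phi>. f \<phi> - g \<phi>) \<in> Rlow"
proof -
  have "(\<lambda>\<phi>\<in>Ureg. over_d f \<phi> - over_d g \<phi>) = over_d (\<lambda>\<phi>. f \<phi> - g \<phi>)"
    unfolding over_d_def by (rule restrict_ext) (simp add: left_diff_distrib)
  then show ?thesis
    unfolding cls_def to_P_eq_iff[OF over_d_carrier[OF assms(1)] over_d_carrier[OF assms(2)]] by (simp only:)
qed

lemma cls_0: "cls (\<lambda>\<phi>. 0) = Rlow"
proof -
  have "over_d (\<lambda>\<phi>. 0) = (\<lambda>\<phi>\<in>Ureg. 0)" unfolding over_d_def by (rule restrict_ext) simp
  then show ?thesis unfolding cls_def by (simp only: to_P_zero)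
qed

lemma cls_zero_iff:
  assumes "f \<in> rat {}"
  shows "cls f = Rlow \<longleftrightarrow> over_d f \<in> Rlow"
  using cls_eq_iff[OF assms rat_const[of 0]] unfolding cls_0 by simp

lemma u_X_eq: "u_X scale X = cls (\<lambda>\<phi>. 1)"
proof -
  have "(\<lambda>\<phi>\<in>Ureg. inverse (d_X scale X \<phi>)) = over_d (\<lambda>\<phi>. 1)"
    unfolding over_d_def by (rule restrict_ext) (simp add: d_X_eq Ureg_dual)
  then show ?thesis unfolding u_X_def cls_def by (simp only:)
qed

lemma smult_u_X: "f \<in> poly_funs scale \<Longrightarrow> f \<odot>\<^bsub>P_X scale X\<^esub> u_X scale X = cls f"
  unfolding u_X_eq by (simp add: cls_smult poly_funs_rat rat_const)

lemma carrier_Q: "carrier (Q_X scale X) = cls ` poly_funs scale"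
proof -
  have "carrier (Q_X scale X) = (\<lambda>f. f \<odot>\<^bsub>P_X scale X\<^esub> u_X scale X) ` poly_funs scale"
    unfolding Q_X_def cyclic_submodule_def by auto
  also have "\<dots> = cls ` poly_funs scale" by (intro image_cong smult_u_X refl)
  finally show ?thesis .
qed

lemma cls_carrier_Q: "f \<in> rat {} \<Longrightarrow> cls f \<in> carrier (Q_X scale X)"
  unfolding carrier_Q using rat_poly_funs[of f] by (intro image_eqI[of _ _ "restrict f U"] cls_cong) auto

lemma carrier_QE:
  assumes "C \<in> carrier (Q_X scale X)"
  obtains f where "f \<in> rat {}" "C = cls f"
  using assms poly_funs_rat unfolding carrier_Q by blast

lemma Q_ops: "\<zero>\<^bsub>Q_X scale X\<^esub> = Rlow" "C \<oplus>\<^bsub>Q_X scale X\<^esub> C' = C \<oplus>\<^bsub>P_X scale X\<^esub> C'"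
  "f \<odot>\<^bsub>Q_X scale X\<^esub> C = f \<odot>\<^bsub>P_X scale X\<^esub> C"
  by (simp_all add: Q_X_def cyclic_submodule_def P_ops)

text \<open>This makes finite sums in Q_X computable. Each law is transferred from functions, since
  \<open>cls\<close> is additive and onto.\<close>

lemma Q_abelian_monoid: "abelian_monoid (Q_X scale X)"
proof (rule abelian_monoidI)
  show "\<zero>\<^bsub>Q_X scale X\<^esub> \<in> carrier (Q_X scale X)"
    using cls_carrier_Q[OF rat_const[of 0]] by (simp only: Q_ops cls_0)
  fix C C' assume C: "C \<in> carrier (Q_X scale X)" and C': "C' \<in> carrier (Q_X scale X)"
  obtain f where f: "f \<in> rat {}" "C = cls f" using carrier_QE[OF C] .
  obtain g where g: "g \<in> rat {}" "C' = cls g" using carrier_QE[OF C'] .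
  show "C \<oplus>\<^bsub>Q_X scale X\<^esub> C' \<in> carrier (Q_X scale X)"
    using f g by (simp add: Q_ops cls_add cls_carrier_Q rat_add)
  show "C \<oplus>\<^bsub>Q_X scale X\<^esub> C' = C' \<oplus>\<^bsub>Q_X scale X\<^esub> C"
    using f g by (simp add: Q_ops cls_add add.commute)
  show "\<zero>\<^bsub>Q_X scale X\<^esub> \<oplus>\<^bsub>Q_X scale X\<^esub> C = C"
    using cls_add[OF rat_const[of 0] f(1)] f(2) by (simp add: Q_ops cls_0)
  fix C'' assume C'': "C'' \<in> carrier (Q_X scale X)"
  obtain h where h: "h \<in> rat {}" "C'' = cls h" using carrier_QE[OF C''] .
  show "C \<oplus>\<^bsub>Q_X scale X\<^esub> C' \<oplus>\<^bsub>Q_X scale X\<^esub> C'' = C \<oplus>\<^bsub>Q_X scale X\<^esub> (C' \<oplus>\<^bsub>Q_X scale X\<^esub> C'')"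
    using f g h by (simp add: Q_ops cls_add rat_add add.assoc)
qed

lemma lin_comb_Q:
  assumes "finite J" "\<And>i. i \<in> J \<Longrightarrow> f i \<in> rat {}"
  shows "lin_comb scale (Q_X scale X) J c (\<lambda>i. cls (f i)) = cls (\<lambda>\<phi>. \<Sum>i\<in>J. c i * f i \<phi>)"
  using assms
proof (induction J rule: finite_induct)
  interpret Q: abelian_monoid "Q_X scale X" by (rule Q_abelian_monoid)
  case empty
  show ?case by (simp add: lin_comb_def cls_0 Q_ops)
next
  interpret Q: abelian_monoid "Q_X scale X" by (rule Q_abelian_monoid)
  case (insert i J)
  have sm: "const_fun scale (c j) \<odot>\<^bsub>Q_X scale X\<^esub> cls (f j) = cls (\<lambda>\<phi>. c j * f j \<phi>)" if "j \<in> insert i J" for j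
  proof -
    have "const_fun scale (c j) \<odot>\<^bsub>Q_X scale X\<^esub> cls (f j) = cls (\<lambda>\<phi>. const_fun scale (c j) \<phi> * f j \<phi>)"
      unfolding Q_ops by (rule cls_smult[OF poly_funs_rat[OF poly_funs.const] insert.prems[OF that]])
    also have "\<dots> = cls (\<lambda>\<phi>. c j * f j \<phi>)" by (rule cls_cong) (simp add: const_fun_def)
    finally show ?thesis .
  qed
  have cl: "cls (\<lambda>\<phi>. c j * f j \<phi>) \<in> carrier (Q_X scale X)" if "j \<in> insert i J" for j
    using that insert.prems by (intro cls_carrier_Q rat_mult rat_const) auto
  have "lin_comb scale (Q_X scale X) (insert i J) c (\<lambda>i. cls (f i)) =
      const_fun scale (c i) \<odot>\<^bsub>Q_X scale X\<^esub> cls (f i) \<oplus>\<^bsub>Q_X scale X\<^esub> lin_comb scale (Q_X scale X) J c (\<lambda>i. cls (f i))"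
    unfolding lin_comb_def using insert.hyps sm cl by (intro Q.finsum_insert) auto
  also have "\<dots> = cls (\<lambda>\<phi>. c i * f i \<phi>) \<oplus>\<^bsub>P_X scale X\<^esub> cls (\<lambda>\<phi>. \<Sum>i\<in>J. c i * f i \<phi>)"
    using insert.IH insert.prems sm by (simp add: Q_ops(2))
  also have "\<dots> = cls (\<lambda>\<phi>. c i * f i \<phi> + (\<Sum>i\<in>J. c i * f i \<phi>))"
    using insert.prems by (intro cls_add rat_sum rat_mult rat_const) auto
  finally show ?case using insert.hyps by simp
qed

lemma annihilator_eq: "annihilator_of (SymAlg scale) (P_X scale X) (u_X scale X) = I_X scale X"
proof -
  have "I_X scale X \<subseteq> poly_funs scale"
  proof
    fix f assume "f \<in> I_X scale X"
    then obtain h where h: "h \<in> idl cocircuit_gens" "f = restrict h U" unfolding I_X_eq by blast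
    have "h \<in> rat {}" using h(1)
      by (induction rule: idl.induct)
        (auto simp: gens_def intro!: rat_const rat_add rat_mult monom_at_rat)
    then show "f \<in> poly_funs scale" unfolding h(2) by (rule rat_poly_funs)
  qed
  moreover have "f \<odot>\<^bsub>P_X scale X\<^esub> u_X scale X = \<zero>\<^bsub>P_X scale X\<^esub> \<longleftrightarrow> f \<in> I_X scale X"
    if "f \<in> poly_funs scale" for f
    unfolding smult_u_X[OF that] P_ops(1) cls_zero_iff[OF poly_funs_rat[OF that]] over_d_in_Rlow_iff[OF that] ..
  ultimately show ?thesis unfolding annihilator_of_def carrier_SymAlg by blast
qed

lemma basis_Q: "basis_family scale (Q_X scale X) (extracted_bases scale X) (u_basis scale X)"
proof -
  let ?M = "\<lambda>b. monom_at ((!) X) ({..<length X} - X_brk b)"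
  have u: "u_basis scale X b = cls (?M b)" if "b \<in> X_bases" for b
  proof -
    have "u_basis scale X b = cls (restrict (?M b) U)"
      unfolding u_basis_def breaking_eq[OF that] sublist_prod_eq idx_def
      by (intro smult_u_X rat_poly_funs monom_at_rat)
    also have "\<dots> = cls (?M b)" by (rule cls_cong) simp
    finally show ?thesis .
  qed
  interpret Q: abelian_monoid "Q_X scale X" by (rule Q_abelian_monoid)
  have comb: "lin_comb scale (Q_X scale X) X_bases c (u_basis scale X) = cls (\<lambda>\<phi>. \<Sum>b\<in>X_bases. c b * ?M b \<phi>)" for c
  proof -
    have "lin_comb scale (Q_X scale X) X_bases c (u_basis scale X) =
        lin_comb scale (Q_X scale X) X_bases c (\<lambda>b. cls (?M b))"
      unfolding lin_comb_def
    \<comment> \<open>The elements u_b are known as classes only for actual bases, so the summands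
      are compared on the index set alone.\<close>
    proof (rule Q.finsum_cong'[OF refl])
      have "const_fun scale (c b) \<odot>\<^bsub>Q_X scale X\<^esub> cls (?M b) = cls (\<lambda>\<phi>. const_fun scale (c b) \<phi> * ?M b \<phi>)" for b
        unfolding Q_ops by (rule cls_smult[OF poly_funs_rat[OF poly_funs.const] monom_at_rat])
      then show "(\<lambda>b. const_fun scale (c b) \<odot>\<^bsub>Q_X scale X\<^esub> cls (?M b)) \<in> X_bases \<rightarrow> carrier (Q_X scale X)"
        using cls_carrier_Q[OF rat_mult[OF poly_funs_rat[OF poly_funs.const] monom_at_rat]] by auto
    qed (simp add: u)
    also have "\<dots> = cls (\<lambda>\<phi>. \<Sum>b\<in>X_bases. c b * ?M b \<phi>)"
      by (intro lin_comb_Q monom_at_rat) simp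
    finally show ?thesis .
  qed
  have rat: "(\<lambda>\<phi>. \<Sum>b\<in>X_bases. c b * ?M b \<phi>) \<in> rat {}" for c
    by (intro rat_sum rat_mult rat_const monom_at_rat)
  show ?thesis
    unfolding basis_family_def extracted_bases_eq comb Q_ops(1) cls_zero_iff[OF rat]
  proof (intro conjI ballI allI impI)
    show "u_basis scale X b \<in> carrier (Q_X scale X)" if "b \<in> X_bases" for b
      unfolding u[OF that] by (intro cls_carrier_Q monom_at_rat)
    fix C assume "C \<in> carrier (Q_X scale X)"
    then obtain f where f: "f \<in> rat {}" "C = cls f" by (rule carrier_QE)
    obtain h c where h: "h \<in> idl cocircuit_gens" "\<forall>\<phi>\<in>U. f \<phi> = h \<phi> + (\<Sum>b\<in>X_bases. c b * ?M b \<phi>)"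
      by (rule poly_normal_form[OF f(1)])
    have "over_d (\<lambda>\<phi>. f \<phi> - (\<Sum>b\<in>X_bases. c b * ?M b \<phi>)) = over_d h"
      using h(2) by (intro over_d_cong) simp
    then have "C = cls (\<lambda>\<phi>. \<Sum>b\<in>X_bases. c b * ?M b \<phi>)"
      unfolding f(2) cls_eq_iff[OF f(1) rat] using over_d_idl[OF h(1)] by simp
    then show "\<exists>c. C = cls (\<lambda>\<phi>. \<Sum>b\<in>X_bases. c b * ?M b \<phi>)" by blast
  qed (auto dest: over_d_independent)
qed

section \<open>The graded isomorphism\<close>

abbreviation "A \<equiv> SymAlg scale"
abbreviation "coset f \<equiv> I_X scale X +>\<^bsub>A\<^esub> f"

lemma ideal_I_X: "ideal (I_X scale X) A"
proof -
  interpret A: cring A by (rule cring_SymAlg)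
  show ?thesis unfolding I_X_def
    using rat_poly_funs[OF monom_at_rat] by (intro A.genideal_ideal) (auto simp only: sublist_prod_eq carrier_SymAlg)
qed

lemma SymAlg_ops: "f \<oplus>\<^bsub>A\<^esub> g = (\<lambda>\<phi>\<in>U. f \<phi> + g \<phi>)" "f \<otimes>\<^bsub>A\<^esub> g = (\<lambda>\<phi>\<in>U. f \<phi> * g \<phi>)"
  by (simp_all add: SymAlg_def)

lemma coset_eq: "coset f = {\<lambda>\<phi>\<in>U. i \<phi> + f \<phi> | i. i \<in> I_X scale X}"
  unfolding a_r_coset_def' SymAlg_ops by auto

lemma A_X_ops:
  "carrier (A_X scale X) = coset ` poly_funs scale"
  "C \<oplus>\<^bsub>A_X scale X\<^esub> C' = C <+>\<^bsub>A\<^esub> C'"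
  "f \<odot>\<^bsub>A_X scale X\<^esub> C = rcoset_mult A (I_X scale X) (coset f) C"
  by (auto simp: A_X_def quot_ring_module_def ring.defs module.defs FactRing_def A_RCOSETS_def')

lemma cls_eqI:
  assumes "f \<in> poly_funs scale" "g \<in> coset f"
  shows "cls g = cls f"
proof -
  obtain i where i: "i \<in> I_X scale X" "g = (\<lambda>\<phi>\<in>U. i \<phi> + f \<phi>)" using assms(2) unfolding coset_eq by blast
  have i_poly: "i \<in> poly_funs scale"
    using i(1) annihilator_eq unfolding annihilator_of_def carrier_SymAlg by blast
  have "cls g = cls (\<lambda>\<phi>. i \<phi> + f \<phi>)" by (rule cls_cong) (simp add: i(2))
  also have "\<dots> = cls f"
    using over_d_in_Rlow_iff[OF i_poly] i(1) poly_funs_rat[OF i_poly] poly_funs_rat[OF assms(1)]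
    by (subst cls_eq_iff) (simp_all add: rat_add)
  finally show ?thesis .
qed

text \<open>The difference f - g, restricted to the dual, lies in I_X exactly when its quotient by
  d_X lies in R_{X,s-1}; this gives injectivity of A_X -> Q_X.\<close>

lemma coset_eq_iff:
  assumes "f \<in> poly_funs scale" "g \<in> poly_funs scale"
  shows "coset f = coset g \<longleftrightarrow> cls f = cls g"
proof
  interpret I: ideal "I_X scale X" A by (rule ideal_I_X)
  have self: "f \<in> coset f" using assms(1) by (intro I.a_rcos_self) simp
  show "cls f = cls g" if "coset f = coset g"
    using cls_eqI[OF assms(2), of f] self that by simp
  assume "cls f = cls g"
  let ?i = "restrict (\<lambda>\<phi>. f \<phi> - g \<phi>) U"
  note rat = poly_funs_rat[OF assms(1)] poly_funs_rat[OF assms(2)]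
  have "over_d ?i = over_d (\<lambda>\<phi>. f \<phi> - g \<phi>)" by (rule over_d_cong) simp
  then have "?i \<in> I_X scale X"
    using \<open>cls f = cls g\<close> over_d_in_Rlow_iff[OF rat_poly_funs[OF rat_diff[OF rat]]]
    unfolding cls_eq_iff[OF rat] by simp
  moreover have "f = (\<lambda>\<phi>\<in>U. ?i \<phi> + g \<phi>)"
    by (subst restrict_poly_funs[OF assms(1), symmetric]) (rule restrict_ext, simp)
  ultimately have "f \<in> coset g" unfolding coset_eq by blast
  then show "coset f = coset g" using I.a_repr_independence'[of f g] assms(2) by simp
qed

text \<open>R_{X,s-1} is a graded subspace: the denominator of a generator is homogeneous, and
  replacing its numerator by a component leaves the set of denominators unchanged. Components are
  total functions, so membership is tested after restriction.\<close>

lemma graded_sum_Rlow: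
  assumes "r \<in> Rlow"
  shows "\<exists>F I. graded_sum Ureg {r. restrict r Ureg \<in> Rlow} r F I"
  using assms
proof (induction rule: Rlow_induct)
  case zero
  have "graded_sum Ureg {r. restrict r Ureg \<in> Rlow} (\<lambda>\<phi>\<in>Ureg. 0) (\<lambda>d \<phi>. 0) {}"
    using Rlow_0 by (simp only: graded_sum_def) simp
  then show ?case by (intro exI)
next
  case (step g r)
  let ?W = "{r. restrict r Ureg \<in> Rlow}"
  obtain f h where f: "f \<in> rat {}" "span ((!) X ` {i. i < length X \<and> 0 < h i}) \<noteq> UNIV"
    "g = (\<lambda>\<phi>\<in>Ureg. f \<phi> * (\<Prod>i<length X. \<phi> (X ! i) powi (- int (h i))))"
    using step.hyps(1) unfolding frac_gens_def by blast
  obtain F I where F: "graded_sum U (rat {}) f F I" using poly_graded[OF f(1)] by (elim exE)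
  have "graded_sum Ureg (rat {}) f F I"
    using F Ureg_dual unfolding graded_sum_def by (auto intro: homogeneous_on_mono[of U])
  moreover have "homogeneous_on Ureg (\<Sum>i<length X. 1 * - int (h i))
      (\<lambda>\<phi>. \<Prod>i<length X. \<phi> (X ! i) powi (- int (h i)))"
    by (intro homogeneous_on_prod homogeneous_on_power_int) (simp add: homogeneous_on_def)
  moreover have "(\<lambda>\<phi>. (\<Prod>i<length X. \<phi> (X ! i) powi (- int (h i))) * f' \<phi>) \<in> ?W" if "f' \<in> rat {}" for f'
    using Rlow_gen[OF frac_gensI[OF that f(2)]] by (simp add: mult.commute)
  ultimately have "\<exists>F I. graded_sum Ureg ?W (\<lambda>\<phi>. (\<Prod>i<length X. \<phi> (X ! i) powi (- int (h i))) * f \<phi>) F I"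
    by (intro exI, rule graded_sum_mult)
  then obtain G J where "graded_sum Ureg ?W (\<lambda>\<phi>. (\<Prod>i<length X. \<phi> (X ! i) powi (- int (h i))) * f \<phi>) G J"
    by (elim exE)
  moreover obtain H K where "graded_sum Ureg ?W r H K" using step.IH by (elim exE)
  moreover have "(\<lambda>\<phi>. f \<phi> + g \<phi>) \<in> ?W" if "f \<in> ?W" "g \<in> ?W" for f g
  proof -
    have "(\<lambda>\<phi>\<in>Ureg. restrict f Ureg \<phi> + restrict g Ureg \<phi>) = (\<lambda>\<phi>\<in>Ureg. f \<phi> + g \<phi>)"
      by (rule restrict_ext) simp
    with Rlow_add[of "restrict f Ureg" "restrict g Ureg"] that show ?thesis by (simp only: mem_Collect_eq)
  qed
  ultimately have "graded_sum Ureg ?W (\<lambda>\<phi>. (\<Prod>i<length X. \<phi> (X ! i) powi (- int (h i))) * f \<phi> + r \<phi>)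
      (\<lambda>d \<phi>. G d \<phi> + H d \<phi>) (J \<union> K)" by (rule graded_sum_add)
  then have "graded_sum Ureg ?W (\<lambda>\<phi>\<in>Ureg. g \<phi> + r \<phi>) (\<lambda>d \<phi>. G d \<phi> + H d \<phi>) (J \<union> K)"
    unfolding graded_sum_def by (simp add: f(3) mult.commute)
  then show ?case by (intro exI)
qed

lemma homogeneous_inverse_d:
  "homogeneous_on Ureg (- int (length X)) (\<lambda>\<phi>. inverse (\<Prod>i<length X. \<phi> (X ! i)))"
proof -
  have "homogeneous_on Ureg (\<Sum>i<length X. 1 * - 1) (\<lambda>\<phi>. \<Prod>i<length X. \<phi> (X ! i) powi - 1)"
    by (intro homogeneous_on_prod homogeneous_on_power_int) (simp add: homogeneous_on_def)
  then show ?thesis by (simp add: power_int_minus prod_inversef[symmetric] comp_def)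
qed

text \<open>The difference f / d_X - r lies in the graded subspace R_{X,s-1}, hence so does its
  component of degree d - N. As r is homogeneous of that degree, the degree d part of f has the same
  class as r.\<close>

lemma homogeneous_component:
  assumes f: "f \<in> rat {}" and r: "r \<in> R_X_deg scale X d" and eq: "cls f = to_P scale X r"
  shows "\<exists>f'\<in>SymAlg_deg scale d. cls f' = cls f"
proof -
  let ?N = "int (length X)" and ?i = "\<lambda>\<phi>. inverse (\<Prod>i<length X. \<phi> (X ! i))"
  have rc: "r \<in> carrier (R_X scale X)" and rh: "homogeneous_on Ureg (d - ?N) r"
    using r by (simp_all add: R_X_deg_def)
  obtain F I where F: "graded_sum U (rat {}) f F I" using poly_graded[OF f] by (elim exE)
  have "graded_sum Ureg UNIV f F I"
    using F Ureg_dual unfolding graded_sum_def by (auto intro: homogeneous_on_mono[of U])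
  from graded_sum_mult[OF this homogeneous_inverse_d UNIV_I]
  have 1: "graded_sum Ureg UNIV (\<lambda>\<phi>. ?i \<phi> * f \<phi>) (\<lambda>k \<phi>. ?i \<phi> * F (k - - ?N) \<phi>) ((+) (- ?N) ` I)" .
  have "homogeneous_on Ureg (d - ?N) (\<lambda>\<phi>. - r \<phi>)" using rh by (simp add: homogeneous_on_def)
  from graded_sum_add[OF 1 graded_sum_single[OF this UNIV_I UNIV_I] UNIV_I]
  obtain J where 2: "graded_sum Ureg UNIV (\<lambda>\<phi>. ?i \<phi> * f \<phi> + - r \<phi>)
      (\<lambda>k \<phi>. ?i \<phi> * F (k - - ?N) \<phi> + (if k = d - ?N then \<lambda>\<phi>. - r \<phi> else (\<lambda>\<phi>. 0)) \<phi>) J"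
    by blast
  have low: "(\<lambda>\<phi>\<in>Ureg. over_d f \<phi> - r \<phi>) \<in> Rlow"
    using eq unfolding cls_def to_P_eq_iff[OF over_d_carrier[OF f] rc] .
  obtain G K where 3: "graded_sum Ureg {r. restrict r Ureg \<in> Rlow} (\<lambda>\<phi>\<in>Ureg. over_d f \<phi> - r \<phi>) G K"
    using graded_sum_Rlow[OF low] by (elim exE)
  have fin: "finite (J \<union> K)" using 2 3 by (simp add: graded_sum_def)
  \<comment> \<open>At degree d - N the shifted index k - (-N) is d, so this component contains the
    degree d part of f over d_X together with all of -r.\<close>
  have comp: "?i \<phi> * F d \<phi> + - r \<phi> = G (d - ?N) \<phi>" if "\<phi> \<in> Ureg" for \<phi>
    using graded_sum_unique[OF graded_sum_mono_index[OF 2 _ fin] graded_sum_mono_index[OF 3 _ fin] _ that Ureg_mult,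
        of "d - ?N"]
    by (simp add: over_d_def mult.commute)
  have Fd: "F d \<in> rat {}" "homogeneous_on U d (F d)" using F by (simp_all add: graded_sum_def)
  have "(\<lambda>\<phi>\<in>Ureg. over_d (F d) \<phi> - r \<phi>) = restrict (G (d - ?N)) Ureg"
    by (rule restrict_ext) (simp add: comp[symmetric] over_d_def mult.commute)
  also have "\<dots> \<in> Rlow" using 3 by (simp add: graded_sum_def)
  finally have "cls (F d) = to_P scale X r"
    unfolding cls_def to_P_eq_iff[OF over_d_carrier[OF Fd(1)] rc] .
  moreover have "cls (restrict (F d) U) = cls (F d)" by (rule cls_cong) simp
  moreover have "restrict (F d) U \<in> SymAlg_deg scale d"
    unfolding SymAlg_deg_def carrier_SymAlg
    using rat_poly_funs[OF Fd(1)] homogeneous_on_cong[OF Fd(2), of "restrict (F d) U"] dual_mult by auto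
  ultimately show ?thesis using eq by (intro bexI[of _ "restrict (F d) U"]) simp_all
qed

text \<open>Division by d_X lowers the degree by N, which the shift in \<open>R_X_deg\<close>
  compensates. The substantial inclusion is that a homogeneous class has a homogeneous polynomial
  representative.\<close>

lemma Q_X_deg_eq: "Q_X_deg scale X d = cls ` SymAlg_deg scale d"
proof (intro equalityI subsetI)
  fix C assume "C \<in> Q_X_deg scale X d"
  then obtain r where r: "C \<in> carrier (Q_X scale X)" "r \<in> R_X_deg scale X d" "C = to_P scale X r"
    unfolding Q_X_deg_def P_X_deg_def by blast
  obtain f where f: "f \<in> rat {}" "C = cls f" using carrier_QE[OF r(1)] .
  obtain f' where "f' \<in> SymAlg_deg scale d" "cls f' = cls f"
    using homogeneous_component[OF f(1) r(2)] r(3) f(2) by auto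
  with f(2) show "C \<in> cls ` SymAlg_deg scale d" by auto
next
  fix C assume "C \<in> cls ` SymAlg_deg scale d"
  then obtain f where f: "f \<in> poly_funs scale" "homogeneous_on U d f" "C = cls f"
    unfolding SymAlg_deg_def carrier_SymAlg by blast
  have "homogeneous_on Ureg d f" using f(2) by (rule homogeneous_on_mono) (auto dest: Ureg_dual)
  from homogeneous_on_mult[OF this homogeneous_inverse_d]
  have "homogeneous_on Ureg (d + - int (length X)) (over_d f)"
  proof (rule homogeneous_on_cong)
    show "f \<phi> * inverse (\<Prod>i<length X. \<phi> (X ! i)) = over_d f \<phi>" if "\<phi> \<in> Ureg" for \<phi>
      unfolding over_d_def restrict_apply'[OF that] ..
  qed (rule Ureg_mult)
  then have "over_d f \<in> R_X_deg scale X d"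
    unfolding R_X_deg_def using over_d_carrier[OF poly_funs_rat[OF f(1)]] by simp
  then show "C \<in> Q_X_deg scale X d"
    unfolding Q_X_deg_def P_X_deg_def using f(3) cls_carrier_Q[OF poly_funs_rat[OF f(1)]]
    by (auto simp: cls_def)
qed

lemma graded_iso:
  "graded_isomorphic A (A_X scale X) (A_X_deg scale X) (Q_X scale X) (Q_X_deg scale X)"
proof -
  interpret I: ideal "I_X scale X" A by (rule ideal_I_X)
  \<comment> \<open>A representative is chosen by \<open>SOME\<close>; by \<open>cls_eqI\<close> its
    class does not depend on the choice.\<close>
  define h where "h C = cls (SOME f. f \<in> C)" for C
  have h: "h (coset f) = cls f" if "f \<in> poly_funs scale" for f
    unfolding h_def
  proof (rule cls_eqI[OF that])
    have "f \<in> coset f" using that by (intro I.a_rcos_self) simp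
    then show "(SOME g. g \<in> coset f) \<in> coset f" by (rule someI[of "\<lambda>g. g \<in> coset f"])
  qed
  have "h \<in> module_isos A (A_X scale X) (Q_X scale X)"
    unfolding module_isos_def mem_Collect_eq
  proof (intro conjI ballI)
    have "inj_on h (coset ` poly_funs scale)"
    proof (rule inj_onI)
      fix C C' assume "C \<in> coset ` poly_funs scale" "C' \<in> coset ` poly_funs scale" "h C = h C'"
      then obtain f g where fg: "f \<in> poly_funs scale" "g \<in> poly_funs scale" "C = coset f" "C' = coset g" by blast
      with \<open>h C = h C'\<close> have "cls f = cls g" by (simp only: h)
      then show "C = C'" unfolding fg(3,4) using coset_eq_iff[OF fg(1,2)] by blast
    qed
    moreover have "h ` coset ` poly_funs scale = cls ` poly_funs scale"
      unfolding image_image using h by (rule image_cong[OF refl])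
    ultimately show "bij_betw h (carrier (A_X scale X)) (carrier (Q_X scale X))"
      unfolding bij_betw_def A_X_ops carrier_Q by simp
  next
    fix C C' assume "C \<in> carrier (A_X scale X)" "C' \<in> carrier (A_X scale X)"
    then obtain f g where f: "f \<in> poly_funs scale" "C = coset f" and g: "g \<in> poly_funs scale" "C' = coset g"
      unfolding A_X_ops by blast
    have sum: "f \<oplus>\<^bsub>A\<^esub> g \<in> poly_funs scale" using I.add.m_closed[of f g] f(1) g(1) by simp
    have "h (C \<oplus>\<^bsub>A_X scale X\<^esub> C') = h (coset (f \<oplus>\<^bsub>A\<^esub> g))"
      unfolding A_X_ops f(2) g(2) using I.a_rcos_sum[of f g] f(1) g(1) by simp
    also have "\<dots> = cls (f \<oplus>\<^bsub>A\<^esub> g)" by (rule h[OF sum])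
    also have "\<dots> = cls (\<lambda>\<phi>. f \<phi> + g \<phi>)" by (rule cls_cong) (simp add: SymAlg_ops)
    also have "\<dots> = h C \<oplus>\<^bsub>Q_X scale X\<^esub> h C'"
      unfolding Q_ops f(2) g(2) h[OF f(1)] h[OF g(1)] by (rule cls_add[symmetric]; intro poly_funs_rat f g)
    finally show "h (C \<oplus>\<^bsub>A_X scale X\<^esub> C') = h C \<oplus>\<^bsub>Q_X scale X\<^esub> h C'" .
  next
    fix f C assume f: "f \<in> carrier A" and "C \<in> carrier (A_X scale X)"
    then obtain g where g: "g \<in> poly_funs scale" "C = coset g"
      unfolding A_X_ops by blast
    have prod: "f \<otimes>\<^bsub>A\<^esub> g \<in> poly_funs scale" using I.m_closed[of f g] f g(1) by simp
    have "h (f \<odot>\<^bsub>A_X scale X\<^esub> C) = h (coset (f \<otimes>\<^bsub>A\<^esub> g))"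
      unfolding A_X_ops g(2) using I.rcoset_mult_add[of f g] f g(1) by simp
    also have "\<dots> = cls (f \<otimes>\<^bsub>A\<^esub> g)" by (rule h[OF prod])
    also have "\<dots> = cls (\<lambda>\<phi>. f \<phi> * g \<phi>)" by (rule cls_cong) (simp add: SymAlg_ops)
    also have "\<dots> = f \<odot>\<^bsub>Q_X scale X\<^esub> h C"
      unfolding Q_ops g(2) h[OF g(1)]
      using f by (intro cls_smult[symmetric] poly_funs_rat g(1)) simp
    finally show "h (f \<odot>\<^bsub>A_X scale X\<^esub> C) = f \<odot>\<^bsub>Q_X scale X\<^esub> h C" .
  qed
  moreover have "h ` A_X_deg scale X d = Q_X_deg scale X d" for d
  proof -
    have "h ` A_X_deg scale X d = cls ` SymAlg_deg scale d"
      unfolding A_X_deg_def image_image by (rule image_cong[OF refl], rule h) (simp add: SymAlg_deg_def)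
    then show ?thesis by (simp only: Q_X_deg_eq)
  qed
  ultimately show ?thesis unfolding graded_isomorphic_def by blast
qed

end

theorem theorem6p3:
  fixes scale :: "complex \<Rightarrow> 'v::ab_group_add \<Rightarrow> 'v"
    and X :: "'v list"
  assumes "vector_space scale"
    and "0 \<notin> set X"
    and "vspan scale (set X) = UNIV"
  shows "annihilator_of (SymAlg scale) (P_X scale X) (u_X scale X) = I_X scale X
       \<and> graded_isomorphic (SymAlg scale)
           (A_X scale X) (A_X_deg scale X) (Q_X scale X) (Q_X_deg scale X)
       \<and> basis_family scale (Q_X scale X) (extracted_bases scale X) (u_basis scale X)"
proof -
  interpret vector_space scale by fact
  interpret vector_config scale X
    using assms(2,3) by unfold_locales
  show ?thesis using annihilator_eq graded_iso basis_Q by blast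
qed

end
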